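(* For all $n\ge 1$, we have $$M(B_n,q)=\sum_{j=0}^{\lfloor (n-1)/2\rfloor}\gamma_{n,j}\,q^j(1+q)^{n-1-2j},$$ where $\gamma_{n,j}$ is the number of words $\mathbf{x}=x_1\cdots x_n\in\mathcal{X}^B_n$ with $\mathrm{exc}(\mathbf{x})=j$ such that $x_1=1$ and $\mathbf{x}$ contains no two consecutive excedances.
   Context: $\mathcal{X}^B_n$ is the set of words $\mathbf{x}=x_1x_2\cdots x_n$ of length $n$ over the alphabet $\{1,\dots,n\}$. A letter $x_i$ is an excedance of $\mathbf{x}$ if $x_i>i$; $\mathrm{exc}(\mathbf{x})$ is the number of excedances of $\mathbf{x}$. Two excedances are consecutive if they are $x_i$ and $x_{i+1}$ for some $i$. $B_n$ is the group of bijections $\omega$ of $\{\pm1,\dots,\pm n\}$ with $\omega(-i)=-\omega(i)$, and $c=(1,2,\dots,n,-1,-2,\dots,-n)$. Its simple generators $S$ are $(1,-1)$ and $(i,i+1)(-i,-(i+1))$ for $1\le i\le n-1$; its set $T$ of reflections consists of $(i,-i)$ for $1\le i\le n$ and $(i,j)(-i,-j)$, $(i,-j)(-i,j)$ for $1\le i<j\le n$. The product $\sigma\tau$ means: first apply $\tau$, then $\sigma$. Let $\ell_S$ (resp. $\ell_T$) be the word length with respect to $S$ (resp. $T$). The absolute order is: $\omega<\omega'$ iff $\omega\ne\omega'$ and $\ell_T(\omega')=\ell_T(\omega)+\ell_T(\omega^{-1}\omega')$. Then $\mathrm{NC}(B_n,c)=\{\omega\in B_n:e\le\omega\le c\}$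 with the absolute order. The (strong) Bruhat order $\le_B$ is the partial order generated by $\omega<_B\omega t$ for $t\in T$ with $\ell_S(\omega)<\ell_S(\omega t)$. For a maximal chain $\mathbf{w}:e=\omega_0<\cdots<\omega_n=c$ in $\mathrm{NC}(B_n,c)$, $\mathrm{bad}(\mathbf{w})$ is the number of $i\in\{1,\dots,n\}$ with $\omega_{i-1}>_B\omega_i$. Define $M(B_n,q)=\sum_{\mathbf{w}}q^{\mathrm{bad}(\mathbf{w})}$, summed over all maximal chains. By a known theorem of Josuat-Vergès, $M(B_n,q)=\prod_{k=0}^{n-1}(n-k+kq)$. *)

theory Defs
  imports "HOL-Computational_Algebra.Polynomial" "HOL-Combinatorics.Combinatorics"
begin

text \<open>Elements of \<open>B\<^sub>n\<close> are represented as functions on all integers which fix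
  every integer outside \<open>{\<plusminus>1, \<dots>, \<plusminus>n}\<close>, so that the group product is \<open>\<circ>\<close>
  (the right factor is applied first), the identity is \<open>id\<close> and inverses are \<open>inv\<close>.\<close>

definition signed_dom :: "nat \<Rightarrow> int set" where
  "signed_dom n = {i. 1 \<le> \<bar>i\<bar> \<and> \<bar>i\<bar> \<le> int n}"

definition B_group :: "nat \<Rightarrow> (int \<Rightarrow> int) set" where
  "B_group n = {w. w permutes signed_dom n \<and> (\<forall>i \<in> signed_dom n. w (- i) = - w i)}"

definition coxeter_elt :: "nat \<Rightarrow> int \<Rightarrow> int" where
  "coxeter_elt n = cycle_of_list ([1..int n] @ map uminus [1..int n])"

definition sign_change :: "int \<Rightarrow> int \<Rightarrow> int" where
  "sign_change i = transpose i (- i)"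

definition paired_transp :: "int \<Rightarrow> int \<Rightarrow> int \<Rightarrow> int" where
  "paired_transp i j = transpose i j \<circ> transpose (- i) (- j)"

definition simple_gens :: "nat \<Rightarrow> (int \<Rightarrow> int) set" where
  "simple_gens n =
     insert (sign_change 1) {paired_transp i (i + 1) | i. 1 \<le> i \<and> i \<le> int n - 1}"

text \<open>\<open>paired_transp i (- j)\<close> is \<open>(i, -j)(-i, j)\<close>.\<close>

definition reflections :: "nat \<Rightarrow> (int \<Rightarrow> int) set" where
  "reflections n =
     {sign_change i | i. 1 \<le> i \<and> i \<le> int n} \<union>
     {paired_transp i j | i j. 1 \<le> i \<and> i < j \<and> j \<le> int n} \<union>
     {paired_transp i (- j) | i j. 1 \<le> i \<and> i < j \<and> j \<le> int n}"

definition word_length :: "('a \<Rightarrow> 'a) set \<Rightarrow> ('a \<Rightarrow> 'a) \<Rightarrow> nat" where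
  "word_length X w = (LEAST k. \<exists>ts. set ts \<subseteq> X \<and> length ts = k \<and> w = foldr (\<circ>) ts id)"

abbreviation len_S :: "nat \<Rightarrow> (int \<Rightarrow> int) \<Rightarrow> nat" where
  "len_S n \<equiv> word_length (simple_gens n)"

abbreviation len_T :: "nat \<Rightarrow> (int \<Rightarrow> int) \<Rightarrow> nat" where
  "len_T n \<equiv> word_length (reflections n)"

definition abs_less :: "nat \<Rightarrow> (int \<Rightarrow> int) \<Rightarrow> (int \<Rightarrow> int) \<Rightarrow> bool" where
  "abs_less n u v \<longleftrightarrow> u \<in> B_group n \<and> v \<in> B_group n \<and> u \<noteq> v \<and>
     len_T n v = len_T n u + len_T n (inv u \<circ> v)"

definition abs_le :: "nat \<Rightarrow> (int \<Rightarrow> int) \<Rightarrow> (int \<Rightarrow> int) \<Rightarrow> bool" where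
  "abs_le n u v \<longleftrightarrow> abs_less n u v \<or> (u \<in> B_group n \<and> u = v)"

definition NC_B :: "nat \<Rightarrow> (int \<Rightarrow> int) set" where
  "NC_B n = {w \<in> B_group n. abs_le n id w \<and> abs_le n w (coxeter_elt n)}"

definition bruhat_step :: "nat \<Rightarrow> (int \<Rightarrow> int) \<Rightarrow> (int \<Rightarrow> int) \<Rightarrow> bool" where
  "bruhat_step n u v \<longleftrightarrow>
     u \<in> B_group n \<and> (\<exists>t \<in> reflections n. v = u \<circ> t \<and> len_S n u < len_S n v)"

definition bruhat_le :: "nat \<Rightarrow> (int \<Rightarrow> int) \<Rightarrow> (int \<Rightarrow> int) \<Rightarrow> bool" where
  "bruhat_le n = (bruhat_step n)\<^sup>*\<^sup>*"

definition bruhat_less :: "nat \<Rightarrow> (int \<Rightarrow> int) \<Rightarrow> (int \<Rightarrow> int) \<Rightarrow> bool" where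
  "bruhat_less n u v \<longleftrightarrow> bruhat_le n u v \<and> u \<noteq> v"

text \<open>A maximal chain is represented by its increasing enumeration
  \<open>\<omega>\<^sub>0 < \<dots> < \<omega>\<^sub>n\<close>, with \<open>\<omega>\<^sub>i = ws ! i\<close>.  As \<open>NC_B n\<close> is
  bounded and graded of rank \<open>n\<close>, the conditions on the length and the end points hold
  for every maximal chain.\<close>

definition max_chains :: "nat \<Rightarrow> (int \<Rightarrow> int) list set" where
  "max_chains n = {ws. length ws = n + 1 \<and> ws ! 0 = id \<and> ws ! n = coxeter_elt n \<and>
     sorted_wrt (abs_less n) ws \<and> pred_on.maxchain (NC_B n) (abs_less n) (set ws)}"

definition bad :: "nat \<Rightarrow> (int \<Rightarrow> int) list \<Rightarrow> nat" where
  "bad n ws = card {i \<in> {1..n}. bruhat_less n (ws ! i) (ws ! (i - 1))}"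

text \<open>\<open>M(B\<^sub>n, q)\<close> as a polynomial in the indeterminate \<open>q\<close>.\<close>

definition M_B :: "nat \<Rightarrow> int poly" where
  "M_B n = (\<Sum>ws \<in> max_chains n. monom 1 (bad n ws))"

text \<open>Words are lists, so the letter \<open>x\<^sub>i\<close> of a word \<open>x\<close> is \<open>x ! (i - 1)\<close>;
  an excedance is recorded by its position \<open>i\<close>.\<close>

definition words_B :: "nat \<Rightarrow> nat list set" where
  "words_B n = {x. length x = n \<and> set x \<subseteq> {1..n}}"

definition excedances :: "nat list \<Rightarrow> nat set" where
  "excedances x = {i \<in> {1..length x}. x ! (i - 1) > i}"

definition exc :: "nat list \<Rightarrow> nat" where
  "exc x = card (excedances x)"

definition no_consecutive_exc :: "nat list \<Rightarrow> bool" where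
  "no_consecutive_exc x \<longleftrightarrow> \<not> (\<exists>i. i \<in> excedances x \<and> i + 1 \<in> excedances x)"

definition gamma_B :: "nat \<Rightarrow> nat \<Rightarrow> nat" where
  "gamma_B n j = card {x \<in> words_B n. exc x = j \<and> x ! 0 = 1 \<and> no_consecutive_exc x}"

end

theory Submission
  imports Defs "HOL-Library.Numeral_Type"
begin

text \<open>
  Both sides are equal to \<open>\<Prod>k<n. n - k + k q\<close>; for the left-hand side this is the theorem of
  Josuat-Verges, which is proved here as well.

  The left-hand side.  A maximal chain of \<open>NC(B\<^sub>n, c)\<close> is a factorisation \<open>c = t\<^sub>1 \<dots> t\<^sub>n\<close> into
  reflections (\<open>max_chains_eq_refl_chains\<close>), and by the strong exchange property the step from
  \<open>w t\<close> to \<open>w\<close>, where \<open>t\<close> interchanges \<open>a < b\<close>, is bad exactly if \<open>w a < w b\<close>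
  (\<open>len_S_less_comp_signed_transp_iff\<close>).  Peel off the reflections from the right.  Every element
  \<open>w\<close> that is met is a product of disjoint cycles which visit their elements in the cyclic order
  \<open>1, \<dots>, n, -1, \<dots>, -n\<close> of \<open>c\<close>: some pairs of opposite cycles \<open>C\<close>, \<open>-C\<close>, as in type A, and
  at most one cycle \<open>B = -B\<close>, as in type B.  This is the notion \<open>config\<close>.  A reflection that
  interchanges two elements of one cycle splits it (and its opposite) in two; no other reflection can be the last factor of a
  shortest factorisation of \<open>w\<close>, as a count of the odd functions fixed by all the factors
  shows (\<open>config_word_same_block\<close>).  As a cycle first rises through positive and then falls through
  negative numbers, the number of splittings into given sizes that reverse the order of the two
  elements depends only on the sizes.  Hence the generating function of the
  factorisations of \<open>w\<close> is \<open>k!\<close> times a product of one number \<open>\<alpha>\<close> for each pair \<open>C\<close>, \<open>-C\<close> and one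
  number \<open>\<beta>\<close> for \<open>B\<close>, where \<open>\<alpha>\<close> and \<open>\<beta>\<close> depend on the sizes of the cycles and satisfy two quadratic
  recurrences (\<open>chain_weight_config\<close>).  Rothe's convolution identity solves the recurrences.  It is
  used for \<open>q = 1 - 1/N\<close> only, where it follows by an induction on differences; infinitely many
  values of \<open>q\<close> determine the polynomial.

  The right-hand side.  A word has \<open>x\<^sub>1 = 1\<close> if and only if \<open>1\<close> is not an excedance.  So the words
  counted by \<open>\<gamma>\<^bsub>n,j\<^esub>\<close> can be built letter by letter, with \<open>i\<close> choices for a non-excedance
  and \<open>n - i\<close> choices for an excedance at \<open>i\<close>.  This gives a three-term recurrence in the length of a
  prefix (\<open>word_weight_recurrence\<close>).  Its solution is an explicit alternating sum, which
  collapses to a product for the prefix of length \<open>n - 1\<close>.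
\<close>

section \<open>Reflections\<close>

text \<open>The reflection of \<open>B\<^sub>n\<close> that interchanges \<open>a\<close> and \<open>b\<close>.  The case \<open>b = -a\<close> is separate because
  \<open>paired_transp a (- a)\<close> composes the same transposition with itself and is the identity.\<close>

definition signed_transp :: "int \<Rightarrow> int \<Rightarrow> int \<Rightarrow> int" where
  "signed_transp a b = (if b = - a then sign_change a else paired_transp a b)"

lemma signed_transp_apply:
  assumes "a \<noteq> b" "a \<noteq> 0" "b \<noteq> 0"
  shows "signed_transp a b x =
    (if x = a then b else if x = b then a else if x = - a then - b else if x = - b then - a else x)"
  using assms by (auto simp: signed_transp_def sign_change_def paired_transp_def transpose_def)

lemma signed_transp_commute: "a \<noteq> b \<Longrightarrow> a \<noteq> 0 \<Longrightarrow> b \<noteq> 0 \<Longrightarrow> signed_transp b a = signed_transp a b"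
  by (rule ext) (auto simp: signed_transp_apply)

lemma signed_transp_uminus: "a \<noteq> b \<Longrightarrow> a \<noteq> 0 \<Longrightarrow> b \<noteq> 0 \<Longrightarrow> signed_transp (- a) (- b) = signed_transp a b"
  by (rule ext) (auto simp: signed_transp_apply)

lemma signed_transp_involution: "a \<noteq> b \<Longrightarrow> a \<noteq> 0 \<Longrightarrow> b \<noteq> 0 \<Longrightarrow> signed_transp a b \<circ> signed_transp a b = id"
  by (rule ext) (auto simp: signed_transp_apply)

lemma signed_dom_nonzero: "a \<in> signed_dom n \<Longrightarrow> a \<noteq> 0"
  by (auto simp: signed_dom_def)

lemma signed_dom_uminus [simp]: "- a \<in> signed_dom n \<longleftrightarrow> a \<in> signed_dom n"
  by (auto simp: signed_dom_def)

lemma finite_signed_dom [simp]: "finite (signed_dom n)"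
  by (rule finite_subset[of _ "{- int n..int n}"]) (auto simp: signed_dom_def)

text \<open>With \<open>signed_transp\<close> the three families of reflections become one; the price is that each
  reflection is named by up to four pairs (see \<open>signed_transp_eqD\<close> below).\<close>

lemma reflections_eq:
  "reflections n = {signed_transp a b | a b. a \<in> signed_dom n \<and> b \<in> signed_dom n \<and> a \<noteq> b}"
proof (intro equalityI subsetI)
  fix t assume "t \<in> reflections n"
  then consider i where "1 \<le> i" "i \<le> int n" "t = sign_change i"
    | i j where "1 \<le> i" "i < j" "j \<le> int n" "t = paired_transp i j"
    | i j where "1 \<le> i" "i < j" "j \<le> int n" "t = paired_transp i (- j)"
    by (auto simp: reflections_def)
  then show "t \<in> {signed_transp a b | a b. a \<in> signed_dom n \<and> b \<in> signed_dom n \<and> a \<noteq> b}"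
  proof cases
    case 1
    then have "t = signed_transp i (- i)" "i \<in> signed_dom n" "i \<noteq> - i"
      by (auto simp: signed_transp_def signed_dom_def)
    then show ?thesis using signed_dom_uminus by blast
  next
    case 2
    then have "t = signed_transp i j" "i \<in> signed_dom n" "j \<in> signed_dom n" "i \<noteq> j"
      by (auto simp: signed_transp_def signed_dom_def)
    then show ?thesis by blast
  next
    case 3
    then have "t = signed_transp i (- j)" "i \<in> signed_dom n" "- j \<in> signed_dom n" "i \<noteq> - j"
      by (auto simp: signed_transp_def signed_dom_def)
    then show ?thesis by blast
  qed
next
  have pos: "signed_transp a b \<in> reflections n"
    if "a \<in> signed_dom n" "b \<in> signed_dom n" "a \<noteq> b" "\<bar>a\<bar> \<le> \<bar>b\<bar>" "0 < a" for a b
  proof -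
    consider "b = - a" | "b \<noteq> - a" "0 < b" | "b \<noteq> - a" "b < 0"
      using signed_dom_nonzero[OF \<open>b \<in> signed_dom n\<close>] by linarith
    then show ?thesis
    proof cases
      case 1 then show ?thesis using that by (auto simp: signed_transp_def reflections_def signed_dom_def)
    next
      case 2 then have "signed_transp a b = paired_transp a b" "1 \<le> a" "a < b" "b \<le> int n"
        using that by (auto simp: signed_transp_def signed_dom_def)
      then show ?thesis unfolding reflections_def by blast
    next
      case 3 then have "signed_transp a b = paired_transp a (- (- b))" "1 \<le> a" "a < - b" "- b \<le> int n"
        using that by (auto simp: signed_transp_def signed_dom_def)
      then show ?thesis unfolding reflections_def by blast
    qed
  qed
  have le: "signed_transp a b \<in> reflections n"
    if "a \<in> signed_dom n" "b \<in> signed_dom n" "a \<noteq> b" "\<bar>a\<bar> \<le> \<bar>b\<bar>" for a b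
  proof (cases "0 < a")
    case True then show ?thesis using pos that by blast
  next
    case False
    then have "signed_transp (- a) (- b) \<in> reflections n" using that pos[of "- a" "- b"]
      by (auto simp: signed_dom_def)
    then show ?thesis using that by (simp add: signed_transp_uminus signed_dom_nonzero)
  qed
  fix t assume "t \<in> {signed_transp a b | a b. a \<in> signed_dom n \<and> b \<in> signed_dom n \<and> a \<noteq> b}"
  then obtain a b where t: "t = signed_transp a b" "a \<in> signed_dom n" "b \<in> signed_dom n" "a \<noteq> b" by blast
  then show "t \<in> reflections n"
  proof (cases "\<bar>a\<bar> \<le> \<bar>b\<bar>")
    case True then show ?thesis using le t by blast
  next
    case False
    then have "signed_transp b a \<in> reflections n" using le[of b a] t by auto
    then show ?thesis using t by (simp add: signed_transp_commute signed_dom_nonzero)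
  qed
qed

lemma reflectionsE:
  assumes "t \<in> reflections n"
  obtains a b where "t = signed_transp a b" "a \<in> signed_dom n" "b \<in> signed_dom n" "a \<noteq> b" "a \<noteq> 0" "b \<noteq> 0"
  using assms unfolding reflections_eq using signed_dom_nonzero by blast

lemma signed_transp_in_reflections:
  "a \<in> signed_dom n \<Longrightarrow> b \<in> signed_dom n \<Longrightarrow> a \<noteq> b \<Longrightarrow> signed_transp a b \<in> reflections n"
  unfolding reflections_eq by blast

lemma finite_reflections [simp]: "finite (reflections n)"
proof -
  have "reflections n \<subseteq> (\<lambda>(a, b). signed_transp a b) ` (signed_dom n \<times> signed_dom n)"
    by (auto elim!: reflectionsE)
  then show ?thesis by (rule finite_subset) simp
qed

lemma B_group_odd: "w \<in> B_group n \<Longrightarrow> w (- x) = - w x"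
  by (cases "x \<in> signed_dom n") (auto simp: B_group_def permutes_def)

lemma B_group_permutes: "w \<in> B_group n \<Longrightarrow> w permutes signed_dom n"
  by (simp add: B_group_def)

lemma B_group_comp: "u \<in> B_group n \<Longrightarrow> v \<in> B_group n \<Longrightarrow> u \<circ> v \<in> B_group n"
  using B_group_odd[of u] B_group_odd[of v] by (auto simp: B_group_def permutes_compose)

lemma B_group_id: "id \<in> B_group n"
  by (auto simp: B_group_def permutes_id)

lemma B_group_dom [simp]: "w \<in> B_group n \<Longrightarrow> w x \<in> signed_dom n \<longleftrightarrow> x \<in> signed_dom n"
  by (meson B_group_permutes permutes_in_image)

lemma B_group_eq_iff: "w \<in> B_group n \<Longrightarrow> w x = w y \<longleftrightarrow> x = y"
  by (meson B_group_permutes permutes_inj injD)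

lemma B_group_inv: assumes "w \<in> B_group n" shows "inv w \<in> B_group n"
proof -
  have "inv w (- x) = - inv w x" for x
  proof -
    have "w (inv w (- x)) = - x" "w (inv w x) = x"
      using B_group_permutes[OF assms] permutes_surj surj_f_inv_f by metis+
    then have "w (inv w (- x)) = w (- inv w x)" using B_group_odd[OF assms] by simp
    then show ?thesis using B_group_eq_iff[OF assms] by blast
  qed
  then show ?thesis using assms permutes_inv by (auto simp: B_group_def)
qed

lemma B_group_inv_cancel:
  assumes "w \<in> B_group n" shows "w \<circ> inv w = id" "inv w \<circ> w = id"
  using permutes_inv_o[OF B_group_permutes[OF assms]] by auto

lemma reflections_B_group: "t \<in> reflections n \<Longrightarrow> t \<in> B_group n"
proof (elim reflectionsE)
  fix a b assume t: "t = signed_transp a b" "a \<in> signed_dom n" "b \<in> signed_dom n" "a \<noteq> b" "a \<noteq> 0" "b \<noteq> 0"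
  have "t (t x) = x" for x using signed_transp_involution[of a b] t by (auto simp: fun_eq_iff)
  then have "bij t" by (metis involuntory_imp_bij)
  moreover have "t x = x" if "x \<notin> signed_dom n" for x
    using that t by (auto simp: signed_transp_apply)
  ultimately have "t permutes signed_dom n" by (simp add: bij_iff permutes_def)
  then show ?thesis using t by (auto simp: B_group_def signed_transp_apply)
qed

lemma reflections_involution: "t \<in> reflections n \<Longrightarrow> t \<circ> t = id"
  by (elim reflectionsE) (simp add: signed_transp_involution)

lemma signed_transp_conjugate:
  assumes "s \<in> B_group n" "a \<noteq> b" "a \<noteq> 0" "b \<noteq> 0"
  shows "s \<circ> signed_transp a b = signed_transp (s a) (s b) \<circ> s"
proof
  fix x
  have s0: "s 0 = 0" using B_group_odd[OF assms(1), of 0] by simp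
  then have "s a \<noteq> 0" "s b \<noteq> 0" "s a \<noteq> s b" using assms B_group_eq_iff[OF assms(1)] by metis+
  then show "(s \<circ> signed_transp a b) x = (signed_transp (s a) (s b) \<circ> s) x"
    using assms by (auto simp: signed_transp_apply B_group_eq_iff B_group_odd[OF assms(1), symmetric])
qed

section \<open>Words and word length\<close>

definition compose_list :: "('a \<Rightarrow> 'a) list \<Rightarrow> 'a \<Rightarrow> 'a" where
  "compose_list ts = foldr (\<circ>) ts id"

lemma compose_list_Nil [simp]: "compose_list [] = id"
  by (simp add: compose_list_def)

definition generated :: "('a \<Rightarrow> 'a) set \<Rightarrow> ('a \<Rightarrow> 'a) set" where
  "generated X = {compose_list ts | ts. set ts \<subseteq> X}"

lemma compose_list_Cons: "compose_list (t # ts) = t \<circ> compose_list ts"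
  by (simp add: compose_list_def)

lemma compose_list_append: "compose_list (ss @ ts) = compose_list ss \<circ> compose_list ts"
  by (induction ss) (auto simp: compose_list_Cons comp_assoc)

lemma word_length_eq:
  "word_length X w = (LEAST k. \<exists>ts. set ts \<subseteq> X \<and> length ts = k \<and> w = compose_list ts)"
  by (simp add: word_length_def compose_list_def)

lemma generated_comp: "u \<in> generated X \<Longrightarrow> v \<in> generated X \<Longrightarrow> u \<circ> v \<in> generated X"
proof -
  assume "u \<in> generated X" "v \<in> generated X"
  then obtain ss ts where "u = compose_list ss" "v = compose_list ts" "set ss \<subseteq> X" "set ts \<subseteq> X"
    by (auto simp: generated_def)
  then have "u \<circ> v = compose_list (ss @ ts)" "set (ss @ ts) \<subseteq> X"
    by (auto simp only: compose_list_append set_append)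
  then show ?thesis unfolding generated_def by blast
qed

lemma generated_base: "x \<in> X \<Longrightarrow> x \<in> generated X"
proof -
  assume "x \<in> X"
  then have "x = compose_list [x]" "set [x] \<subseteq> X" by (auto simp: compose_list_Cons)
  then show ?thesis unfolding generated_def by blast
qed

lemma generated_id: "id \<in> generated X"
proof -
  have "id = compose_list []" "set [] \<subseteq> X" by auto
  then show ?thesis unfolding generated_def by blast
qed

lemma generated_mono: "X \<subseteq> generated Y \<Longrightarrow> generated X \<subseteq> generated Y"
proof
  fix w assume X: "X \<subseteq> generated Y" and "w \<in> generated X"
  then obtain ts where "w = compose_list ts" "set ts \<subseteq> X" by (auto simp: generated_def)
  then show "w \<in> generated Y"
  proof (induction ts arbitrary: w)
    case Nil then show ?case using generated_id by (simp only: compose_list_Nil)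
  next
    case (Cons t ts)
    then have "set ts \<subseteq> X" "t \<in> generated Y" using X by auto
    then have "t \<circ> compose_list ts \<in> generated Y" by (intro generated_comp Cons.IH[OF HOL.refl])
    then show ?case using Cons.prems(1) by (simp only: compose_list_Cons)
  qed
qed

lemma word_length_le: "set ts \<subseteq> X \<Longrightarrow> word_length X (compose_list ts) \<le> length ts"
  unfolding word_length_eq by (rule Least_le) auto

lemma shortest_word:
  assumes "w \<in> generated X"
  obtains ts where "set ts \<subseteq> X" "length ts = word_length X w" "w = compose_list ts"
proof -
  obtain ts where "set ts \<subseteq> X" "w = compose_list ts" using assms by (auto simp: generated_def)
  then have "\<exists>k ts. set ts \<subseteq> X \<and> length ts = k \<and> w = compose_list ts" by blast
  then have "\<exists>ts. set ts \<subseteq> X \<and> length ts = word_length X w \<and> w = compose_list ts"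
    unfolding word_length_eq by (rule LeastI_ex)
  then show ?thesis using that by blast
qed

lemma word_length_comp_le:
  assumes "u \<in> generated X" "v \<in> generated X"
  shows "word_length X (u \<circ> v) \<le> word_length X u + word_length X v"
proof -
  obtain ss where ss: "set ss \<subseteq> X" "length ss = word_length X u" "u = compose_list ss"
    using shortest_word[OF assms(1)] by blast
  obtain ts where ts: "set ts \<subseteq> X" "length ts = word_length X v" "v = compose_list ts"
    using shortest_word[OF assms(2)] by blast
  have "u \<circ> v = compose_list (ss @ ts)" by (simp only: ss ts compose_list_append)
  then show ?thesis using word_length_le[of "ss @ ts" X] ss ts by simp
qed

lemma word_length_eq_0: "w \<in> generated X \<Longrightarrow> word_length X w = 0 \<Longrightarrow> w = id"
  by (erule shortest_word) simp

lemma word_length_eq_1: "w \<in> generated X \<Longrightarrow> word_length X w = 1 \<Longrightarrow> w \<in> X"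
  by (erule shortest_word) (auto simp: length_Suc_conv compose_list_Cons)

text \<open>If \<open>w\<close> moves \<open>a\<close>, then multiplication on the left by the reflection that interchanges \<open>a\<close> and \<open>w a\<close> makes
  \<open>a\<close> a fixed point and keeps all old ones.\<close>

lemma B_group_generated_reflections: "w \<in> B_group n \<Longrightarrow> w \<in> generated (reflections n)"
proof (induction "card {x \<in> signed_dom n. w x \<noteq> x}" arbitrary: w rule: less_induct)
  case less
  show ?case
  proof (cases "w = id")
    case True then show ?thesis by (simp only: generated_id)
  next
    case False
    then obtain a where a: "w a \<noteq> a" by (auto simp: fun_eq_iff)
    then have dom: "a \<in> signed_dom n" using B_group_permutes[OF less.prems] by (auto simp: permutes_def)
    define t where "t = signed_transp a (w a)"
    have t: "t \<in> reflections n" unfolding t_def using a dom less.prems by (auto intro!: signed_transp_in_reflections)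
    have nz: "a \<noteq> 0" "w a \<noteq> 0" using dom less.prems signed_dom_nonzero by (blast, metis B_group_dom signed_dom_nonzero)
    have "(t \<circ> w) a = a" using a nz by (simp add: t_def signed_transp_apply)
    moreover have "(t \<circ> w) x = x" if "w x = x" for x
    proof -
      have "x \<noteq> a" "x \<noteq> - a" "x \<noteq> w a" "x \<noteq> - w a"
        using that a B_group_eq_iff[OF less.prems] B_group_odd[OF less.prems] by (metis minus_minus)+
      then show ?thesis using that a nz by (simp add: t_def signed_transp_apply)
    qed
    ultimately have "{x \<in> signed_dom n. (t \<circ> w) x \<noteq> x} \<subset> {x \<in> signed_dom n. w x \<noteq> x}"
      using a dom by blast
    then have "card {x \<in> signed_dom n. (t \<circ> w) x \<noteq> x} < card {x \<in> signed_dom n. w x \<noteq> x}"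
      by (intro psubset_card_mono) auto
    then have "t \<circ> w \<in> generated (reflections n)"
      using less.hyps less.prems t by (simp add: B_group_comp reflections_B_group)
    then have "t \<circ> (t \<circ> w) \<in> generated (reflections n)"
      using generated_comp[OF generated_base[OF t]] by blast
    then show ?thesis using reflections_involution[OF t] by (simp add: comp_assoc[symmetric])
  qed
qed

lemma compose_list_B_group: "set ts \<subseteq> reflections n \<Longrightarrow> compose_list ts \<in> B_group n"
proof (induction ts)
  case (Cons t ts)
  then have "set ts \<subseteq> reflections n" "t \<in> B_group n" using reflections_B_group by auto
  then show ?case unfolding compose_list_Cons by (intro B_group_comp Cons.IH)
qed (simp add: B_group_id)

section \<open>The simple generators and the Bruhat order\<close>

lemma simple_gens_eq:
  "simple_gens n = insert (signed_transp 1 (- 1)) {signed_transp i (i + 1) | i. 1 \<le> i \<and> i \<le> int n - 1}"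
proof -
  have "paired_transp i (i + 1) = signed_transp i (i + 1)" if "1 \<le> i" for i
    using that by (simp add: signed_transp_def)
  then have "{paired_transp i (i + 1) | i. 1 \<le> i \<and> i \<le> int n - 1} =
      {signed_transp i (i + 1) | i. 1 \<le> i \<and> i \<le> int n - 1}" by metis
  moreover have "signed_transp 1 (- 1) = sign_change 1" by (simp add: signed_transp_def)
  ultimately show ?thesis unfolding simple_gens_def by simp
qed

lemma simple_gens_reflections: "n \<ge> 1 \<Longrightarrow> simple_gens n \<subseteq> reflections n"
  unfolding simple_gens_eq by (auto intro!: signed_transp_in_reflections simp: signed_dom_def)

text \<open>A simple generator interchanges neighbours, so it changes the relative order of no pair except
  the one that it interchanges itself.\<close>

lemma simple_gen_preserves_order:
  assumes "s \<in> simple_gens n" "a \<noteq> b" "a \<noteq> 0" "b \<noteq> 0" "signed_transp a b \<noteq> s"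
  shows "s a < s b \<longleftrightarrow> a < b"
proof -
  consider "s = signed_transp 1 (- 1)" | i where "1 \<le> i" "s = signed_transp i (i + 1)"
    using assms(1) unfolding simple_gens_eq by blast
  then show ?thesis
  proof cases
    case 1
    have "\<not> (a = 1 \<and> b = - 1)" using 1 assms(5) by auto
    moreover have "\<not> (a = - 1 \<and> b = 1)" using 1 assms(5) signed_transp_commute[of 1 "- 1"] by auto
    ultimately show ?thesis using assms(2-4) by (auto simp: 1 signed_transp_apply)
  next
    case 2
    have "\<not> (a = i \<and> b = i + 1)" using 2 assms(5) by auto
    moreover have "\<not> (a = i + 1 \<and> b = i)" using 2 assms(5) signed_transp_commute[of i "i + 1"] by auto
    moreover have "\<not> (a = - i \<and> b = - (i + 1))" using 2 assms(5) signed_transp_uminus[of i "i + 1"] by auto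
    moreover have "\<not> (a = - (i + 1) \<and> b = - i)"
      using 2 assms(5) signed_transp_uminus[of i "i + 1"] signed_transp_commute[of "- i" "- (i + 1)"] by auto
    moreover have s: "s x = (if x = i then i + 1 else if x = i + 1 then i
        else if x = - i then - i - 1 else if x = - i - 1 then - i else x)" for x
      using 2(1) by (simp add: 2(2) signed_transp_apply)
    ultimately show ?thesis using assms(2-4) 2(1) unfolding s by (smt (verit))
  qed
qed

text \<open>Read the word from the right: each generator either carries the pair to another one in the same
  order, or it is the reflection that interchanges the current pair and can be cancelled.  The latter
  must happen if the product of the word inverts the pair \<open>a, b\<close>.\<close>

lemma strong_exchange:
  assumes "n \<ge> 1" "set ss \<subseteq> simple_gens n" "a \<noteq> b" "a \<noteq> 0" "b \<noteq> 0"
    and "(compose_list ss a < compose_list ss b) \<noteq> (a < b)"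
  shows "\<exists>ss'. set ss' \<subseteq> simple_gens n \<and> length ss' < length ss \<and>
    compose_list ss' = compose_list ss \<circ> signed_transp a b"
  using assms(2-)
proof (induction ss arbitrary: a b rule: rev_induct)
  case Nil then show ?case by simp
next
  case (snoc s ss)
  have s: "s \<in> simple_gens n" "s \<in> B_group n"
    using snoc.prems(1) assms(1) simple_gens_reflections reflections_B_group by auto
  have comp: "compose_list (ss @ [s]) = compose_list ss \<circ> s" by (simp add: compose_list_append compose_list_Cons)
  show ?case
  proof (cases "signed_transp a b = s")
    case True
    then have "compose_list (ss @ [s]) \<circ> signed_transp a b = compose_list ss"
      unfolding comp using signed_transp_involution[OF snoc.prems(2-4)] by (metis comp_assoc comp_id)
    then have "compose_list ss = compose_list (ss @ [s]) \<circ> signed_transp a b" by (rule sym)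
    moreover have "set ss \<subseteq> simple_gens n" "length ss < length (ss @ [s])" using snoc.prems(1) by auto
    ultimately show ?thesis by blast
  next
    case False
    have "s 0 = 0" using B_group_odd[OF s(2), of 0] by simp
    then have nz: "s a \<noteq> s b" "s a \<noteq> 0" "s b \<noteq> 0"
      using snoc.prems(2-4) B_group_eq_iff[OF s(2)] by metis+
    have "(compose_list ss (s a) < compose_list ss (s b)) \<noteq> (s a < s b)"
      using snoc.prems(5)[unfolded comp comp_apply]
        simple_gen_preserves_order[OF s(1) snoc.prems(2-4) False] by simp
    then obtain ss' where ss': "set ss' \<subseteq> simple_gens n" "length ss' < length ss"
        "compose_list ss' = compose_list ss \<circ> signed_transp (s a) (s b)"
      using snoc.IH[of "s a" "s b"] snoc.prems(1) nz by (metis le_sup_iff set_append)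
    have "compose_list (ss' @ [s]) = compose_list ss \<circ> (signed_transp (s a) (s b) \<circ> s)"
      unfolding compose_list_append ss'(3) by (simp add: compose_list_Cons comp_assoc)
    also have "\<dots> = compose_list (ss @ [s]) \<circ> signed_transp a b"
      unfolding signed_transp_conjugate[OF s(2) snoc.prems(2-4), symmetric] comp by (simp add: comp_assoc)
    finally show ?thesis using ss'(1,2) s(1) by (intro exI[of _ "ss' @ [s]"]) simp
  qed
qed

lemma signed_transp_conjugate':
  assumes "s \<in> B_group n" "s \<circ> s = id" "a \<noteq> b" "a \<noteq> 0" "b \<noteq> 0"
  shows "signed_transp (s a) (s b) = s \<circ> signed_transp a b \<circ> s"
  by (metis signed_transp_conjugate[OF assms(1,3-)] assms(2) comp_assoc comp_id)

text \<open>All reflections arise from simple generators by conjugation: sign changes from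
  \<open>sign_change 1\<close>, transpositions of positive numbers from neighbouring ones, and the
  reflections \<open>(i, -j)(-i, j)\<close> from these by a sign change of \<open>j\<close>.\<close>

lemma B_group_generated_simple:
  assumes "n \<ge> 1" "w \<in> B_group n" shows "w \<in> generated (simple_gens n)"
proof -
  have conj: "signed_transp (s a) (s b) \<in> generated (simple_gens n)"
    if "signed_transp a b \<in> generated (simple_gens n)" "s \<in> generated (simple_gens n)" "s \<in> B_group n" "s \<circ> s = id"
      "a \<noteq> b" "a \<noteq> 0" "b \<noteq> 0" for s a b
    unfolding signed_transp_conjugate'[OF that(3-)] by (intro generated_comp that)
  have adj: "signed_transp i (i + 1) \<in> generated (simple_gens n)" "signed_transp i (i + 1) \<in> B_group n"
      "signed_transp i (i + 1) \<circ> signed_transp i (i + 1) = id"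
    if "1 \<le> i" "i + 1 \<le> int n" for i
  proof -
    show "signed_transp i (i + 1) \<in> generated (simple_gens n)"
      using that by (intro generated_base) (auto simp: simple_gens_eq)
    show "signed_transp i (i + 1) \<in> B_group n"
      using that by (intro reflections_B_group signed_transp_in_reflections) (auto simp: signed_dom_def)
    show "signed_transp i (i + 1) \<circ> signed_transp i (i + 1) = id" using that by (intro signed_transp_involution) auto
  qed
  have sc: "signed_transp i (- i) \<in> generated (simple_gens n)" if "1 \<le> i" "i \<le> int n" for i
    using that
  proof (induction rule: int_ge_induct)
    case base then show ?case by (intro generated_base) (auto simp: simple_gens_eq)
  next
    case (step i)
    then have "signed_transp (signed_transp i (i + 1) i) (signed_transp i (i + 1) (- i)) \<in> generated (simple_gens n)"
      by (intro conj[of i "- i" "signed_transp i (i + 1)"] adj) auto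
    moreover have "signed_transp i (i + 1) i = i + 1" "signed_transp i (i + 1) (- i) = - (i + 1)"
      using step by (auto simp: signed_transp_apply)
    ultimately show ?case by (simp only:)
  qed
  have pt: "signed_transp i j \<in> generated (simple_gens n)" if "1 \<le> i" "i + 1 \<le> j" "j \<le> int n" for i j
    using that(2,3)
  proof (induction rule: int_ge_induct)
    case base then show ?case using adj that by auto
  next
    case (step j)
    then have "signed_transp (signed_transp j (j + 1) i) (signed_transp j (j + 1) j) \<in> generated (simple_gens n)"
      using that(1) by (intro conj[of i j "signed_transp j (j + 1)"] adj) auto
    moreover have "signed_transp j (j + 1) i = i" "signed_transp j (j + 1) j = j + 1"
      using step that(1) by (auto simp: signed_transp_apply)
    ultimately show ?case by (simp only:)
  qed
  have nt: "signed_transp i (- j) \<in> generated (simple_gens n)" if "1 \<le> i" "i < j" "j \<le> int n" for i j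
  proof -
    have "signed_transp (signed_transp j (- j) i) (signed_transp j (- j) j) \<in> generated (simple_gens n)"
      using that
      by (intro conj[of i j "signed_transp j (- j)"] sc pt reflections_B_group[of _ n]
          signed_transp_in_reflections signed_transp_involution)
        (auto simp: signed_dom_def)
    moreover have "signed_transp j (- j) i = i" "signed_transp j (- j) j = - j"
      using that by (auto simp: signed_transp_apply)
    ultimately show ?thesis by (simp only:)
  qed
  have "reflections n \<subseteq> generated (simple_gens n)"
  proof
    fix t assume "t \<in> reflections n"
    then show "t \<in> generated (simple_gens n)"
      unfolding reflections_def using sc pt nt by (auto simp: signed_transp_def)
  qed
  then show ?thesis using generated_mono B_group_generated_reflections[OF assms(2)] by blast
qed

lemma len_S_comp_signed_transp_less:
  assumes "n \<ge> 1" "w \<in> B_group n" "a \<noteq> b" "a \<noteq> 0" "b \<noteq> 0" "(w a < w b) \<noteq> (a < b)"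
  shows "len_S n (w \<circ> signed_transp a b) < len_S n w"
proof -
  obtain ss where ss: "set ss \<subseteq> simple_gens n" "length ss = len_S n w" "w = compose_list ss"
    using shortest_word[OF B_group_generated_simple[OF assms(1,2)]] by blast
  obtain ss' where "set ss' \<subseteq> simple_gens n" "length ss' < length ss" "compose_list ss' = w \<circ> signed_transp a b"
    using strong_exchange[OF assms(1) ss(1) assms(3-5)] assms(6) ss(3) by blast
  then show ?thesis using word_length_le[of ss' "simple_gens n"] ss(2) by (simp del: comp_apply)
qed

text \<open>Strong exchange settles the case of an inverted pair; in the other case the pair is
  inverted by the product \<open>w t\<close>, and \<open>w t t = w\<close>.\<close>

lemma len_S_less_comp_signed_transp_iff:
  assumes "n \<ge> 1" "w \<in> B_group n" "a \<in> signed_dom n" "b \<in> signed_dom n" "a \<noteq> b"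
  shows "len_S n w < len_S n (w \<circ> signed_transp a b) \<longleftrightarrow> (w a < w b \<longleftrightarrow> a < b)"
proof -
  have nz: "a \<noteq> 0" "b \<noteq> 0" using assms signed_dom_nonzero by auto
  let ?v = "w \<circ> signed_transp a b"
  have v: "?v \<in> B_group n" by (intro B_group_comp assms reflections_B_group signed_transp_in_reflections)
  have "?v \<circ> signed_transp a b = w" using signed_transp_involution[OF assms(5) nz] by (simp add: comp_assoc)
  moreover have "?v a = w b" "?v b = w a" using assms(5) nz by (auto simp: signed_transp_apply)
  moreover have "w a \<noteq> w b" using assms B_group_eq_iff by blast
  ultimately show ?thesis
    using len_S_comp_signed_transp_less[OF assms(1,2,5) nz] len_S_comp_signed_transp_less[OF assms(1) v assms(5) nz]
    by (cases "w a < w b \<longleftrightarrow> a < b") (auto simp del: comp_apply)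
qed

text \<open>Every Bruhat step increases the length, so comparability of \<open>w\<close> and \<open>w t\<close> is decided by their
  lengths.  This turns the statistic \<open>bad\<close> into a condition on lengths.\<close>

lemma bruhat_less_comp_reflection_iff:
  assumes "w \<in> B_group n" "t \<in> reflections n"
  shows "bruhat_less n w (w \<circ> t) \<longleftrightarrow> len_S n w < len_S n (w \<circ> t)"
proof
  have le: "len_S n u \<le> len_S n v \<and> (u \<noteq> v \<longrightarrow> len_S n u < len_S n v)" if "bruhat_le n u v" for u v
    using that unfolding bruhat_le_def
    by (induction rule: rtranclp_induct) (force simp: bruhat_step_def simp del: comp_apply)+
  assume "bruhat_less n w (w \<circ> t)"
  then show "len_S n w < len_S n (w \<circ> t)" using le unfolding bruhat_less_def by blast
next
  assume *: "len_S n w < len_S n (w \<circ> t)"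
  then have "bruhat_step n w (w \<circ> t)" unfolding bruhat_step_def using assms by blast
  then show "bruhat_less n w (w \<circ> t)"
    using * unfolding bruhat_less_def bruhat_le_def by (auto simp del: comp_apply)
qed

section \<open>Maximal chains as factorisations into reflections\<close>

text \<open>The partial products of the factorisations of \<open>w\<close> into \<open>k\<close> reflections.\<close>

definition refl_chains :: "nat \<Rightarrow> nat \<Rightarrow> (int \<Rightarrow> int) \<Rightarrow> (int \<Rightarrow> int) list set" where
  "refl_chains n k w = {ws. length ws = Suc k \<and> ws ! 0 = id \<and> ws ! k = w \<and>
     (\<forall>i<k. \<exists>t \<in> reflections n. ws ! Suc i = ws ! i \<circ> t)}"

lemma refl_chains_last: "ws \<in> refl_chains n k w \<Longrightarrow> ws ! k = w"
  and refl_chains_length: "ws \<in> refl_chains n k w \<Longrightarrow> length ws = Suc k"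
  by (simp_all add: refl_chains_def)

lemma refl_chains_0: "refl_chains n 0 w = (if w = id then {[id]} else {})"
  by (auto simp: refl_chains_def length_Suc_conv)

text \<open>Removal of the last reflection \<open>t\<close> leaves a chain that ends in \<open>w t\<close>.\<close>

lemma refl_chains_Suc:
  "refl_chains n (Suc k) w = (\<Union>t \<in> reflections n. (\<lambda>ws. ws @ [w]) ` refl_chains n k (w \<circ> t))"
proof (intro equalityI subsetI)
  fix ws assume ws: "ws \<in> refl_chains n (Suc k) w"
  then have len: "length ws = Suc (Suc k)" by (simp add: refl_chains_def)
  then have ne: "ws \<noteq> []" by auto
  have w: "ws ! Suc k = w" using ws by (simp add: refl_chains_def)
  obtain t where t: "t \<in> reflections n" "ws ! Suc k = ws ! k \<circ> t"
    using ws unfolding refl_chains_def by blast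
  have "w \<circ> t = ws ! k \<circ> (t \<circ> t)" using t(2) w by (simp only: comp_assoc)
  then have wt: "w \<circ> t = ws ! k" using reflections_involution[OF t(1)] by simp
  have "last ws = w" using w len ne by (simp add: last_conv_nth)
  then have "ws = butlast ws @ [w]" using ne by (metis append_butlast_last_id)
  moreover have "butlast ws \<in> refl_chains n k (w \<circ> t)"
    using ws len by (auto simp: refl_chains_def nth_butlast wt)
  ultimately show "ws \<in> (\<Union>t \<in> reflections n. (\<lambda>ws. ws @ [w]) ` refl_chains n k (w \<circ> t))"
    using t(1) by blast
next
  fix ws assume "ws \<in> (\<Union>t \<in> reflections n. (\<lambda>ws. ws @ [w]) ` refl_chains n k (w \<circ> t))"
  then obtain t vs where t: "t \<in> reflections n" and vs: "vs \<in> refl_chains n k (w \<circ> t)" "ws = vs @ [w]"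
    by blast
  have w: "w = w \<circ> t \<circ> t" using reflections_involution[OF t] by (simp add: comp_assoc)
  have len: "length vs = Suc k" "vs ! 0 = id" "vs ! k = w \<circ> t"
    and steps: "\<And>i. i < k \<Longrightarrow> \<exists>t \<in> reflections n. vs ! Suc i = vs ! i \<circ> t"
    using vs(1) by (auto simp: refl_chains_def)
  have "\<exists>t \<in> reflections n. ws ! Suc i = ws ! i \<circ> t" if "i < Suc k" for i
  proof (cases "i < k")
    case True then show ?thesis using steps[OF True] len by (simp add: vs(2) nth_append)
  next
    case False
    then have "i = k" using that by simp
    then have "ws ! Suc i = w" "ws ! i = w \<circ> t" using len by (auto simp: vs(2) nth_append)
    then show ?thesis using w t by metis
  qed
  then show "ws \<in> refl_chains n (Suc k) w"
    using len by (simp add: refl_chains_def vs(2) nth_append)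
qed

lemma finite_refl_chains: "finite (refl_chains n k w)"
  by (induction k arbitrary: w) (auto simp: refl_chains_0 refl_chains_Suc)

lemma refl_chains_imp_word:
  assumes "ws \<in> refl_chains n k w"
  shows "\<exists>ts. set ts \<subseteq> reflections n \<and> length ts = k \<and> compose_list ts = w"
  using assms
proof (induction k arbitrary: w ws)
  case 0 then show ?case by (intro exI[of _ "[]"]) (auto simp: refl_chains_0 split: if_splits)
next
  case (Suc k)
  then obtain t vs where t: "t \<in> reflections n" "vs \<in> refl_chains n k (w \<circ> t)"
    by (auto simp: refl_chains_Suc)
  obtain ts where ts: "set ts \<subseteq> reflections n" "length ts = k" "compose_list ts = w \<circ> t"
    using Suc.IH[OF t(2)] by blast
  have "compose_list (ts @ [t]) = (w \<circ> t) \<circ> t" by (simp add: compose_list_append compose_list_Cons ts)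
  also have "\<dots> = w" using reflections_involution[OF t(1)] by (simp add: comp_assoc)
  finally show ?case using ts t(1) by (intro exI[of _ "ts @ [t]"]) simp
qed

lemma refl_chains_between:
  assumes "ws \<in> refl_chains n k w" "i \<le> j" "j \<le> k"
  shows "\<exists>ts. set ts \<subseteq> reflections n \<and> length ts = j - i \<and> ws ! j = ws ! i \<circ> compose_list ts"
  using assms(2,3)
proof (induction j rule: dec_induct)
  case base then show ?case by (intro exI[of _ "[]"]) auto
next
  case (step j)
  then obtain ts where ts: "set ts \<subseteq> reflections n" "length ts = j - i"
    "ws ! j = ws ! i \<circ> compose_list ts" by (meson Suc_leD)
  obtain t where t: "t \<in> reflections n" "ws ! Suc j = ws ! j \<circ> t"
    using assms(1) step.prems unfolding refl_chains_def by (auto simp: Suc_le_eq)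
  have "ws ! Suc j = ws ! i \<circ> compose_list (ts @ [t])"
    unfolding t ts(3) by (simp add: compose_list_append compose_list_Cons comp_assoc)
  then show ?case using ts t(1) step by (intro exI[of _ "ts @ [t]"]) auto
qed

lemma refl_chains_B_group:
  assumes "ws \<in> refl_chains n k w" "i \<le> k" shows "ws ! i \<in> B_group n"
proof -
  obtain ts where "set ts \<subseteq> reflections n" "ws ! i = ws ! 0 \<circ> compose_list ts"
    using refl_chains_between[OF assms(1), of 0 i] assms(2) by auto
  moreover have "ws ! 0 = id" using assms(1) by (simp add: refl_chains_def)
  ultimately show ?thesis using compose_list_B_group by (simp only: id_comp)
qed

lemma len_T_inv_comp:
  assumes "u \<in> B_group n" "v \<in> B_group n"
  shows "len_T n v \<le> len_T n u + len_T n (inv u \<circ> v)"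
proof -
  have "u \<circ> (inv u \<circ> v) = v" using B_group_inv_cancel[OF assms(1)] by (simp add: comp_assoc[symmetric])
  moreover have "len_T n (u \<circ> (inv u \<circ> v)) \<le> len_T n u + len_T n (inv u \<circ> v)"
    by (intro word_length_comp_le B_group_generated_reflections B_group_comp B_group_inv assms)
  ultimately show ?thesis by (simp only:)
qed

lemma abs_less_len_T:
  assumes "abs_less n u v" shows "len_T n u < len_T n v"
proof -
  have uv: "u \<in> B_group n" "v \<in> B_group n" "u \<noteq> v" "len_T n v = len_T n u + len_T n (inv u \<circ> v)"
    using assms by (auto simp: abs_less_def)
  have "len_T n (inv u \<circ> v) \<noteq> 0"
  proof
    assume "len_T n (inv u \<circ> v) = 0"
    then have "inv u \<circ> v = id"
      using uv by (intro word_length_eq_0[of _ "reflections n"])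
        (auto intro!: B_group_generated_reflections B_group_comp B_group_inv)
    then have "u \<circ> (inv u \<circ> v) = u" by simp
    then show False using B_group_inv_cancel[OF uv(1)] uv(3) by (simp add: comp_assoc[symmetric])
  qed
  then show ?thesis using uv by simp
qed

text \<open>Elements of \<open>\<ell>\<^sub>T\<close>-length one are reflections, so a step of the absolute order that increases the
  length by one is multiplication by a reflection.\<close>

lemma abs_less_reflection:
  assumes "abs_less n u v" "len_T n v = Suc (len_T n u)"
  shows "\<exists>t \<in> reflections n. v = u \<circ> t"
proof -
  have uv: "u \<in> B_group n" "v \<in> B_group n" "len_T n v = len_T n u + len_T n (inv u \<circ> v)"
    using assms by (auto simp: abs_less_def)
  have "inv u \<circ> v \<in> generated (reflections n)"
    by (intro B_group_generated_reflections B_group_comp B_group_inv uv)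
  then have "inv u \<circ> v \<in> reflections n" using assms(2) uv(3) by (simp add: word_length_eq_1)
  moreover have "v = u \<circ> (inv u \<circ> v)"
    using B_group_inv_cancel[OF uv(1)] by (simp add: comp_assoc[symmetric])
  ultimately show ?thesis by blast
qed

lemma len_T_id [simp]: "len_T n id = 0"
  using word_length_le[of "[]" "reflections n"] by simp

text \<open>If \<open>c\<close> needs all \<open>n\<close> factors, then no partial product or quotient of partial products can be written with
  fewer factors than the factorisation shows.\<close>

lemma refl_chains_abs_less:
  assumes ws: "ws \<in> refl_chains n n c" and n: "len_T n c = n" and ij: "i < j" "j \<le> n"
  shows "abs_less n (ws ! i) (ws ! j)" "len_T n (ws ! i) = i"
proof -
  have B: "ws ! i \<in> B_group n" if "i \<le> n" for i using refl_chains_B_group[OF ws that] .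
  have le: "len_T n (inv (ws ! i) \<circ> ws ! j) \<le> j - i" if "i \<le> j" "j \<le> n" for i j
  proof -
    obtain ts where ts: "set ts \<subseteq> reflections n" "length ts = j - i" "ws ! j = ws ! i \<circ> compose_list ts"
      using refl_chains_between[OF ws \<open>i \<le> j\<close> \<open>j \<le> n\<close>] by blast
    have "inv (ws ! i) \<circ> ws ! j = compose_list ts"
      unfolding ts(3) using B_group_inv_cancel(2)[OF B[of i]] that by (simp add: comp_assoc[symmetric])
    then show ?thesis using word_length_le[OF ts(1)] ts(2) by simp
  qed
  have ends: "ws ! 0 = id" "ws ! n = c" using ws by (auto simp: refl_chains_def)
  have len: "len_T n (ws ! i) = i" if "i \<le> n" for i
  proof -
    have "len_T n (ws ! i) \<le> i" using le[of 0 i] that ends by simp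
    moreover have "n \<le> len_T n (ws ! i) + len_T n (inv (ws ! i) \<circ> ws ! n)"
      using len_T_inv_comp[of "ws ! i" n "ws ! n"] B[of i] B[of n] that n ends by simp
    moreover have "len_T n (inv (ws ! i) \<circ> ws ! n) \<le> n - i" using le[of i n] that by simp
    ultimately show ?thesis using that by linarith
  qed
  have "j \<le> i + len_T n (inv (ws ! i) \<circ> ws ! j)"
    using len_T_inv_comp[of "ws ! i" n "ws ! j"] B ij len by simp
  moreover have "len_T n (inv (ws ! i) \<circ> ws ! j) \<le> j - i" using le[of i j] ij by simp
  ultimately have "len_T n (inv (ws ! i) \<circ> ws ! j) = j - i" by linarith
  moreover have "ws ! i \<noteq> ws ! j" using len[of i] len[of j] ij by auto
  ultimately show "abs_less n (ws ! i) (ws ! j)" using len[of i] len[of j] B ij by (simp add: abs_less_def)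
  show "len_T n (ws ! i) = i" using len ij by simp
qed

text \<open>In a maximal chain the lengths increase strictly from \<open>0\<close> to \<open>n\<close> in \<open>n\<close> steps, so each step is
  multiplication by a reflection.  Conversely, the partial products of a factorisation realise every
  length from \<open>0\<close> to \<open>n\<close>, and a further element of the chain would be comparable with the one of its own
  length, which is impossible.\<close>

lemma max_chains_eq_refl_chains:
  assumes n: "len_T n (coxeter_elt n) = n"
  shows "max_chains n = refl_chains n n (coxeter_elt n)"
proof (intro equalityI subsetI)
  fix ws assume "ws \<in> max_chains n"
  then have len: "length ws = Suc n" and ends: "ws ! 0 = id" "ws ! n = coxeter_elt n"
    and sorted: "sorted_wrt (abs_less n) ws" by (auto simp: max_chains_def)
  have less: "abs_less n (ws ! i) (ws ! j)" if "i < j" "j \<le> n" for i j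
    using sorted_wrt_nth_less[OF sorted] that len by simp
  have up: "len_T n (ws ! i) + (j - i) \<le> len_T n (ws ! j)" if "i \<le> j" "j \<le> n" for i j
    using that
  proof (induction j rule: dec_induct)
    case (step j)
    then show ?case using abs_less_len_T[OF less[of j "Suc j"]] by simp
  qed simp
  have "len_T n (ws ! i) = i" if "i \<le> n" for i
    using up[of 0 i] up[of i n] that ends n by simp
  then have "\<exists>t \<in> reflections n. ws ! Suc i = ws ! i \<circ> t" if "i < n" for i
    using abs_less_reflection[OF less[of i "Suc i"]] that by simp
  then show "ws \<in> refl_chains n n (coxeter_elt n)" using len ends by (simp add: refl_chains_def)
next
  fix ws assume ws: "ws \<in> refl_chains n n (coxeter_elt n)"
  then have len: "length ws = Suc n" and ends: "ws ! 0 = id" "ws ! n = coxeter_elt n"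
    by (auto simp: refl_chains_def)
  have less: "abs_less n (ws ! i) (ws ! j)" if "i < j" "j \<le> n" for i j
    using refl_chains_abs_less(1)[OF ws n that] .
  have lenT: "len_T n (ws ! i) = i" if "i \<le> n" for i
    using refl_chains_abs_less(2)[OF ws n, of i n] that n ends by (cases "i = n") auto
  have B: "ws ! i \<in> B_group n" if "i \<le> n" for i using refl_chains_B_group[OF ws that] .
  have le: "abs_le n (ws ! i) (ws ! j)" if "i \<le> j" "j \<le> n" for i j
    using that less[of i j] B by (cases "i = j") (auto simp: abs_le_def)
  have nth_NC: "ws ! i \<in> NC_B n" if "i \<le> n" for i
    using le[of 0 i] le[of i n] B that ends by (simp add: NC_B_def)
  have sub: "set ws \<subseteq> NC_B n" using nth_NC len by (auto simp: in_set_conv_nth)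
  have sorted: "sorted_wrt (abs_less n) ws" using less len by (simp add: sorted_wrt_iff_nth_less)
  have chain: "pred_on.chain (NC_B n) (abs_less n) (set ws)"
    unfolding pred_on.chain_def
  proof (intro conjI ballI sub)
    fix x y assume "x \<in> set ws" "y \<in> set ws"
    then obtain i j where "x = ws ! i" "y = ws ! j" "i \<le> n" "j \<le> n" using len
      by (metis in_set_conv_nth less_Suc_eq_le)
    then show "(abs_less n)\<^sup>=\<^sup>= x y \<or> (abs_less n)\<^sup>=\<^sup>= y x"
      using less[of i j] less[of j i] by (cases i j rule: linorder_cases) auto
  qed
  have "pred_on.maxchain (NC_B n) (abs_less n) (set ws)"
    unfolding pred_on.maxchain_def
  proof (intro conjI chain notI)
    assume "\<exists>S. pred_on.chain (NC_B n) (abs_less n) S \<and> set ws \<subset> S"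
    then obtain S x where S: "pred_on.chain (NC_B n) (abs_less n) S" "set ws \<subset> S" "x \<in> S" "x \<notin> set ws"
      by blast
    then have x: "x \<in> NC_B n" by (auto simp: pred_on.chain_def)
    then have "len_T n x \<le> n" using n abs_less_len_T[of n x "coxeter_elt n"]
      by (auto simp: NC_B_def abs_le_def)
    then have mem: "ws ! len_T n x \<in> set ws" and eq: "len_T n (ws ! len_T n x) = len_T n x"
      using len lenT by auto
    have "(abs_less n)\<^sup>=\<^sup>= x (ws ! len_T n x) \<or> (abs_less n)\<^sup>=\<^sup>= (ws ! len_T n x) x"
      using S mem unfolding pred_on.chain_def by blast
    then have "x = ws ! len_T n x" using abs_less_len_T[of n] eq by (metis less_irrefl sup2E)
    then show False using mem S(4) by simp
  qed
  then show "ws \<in> max_chains n" using len ends sorted by (simp add: max_chains_def)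
qed

text \<open>The generating function of the factorisations of \<open>w\<close> into \<open>k\<close> reflections by the number of bad
  steps, as a recursion on the last factor; the step from \<open>w t\<close> up to \<open>w\<close> is bad if \<open>w\<close> is the
  shorter of the two in terms of simple generators.\<close>

fun chain_weight :: "nat \<Rightarrow> real \<Rightarrow> nat \<Rightarrow> (int \<Rightarrow> int) \<Rightarrow> real" where
  "chain_weight n q 0 w = (if w = id then 1 else 0)"
| "chain_weight n q (Suc k) w =
    (\<Sum>t \<in> reflections n. (if len_S n w < len_S n (w \<circ> t) then q else 1) * chain_weight n q k (w \<circ> t))"

declare chain_weight.simps [simp del]

lemma chain_weight_eq:
  assumes "w \<in> B_group n"
  shows "chain_weight n q k w =
    (\<Sum>ws \<in> refl_chains n k w. q ^ card {i \<in> {1..k}. bruhat_less n (ws ! i) (ws ! (i - 1))})"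
  using assms
proof (induction k arbitrary: w)
  case 0 then show ?case by (simp add: refl_chains_0 chain_weight.simps)
next
  case (Suc k)
  let ?e = "\<lambda>k ws. card {i \<in> {1..k}. bruhat_less n (ws ! i) (ws ! (i - 1))}"
  let ?f = "\<lambda>ws. ws @ [w]"
  have wt: "w \<circ> t \<in> B_group n" if "t \<in> reflections n" for t
    by (intro B_group_comp reflections_B_group that Suc.prems)
  have disj: "?f ` refl_chains n k (w \<circ> t) \<inter> ?f ` refl_chains n k (w \<circ> t') = {}" if "t \<noteq> t'" for t t'
  proof -
    have "w \<circ> t \<noteq> w \<circ> t'"
    proof
      assume "w \<circ> t = w \<circ> t'"
      then have "inv w \<circ> (w \<circ> t) = inv w \<circ> (w \<circ> t')" by (simp only:)
      then show False using that B_group_inv_cancel[OF Suc.prems] by (simp add: comp_assoc[symmetric])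
    qed
    then have "refl_chains n k (w \<circ> t) \<inter> refl_chains n k (w \<circ> t') = {}"
      using refl_chains_last by (metis disjoint_iff)
    then show ?thesis by blast
  qed
  have step: "q ^ ?e (Suc k) (?f ws) = (if len_S n w < len_S n (w \<circ> t) then q else 1) * q ^ ?e k ws"
    if t: "t \<in> reflections n" and ws: "ws \<in> refl_chains n k (w \<circ> t)" for t ws
  proof -
    have len: "length ws = Suc k" "ws ! k = w \<circ> t" using ws refl_chains_last refl_chains_length by auto
    define E where "E = {i \<in> {1..k}. bruhat_less n (ws ! i) (ws ! (i - 1))}"
    have last: "bruhat_less n (?f ws ! Suc k) (?f ws ! (Suc k - 1)) \<longleftrightarrow> len_S n w < len_S n (w \<circ> t)"
      using bruhat_less_comp_reflection_iff[OF Suc.prems t] len by (simp add: nth_append)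
    define P where "P i \<longleftrightarrow> bruhat_less n (?f ws ! i) (?f ws ! (i - 1))" for i
    have init: "P i \<longleftrightarrow> bruhat_less n (ws ! i) (ws ! (i - 1))" if "i \<le> k" for i
    proof -
      have "i < length ws" "i - 1 < length ws" using that len by auto
      then show ?thesis by (simp add: P_def nth_append)
    qed
    have "{i \<in> {1..Suc k}. P i} = (if P (Suc k) then insert (Suc k) {i \<in> {1..k}. P i} else {i \<in> {1..k}. P i})"
      by (auto simp: le_Suc_eq)
    also have "{i \<in> {1..k}. P i} = E" unfolding E_def using init by auto
    also have "P (Suc k) \<longleftrightarrow> len_S n w < len_S n (w \<circ> t)" unfolding P_def by (rule last)
    finally have "{i \<in> {1..Suc k}. bruhat_less n (?f ws ! i) (?f ws ! (i - 1))} =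
        (if len_S n w < len_S n (w \<circ> t) then insert (Suc k) E else E)" unfolding P_def .
    moreover have "finite E" "Suc k \<notin> E" by (auto simp: E_def)
    ultimately show ?thesis unfolding E_def[symmetric] by simp
  qed
  have "(\<Sum>ws \<in> refl_chains n (Suc k) w. q ^ ?e (Suc k) ws) =
      (\<Sum>t \<in> reflections n. \<Sum>ws \<in> ?f ` refl_chains n k (w \<circ> t). q ^ ?e (Suc k) ws)"
    unfolding refl_chains_Suc using disj
    by (intro sum.UNION_disjoint) (auto simp: finite_refl_chains)
  also have "\<dots> = (\<Sum>t \<in> reflections n. \<Sum>ws \<in> refl_chains n k (w \<circ> t). q ^ ?e (Suc k) (?f ws))"
    by (rule sum.cong[OF HOL.refl]) (simp add: sum.reindex inj_on_def)
  also have "\<dots> = (\<Sum>t \<in> reflections n. \<Sum>ws \<in> refl_chains n k (w \<circ> t).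
      (if len_S n w < len_S n (w \<circ> t) then q else 1) * q ^ ?e k ws)"
    using step by (intro sum.cong HOL.refl) blast
  also have "\<dots> = chain_weight n q (Suc k) w"
    unfolding chain_weight.simps by (intro sum.cong HOL.refl) (simp only: Suc.IH[OF wt] sum_distrib_left)
  finally show ?case by (rule sym)
qed

lemma chain_weight_nonzero_imp_word:
  assumes "chain_weight n q k w \<noteq> 0" "w \<in> B_group n"
  shows "\<exists>ts. set ts \<subseteq> reflections n \<and> length ts = k \<and> compose_list ts = w"
proof -
  have "refl_chains n k w \<noteq> {}" using assms chain_weight_eq by force
  then show ?thesis using refl_chains_imp_word by blast
qed

section \<open>A lower bound for the number of factors\<close>

text \<open>The odd functions into the field with three elements that are fixed by all reflections in \<open>ts\<close>.
  The finite field replaces the dimension of a fixed space by a cardinality; oddness and \<open>2 \<noteq> 0\<close> make the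
  functions vanish on cycles with \<open>B = -B\<close>.\<close>

definition invariant_funs :: "nat \<Rightarrow> (int \<Rightarrow> int) list \<Rightarrow> (int \<Rightarrow> 3) set" where
  "invariant_funs n ts = {f. (\<forall>x. f (- x) = - f x) \<and> (\<forall>x. x \<notin> signed_dom n \<longrightarrow> f x = 0) \<and>
     (\<forall>t \<in> set ts. \<forall>x. f (t x) = f x)}"

lemma three_torsion: fixes x :: 3 shows "x + x + x = 0"
proof -
  have "x + x + x = 3 * x" by (simp add: algebra_simps)
  also have "(3 :: 3) = 0" by simp
  finally show ?thesis by simp
qed

lemma eq_uminus_imp_zero: fixes x :: 3 assumes "x = - x" shows "x = 0"
proof -
  have "x + x = 0" using assms by (metis add.right_inverse)
  then show ?thesis using three_torsion[of x] by simp
qed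

lemma finite_invariant_funs: "finite (invariant_funs n ts)"
proof (rule finite_subset)
  show "invariant_funs n ts \<subseteq> {f. \<forall>x. (x \<in> signed_dom n \<longrightarrow> f x \<in> UNIV) \<and> (x \<notin> signed_dom n \<longrightarrow> f x = 0)}"
    by (auto simp: invariant_funs_def)
  show "finite {f :: int \<Rightarrow> 3. \<forall>x. (x \<in> signed_dom n \<longrightarrow> f x \<in> UNIV) \<and> (x \<notin> signed_dom n \<longrightarrow> f x = 0)}"
    by (rule finite_set_of_finite_funs) auto
qed

lemma card_invariant_funs_Nil: "3 ^ n \<le> card (invariant_funs n [])"
proof -
  \<comment> \<open>An odd function with support in \<open>\<plusminus>{1, \<dots>, n}\<close> is given by arbitrary values on \<open>{1, \<dots>, n}\<close>.\<close>
  define ext :: "(nat \<Rightarrow> 3) \<Rightarrow> int \<Rightarrow> 3" where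
    "ext g x = (if x \<notin> signed_dom n then 0 else if 0 < x then g (nat x) else - g (nat (- x)))" for g x
  have "inj_on ext ({1..n} \<rightarrow>\<^sub>E UNIV)"
  proof (rule inj_onI)
    fix g h assume gh: "g \<in> {1..n} \<rightarrow>\<^sub>E (UNIV :: 3 set)" "h \<in> {1..n} \<rightarrow>\<^sub>E (UNIV :: 3 set)" and e: "ext g = ext h"
    show "g = h"
    proof (rule PiE_ext[OF gh])
      fix i assume "i \<in> {1..n}"
      then show "g i = h i" using fun_cong[OF e, of "int i"] by (auto simp: ext_def signed_dom_def)
    qed
  qed
  moreover have "ext ` ({1..n} \<rightarrow>\<^sub>E UNIV) \<subseteq> invariant_funs n []"
    by (auto simp: invariant_funs_def ext_def) (auto simp: signed_dom_def)
  ultimately have "card ({1..n} \<rightarrow>\<^sub>E (UNIV :: 3 set)) \<le> card (invariant_funs n [])"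
    using card_inj_on_le finite_invariant_funs by blast
  then show ?thesis by (simp add: card_PiE)
qed

text \<open>One more reflection imposes one linear condition \<open>f a = f b\<close>, which divides the cardinality by at
  most three.\<close>

lemma card_invariant_funs_Cons:
  assumes "t \<in> reflections n"
  shows "card (invariant_funs n ts) \<le> 3 * card (invariant_funs n (t # ts))"
proof -
  obtain a b where t: "t = signed_transp a b" "a \<noteq> b" "a \<noteq> 0" "b \<noteq> 0"
    using assms by (elim reflectionsE)
  define K where "K = invariant_funs n (t # ts)"
  define F where "F v = {f \<in> invariant_funs n ts. f a - f b = v}" for v
  \<comment> \<open>Translation by a fixed element of a fibre embeds the fibre into the kernel \<open>K\<close>.\<close>
  have fibre: "card (F v) \<le> card K" for v
  proof (cases "F v = {}")
    case False
    then obtain g where g: "g \<in> F v" by blast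
    have "inj_on (\<lambda>f x. f x - g x) (F v)" by (rule inj_onI) (auto simp: fun_eq_iff)
    moreover have "(\<lambda>f x. f x - g x) ` F v \<subseteq> K"
    proof
      fix h assume "h \<in> (\<lambda>f x. f x - g x) ` F v"
      then obtain f where f: "f \<in> F v" "h = (\<lambda>x. f x - g x)" by blast
      have odd: "f (- x) = - f x" "g (- x) = - g x" for x using f g by (auto simp: F_def invariant_funs_def)
      have "f a - f b = g a - g b" using f g by (simp add: F_def)
      then have "f a - g a = f b - g b" "g a - f a = g b - f b" by (simp_all add: algebra_simps)
      then have "h (t x) = h x" for x
        unfolding t(1) signed_transp_apply[OF t(2-4)] f(2) using odd by auto
      then show "h \<in> K" using f g by (auto simp: F_def K_def invariant_funs_def)
    qed
    ultimately show ?thesis using finite_invariant_funs unfolding K_def by (intro card_inj_on_le) auto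
  qed simp
  have "invariant_funs n ts = (\<Union>v \<in> UNIV. F v)" by (auto simp: F_def)
  then have "card (invariant_funs n ts) \<le> (\<Sum>v \<in> (UNIV :: 3 set). card (F v))"
    by (simp only: card_UN_le finite)
  also have "\<dots> \<le> (\<Sum>v \<in> (UNIV :: 3 set). card K)" by (intro sum_mono fibre)
  also have "\<dots> = 3 * card K" by simp
  finally show ?thesis unfolding K_def .
qed

lemma card_invariant_funs:
  assumes "set ts \<subseteq> reflections n" shows "3 ^ n \<le> 3 ^ length ts * card (invariant_funs n ts)"
  using assms
proof (induction ts)
  case Nil then show ?case using card_invariant_funs_Nil by simp
next
  case (Cons t ts)
  then have "3 ^ n \<le> 3 ^ length ts * card (invariant_funs n ts)" by simp
  also have "\<dots> \<le> 3 ^ length ts * (3 * card (invariant_funs n (t # ts)))"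
    using card_invariant_funs_Cons[of t n ts] Cons.prems by (intro mult_left_mono) auto
  finally show ?case by simp
qed

lemma invariant_funs_compose_list: "f \<in> invariant_funs n ts \<Longrightarrow> f (compose_list ts x) = f x"
proof (induction ts)
  case (Cons t ts)
  then have "f (compose_list (t # ts) x) = f (compose_list ts x)"
    by (simp add: compose_list_Cons invariant_funs_def)
  also have "\<dots> = f x" using Cons by (simp add: invariant_funs_def)
  finally show ?case .
qed simp

section \<open>Configurations of cycles\<close>

text \<open>The order in which \<open>c\<close> visits the elements of \<open>\<plusminus>{1, \<dots>, n}\<close>, starting from \<open>1\<close>.\<close>

definition before :: "int \<Rightarrow> int \<Rightarrow> bool" where
  "before x y \<longleftrightarrow> (if 0 < x then y < 0 \<or> x < y else y < x)"

abbreviation follows :: "(int \<Rightarrow> int) \<Rightarrow> int list \<Rightarrow> bool" where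
  "follows w \<equiv> successively (\<lambda>x y. y = w x)"

text \<open>The cycles of \<open>w\<close> are \<open>C\<close> and \<open>-C\<close> for each list \<open>C\<close> in \<open>As\<close>, and \<open>ys\<close> followed by \<open>-ys\<close>.  Of two
  opposite cycles only one is recorded, and of the cycle \<open>B = -B\<close> only the positive half; \<open>w\<close> carries the
  last element of this half to the negative of its first element.  The condition on multisets says that
  the recorded elements represent each pair \<open>\<plusminus>i\<close> once.\<close>

definition config :: "nat \<Rightarrow> int list list \<Rightarrow> int list \<Rightarrow> (int \<Rightarrow> int) \<Rightarrow> bool" where
  "config n As ys w \<longleftrightarrow> w \<in> B_group n \<and>
     (\<forall>xs \<in> set As. xs \<noteq> [] \<and> sorted_wrt before xs \<and> follows w (xs @ [hd xs])) \<and>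
     sorted_wrt (<) ys \<and> (\<forall>y \<in> set ys. 0 < y) \<and> (ys \<noteq> [] \<longrightarrow> follows w (ys @ [- hd ys])) \<and>
     mset (map abs (concat As @ ys)) = mset [1..int n]"

lemma config_distinct: "config n As ys w \<Longrightarrow> distinct (map abs (concat As @ ys))"
  unfolding config_def by (metis distinct_upto mset_eq_imp_distinct_iff)

lemma config_abs: "config n As ys w \<Longrightarrow> abs ` set (concat As @ ys) = {1..int n}"
  unfolding config_def by (metis list.set_map mset_eq_setD set_upto)

lemma config_dom:
  assumes "config n As ys w" "x \<in> set (concat As @ ys)" shows "x \<in> signed_dom n"
proof -
  have "\<bar>x\<bar> \<in> {1..int n}" using config_abs[OF assms(1)] assms(2) by blast
  then show ?thesis by (simp add: signed_dom_def)
qed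

lemma config_length:
  assumes "config n As ys w" shows "sum_list (map length As) + length ys = n"
proof -
  have "length (map abs (concat As @ ys)) = length [1..int n]"
    using assms unfolding config_def by (metis size_mset)
  then show ?thesis by (simp add: length_concat)
qed

lemma config_cases:
  assumes "config n As ys w" "x \<in> signed_dom n"
  obtains l where "l < length As" "x \<in> set (As ! l)" | l where "l < length As" "- x \<in> set (As ! l)"
    | "\<bar>x\<bar> \<in> set ys"
proof -
  have "\<bar>x\<bar> \<in> abs ` set (concat As @ ys)" using config_abs[OF assms(1)] assms(2) by (auto simp: signed_dom_def)
  then obtain y where y: "\<bar>x\<bar> = \<bar>y\<bar>" "y \<in> set (concat As @ ys)" by auto
  show ?thesis
  proof (cases "y \<in> set ys")
    case True
    then have "0 < y" using assms(1) by (auto simp: config_def)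
    then show ?thesis using y True that(3) by simp
  next
    case False
    then obtain l where l: "l < length As" "y \<in> set (As ! l)"
      using y(2) by (auto simp: in_set_conv_nth[of _ As])
    have "y = x \<or> y = - x" using y(1) by linarith
    then show ?thesis using that(1)[OF l(1)] that(2)[OF l(1)] l(2) by auto
  qed
qed

lemma follows_const:
  assumes "follows w zs" "\<And>x. f (w x) = f x" "x \<in> set zs"
  shows "f x = f (hd zs)"
  using assms
proof (induction zs)
  case (Cons z zs) then show ?case by (cases "zs = []") (auto simp: successively_Cons)
qed simp

text \<open>A function that is fixed by \<open>w\<close> is constant on the cycles of \<open>w\<close>; on a cycle that contains \<open>x\<close> and
  \<open>-x\<close> its value is equal to its negative and hence zero.\<close>

lemma config_fun_values:
  assumes c: "config n As ys w" and f: "\<And>x. f (- x) = - f x" "\<And>x. f (w x) = f x"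
  shows "l < length As \<Longrightarrow> x \<in> set (As ! l) \<Longrightarrow> f x = f (hd (As ! l))"
    and "x \<in> set ys \<Longrightarrow> f x = (0 :: 3)"
proof -
  assume l: "l < length As" "x \<in> set (As ! l)"
  then have "follows w (As ! l @ [hd (As ! l)])" "As ! l \<noteq> []" using c by (auto simp: config_def)
  then have "follows w (As ! l)" by (simp add: successively_append_iff)
  then show "f x = f (hd (As ! l))" using follows_const f(2) l by blast
next
  assume x: "x \<in> set ys"
  then have ne: "ys \<noteq> []" by auto
  then have fol: "follows w (ys @ [- hd ys])" using c by (auto simp: config_def)
  have *: "f y = f (hd ys)" if "y \<in> set (ys @ [- hd ys])" for y
    using follows_const[where f = f, OF fol f(2) that] ne by simp
  have "f (hd ys) = - f (hd ys)" using *[of "- hd ys"] f(1) by simp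
  then have "f (hd ys) = 0" by (rule eq_uminus_imp_zero)
  then show "f x = 0" using *[of x] x by simp
qed

text \<open>An odd function fixed by all factors is fixed by \<open>w\<close>, hence is determined by one value for each list in
  \<open>As\<close>.  So there are at most \<open>3 ^ length As\<close> such functions, whereas \<open>card_invariant_funs\<close> gives at
  least \<open>3 ^ (n - length ts)\<close>.  If the two bounds agree, then every choice of values occurs.\<close>

lemma config_word_rank:
  assumes c: "config n As ys w" and ts: "set ts \<subseteq> reflections n" "w = compose_list ts"
  shows "n \<le> length ts + length As"
    and "n = length ts + length As \<Longrightarrow> l < length As \<Longrightarrow>
      \<exists>f \<in> invariant_funs n ts. \<forall>j < length As. f (hd (As ! j)) = (if j = l then 1 else 0)"
proof -
  define \<phi> where "\<phi> f = map (\<lambda>xs. f (hd xs)) As" for f :: "int \<Rightarrow> 3"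
  have inj: "inj_on \<phi> (invariant_funs n ts)"
  proof (rule inj_onI)
    fix f g assume f: "f \<in> invariant_funs n ts" and g: "g \<in> invariant_funs n ts" and e: "\<phi> f = \<phi> g"
    have odd: "f (- x) = - f x" "g (- x) = - g x" for x using f g by (auto simp: invariant_funs_def)
    have w: "f (w x) = f x" "g (w x) = g x" for x using f g invariant_funs_compose_list by (auto simp: ts(2))
    have hd: "f (hd (As ! l)) = g (hd (As ! l))" if "l < length As" for l
      using e that unfolding \<phi>_def by (metis nth_map)
    show "f = g"
    proof
      fix x
      show "f x = g x"
      proof (cases "x \<in> signed_dom n")
        case True
        from c this show ?thesis
        proof (cases rule: config_cases)
          case (1 l)
          then show ?thesis using config_fun_values(1)[OF c odd(1) w(1) 1] config_fun_values(1)[OF c odd(2) w(2) 1] hd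
            by simp
        next
          case (2 l)
          then have "f (- x) = g (- x)"
            using config_fun_values(1)[OF c odd(1) w(1) 2] config_fun_values(1)[OF c odd(2) w(2) 2] hd by simp
          then show ?thesis using odd by simp
        next
          case 3
          then have "f \<bar>x\<bar> = g \<bar>x\<bar>"
            using config_fun_values(2)[OF c odd(1) w(1) 3] config_fun_values(2)[OF c odd(2) w(2) 3] by simp
          then show ?thesis using odd by (cases "0 \<le> x") auto
        qed
      next
        case False then show ?thesis using f g by (simp add: invariant_funs_def)
      qed
    qed
  qed
  let ?L = "{zs :: 3 list. set zs \<subseteq> UNIV \<and> length zs = length As}"
  have card_L: "card ?L = 3 ^ length As" using card_lists_length_eq[of "UNIV :: 3 set" "length As"] by simp
  have finite_L: "finite ?L" by (rule finite_lists_length_eq) simp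
  have sub: "\<phi> ` invariant_funs n ts \<subseteq> ?L" by (auto simp: \<phi>_def)
  have card_eq: "card (\<phi> ` invariant_funs n ts) = card (invariant_funs n ts)" by (rule card_image[OF inj])
  have "card (invariant_funs n ts) \<le> 3 ^ length As" using card_mono[OF finite_L sub] card_L card_eq by simp
  then have "3 ^ length ts * card (invariant_funs n ts) \<le> 3 ^ length ts * 3 ^ length As" by (rule mult_left_mono) simp
  then have "(3 :: nat) ^ n \<le> 3 ^ (length ts + length As)"
    using card_invariant_funs[OF ts(1)] unfolding power_add by (rule order_trans[rotated])
  then show "n \<le> length ts + length As" by simp
  assume n: "n = length ts + length As" and l: "l < length As"
  then have "3 ^ length As \<le> card (invariant_funs n ts)" using card_invariant_funs[OF ts(1)] by (simp add: power_add)
  then have "\<phi> ` invariant_funs n ts = ?L" using card_seteq[OF finite_L sub] card_L card_eq by simp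
  moreover have "map (\<lambda>j. if j = l then 1 else 0) [0..<length As] \<in> ?L" by simp
  ultimately obtain f where f: "f \<in> invariant_funs n ts" "\<phi> f = map (\<lambda>j. if j = l then 1 else 0) [0..<length As]"
    by (metis (no_types, lifting) imageE)
  have "f (hd (As ! j)) = (if j = l then 1 else 0)" if "j < length As" for j
    using arg_cong[OF f(2), of "\<lambda>zs. zs ! j"] that by (simp add: \<phi>_def)
  then show "\<exists>f \<in> invariant_funs n ts. \<forall>j < length As. f (hd (As ! j)) = (if j = l then 1 else 0)"
    using f(1) by blast
qed

text \<open>In a shortest word every function that is constant on the cycles of \<open>w\<close> is fixed by each of the
  factors.  The function that is \<open>1\<close> on a cycle \<open>C\<close>, \<open>-1\<close> on \<open>-C\<close> and \<open>0\<close> elsewhere then shows that no factor moves an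
  element of \<open>C\<close> out of \<open>C\<close>.\<close>

lemma config_word_same_block:
  assumes c: "config n As ys w" and ts: "set ts \<subseteq> reflections n" "w = compose_list ts"
    and n: "n = length ts + length As" and t: "signed_transp a b \<in> set ts"
    and ab: "a \<noteq> b" "a \<in> signed_dom n" "b \<in> signed_dom n"
  shows "(\<exists>l < length As. {a, b} \<subseteq> set (As ! l) \<or> {- a, - b} \<subseteq> set (As ! l)) \<or> {\<bar>a\<bar>, \<bar>b\<bar>} \<subseteq> set ys"
proof -
  have nz: "a \<noteq> 0" "b \<noteq> 0" using ab signed_dom_nonzero by auto
  have core: "y \<in> set (As ! l)"
    if l: "l < length As" "x \<in> set (As ! l)" and y: "y \<in> signed_dom n"
      and same: "\<And>f. f \<in> invariant_funs n ts \<Longrightarrow> f x = f y" for l x y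
  proof -
    obtain f where f: "f \<in> invariant_funs n ts" "\<And>j. j < length As \<Longrightarrow> f (hd (As ! j)) = (if j = l then 1 else 0)"
      using config_word_rank(2)[OF c ts n l(1)] by blast
    have odd: "f (- x) = - f x" for x using f by (auto simp: invariant_funs_def)
    have w: "f (w x) = f x" for x using f invariant_funs_compose_list by (auto simp: ts(2))
    note vals = config_fun_values[OF c odd w]
    have fy: "f y = 1" using same[OF f(1)] vals(1)[OF l] f(2) l by simp
    from c y show ?thesis
    proof (cases rule: config_cases)
      case (1 j)
      then have "f y = (if j = l then 1 else 0)" using vals(1)[OF 1] f(2) by simp
      then show ?thesis using fy 1 by (cases "j = l") auto
    next
      case (2 j)
      then have "- f y = (if j = l then 1 else 0)" using vals(1)[OF 2] f(2) odd by simp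
      moreover have "- (1 :: 3) \<noteq> 1" "- (1 :: 3) \<noteq> 0" by simp_all
      ultimately show ?thesis using fy by (cases "j = l") auto
    next
      case 3
      then have "f \<bar>y\<bar> = 0" using vals(2) by blast
      then have "f y = 0" using odd by (cases "0 \<le> y") auto
      then show ?thesis using fy by simp
    qed
  qed
  have same: "f a = f b" if "f \<in> invariant_funs n ts" for f
  proof -
    have "f (signed_transp a b b) = f b" using that t unfolding invariant_funs_def by blast
    then show ?thesis using ab nz by (simp add: signed_transp_apply split: if_splits)
  qed
  have same': "f (- a) = f (- b)" if "f \<in> invariant_funs n ts" for f
    using same[OF that] that by (simp add: invariant_funs_def)
  from c ab(2) show ?thesis
  proof (cases rule: config_cases)
    case (1 l) then show ?thesis using core[OF 1 ab(3) same] by auto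
  next
    case (2 l)
    have "- b \<in> set (As ! l)" by (rule core[OF 2]) (use ab(3) same' in auto)
    then show ?thesis using 2 by auto
  next
    case 3
    from c ab(3) show ?thesis
    proof (cases rule: config_cases)
      case (1 l) then show ?thesis using core[OF 1 ab(2) same[symmetric]] by auto
    next
      case (2 l)
      have "- a \<in> set (As ! l)" by (rule core[OF 2]) (use ab(2) same'[symmetric] in auto)
      then show ?thesis using 2 by auto
    next
      case 3 then show ?thesis using \<open>\<bar>a\<bar> \<in> set ys\<close> by simp
    qed
  qed
qed

section \<open>Splitting a cycle by a reflection\<close>

lemma follows_update:
  assumes "follows w zs" "\<And>x. x \<in> set (butlast zs) \<Longrightarrow> t x = x"
  shows "follows (w \<circ> t) zs"
  using assms
proof (induction zs)
  case (Cons z zs)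
  show ?case
  proof (cases "zs = []")
    case False
    then have "follows (w \<circ> t) zs" using Cons by (auto simp: successively_Cons)
    then show ?thesis using Cons.prems False by (auto simp: successively_Cons)
  qed simp
qed simp

lemma follows_snoc:
  "zs \<noteq> [] \<Longrightarrow> follows w (zs @ [x]) \<longleftrightarrow> follows w zs \<and> x = w (last zs)"
  by (simp add: successively_append_iff)

lemma follows_append:
  "xs \<noteq> [] \<Longrightarrow> ys \<noteq> [] \<Longrightarrow>
    follows w (xs @ ys) \<longleftrightarrow> follows w xs \<and> follows w ys \<and> hd ys = w (last xs)"
  by (simp add: successively_append_iff)

lemma follows_uminus:
  assumes "w \<in> B_group n" shows "follows w (map uminus zs) \<longleftrightarrow> follows w zs"
  by (simp add: successively_map B_group_odd[OF assms])

lemma signed_transp_other: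
  "\<bar>x\<bar> \<noteq> \<bar>a\<bar> \<Longrightarrow> \<bar>x\<bar> \<noteq> \<bar>b\<bar> \<Longrightarrow> a \<noteq> b \<Longrightarrow> a \<noteq> 0 \<Longrightarrow> b \<noteq> 0 \<Longrightarrow> signed_transp a b x = x"
  by (auto simp: signed_transp_apply)

lemma sorted_imp_before:
  "sorted_wrt (<) ys \<Longrightarrow> \<forall>y \<in> set ys. 0 < y \<Longrightarrow> sorted_wrt before ys"
  by (erule sorted_wrt_mono_rel[rotated]) (auto simp: before_def)

lemma sorted_imp_before_uminus:
  "sorted_wrt (<) ys \<Longrightarrow> \<forall>y \<in> set ys. 0 < y \<Longrightarrow> sorted_wrt before (map uminus ys)"
  unfolding sorted_wrt_map by (erule sorted_wrt_mono_rel[rotated]) (auto simp: before_def)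

lemma config_update_rest:
  assumes c: "config n As ys w"
    and xs: "xs \<in> set As" and t: "\<And>x. x \<in> set xs \<Longrightarrow> t x = x"
  shows "xs \<noteq> [] \<and> sorted_wrt before xs \<and> follows (w \<circ> t) (xs @ [hd xs])"
  using c xs t unfolding config_def by (auto intro!: follows_update simp del: comp_apply)

lemma distinct_map_neq:
  assumes "distinct (map g zs)" "zs = xs @ a # ys" "x \<in> set xs \<union> set ys"
  shows "g x \<noteq> g a"
proof -
  have "g a \<notin> g ` (set xs \<union> set ys)" using assms(1) unfolding assms(2) by auto
  then show ?thesis using assms(3) by (metis imageI)
qed

text \<open>A reflection that interchanges two elements of a cycle cuts the arc between them out of the
  cycle; both parts keep their order.\<close>

lemma config_split_A:
  assumes c: "config n (As1 @ (p @ q @ r) # As2) ys w" and pq: "p \<noteq> []" "q \<noteq> []"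
  shows "config n (q # (p @ r) # As1 @ As2) ys (w \<circ> signed_transp (last p) (last q))"
proof -
  define t where "t = signed_transp (last p) (last q)"
  obtain p' a where p: "p = p' @ [a]" using pq(1) rev_exhaust by blast
  obtain q' b where q: "q = q' @ [b]" using pq(2) rev_exhaust by blast
  have la: "last p = a" "last q = b" by (simp_all add: p q)
  note D = config_distinct[OF c, unfolded p q]
  have B: "w \<in> B_group n" using c by (simp add: config_def)
  have dom: "a \<in> signed_dom n" "b \<in> signed_dom n" by (auto intro!: config_dom[OF c] simp: p q)
  have "\<bar>b\<bar> \<noteq> \<bar>a\<bar>"
    by (rule distinct_map_neq[OF D, where xs = "concat As1 @ p'" and ys = "q' @ b # r @ concat As2 @ ys"]) auto
  then have ab: "a \<noteq> b" "a \<noteq> 0" "b \<noteq> 0" using dom signed_dom_nonzero by auto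
  have t_def': "t = signed_transp a b" by (simp add: t_def p q)
  have fix_t: "t x = x" if "x \<in> set p' \<union> set q' \<union> set r \<union> set (concat (As1 @ As2)) \<union> set ys" for x
  proof -
    have "\<bar>x\<bar> \<noteq> \<bar>a\<bar>"
      by (rule distinct_map_neq[OF D, where xs = "concat As1 @ p'" and ys = "q' @ b # r @ concat As2 @ ys"])
        (use that in auto)
    moreover have "\<bar>x\<bar> \<noteq> \<bar>b\<bar>"
      by (rule distinct_map_neq[OF D, where xs = "concat As1 @ p' @ a # q'" and ys = "r @ concat As2 @ ys"])
        (use that in auto)
    ultimately show ?thesis unfolding t_def' using ab by (intro signed_transp_other)
  qed
  have t_ab: "t a = b" "t b = a" using ab by (auto simp: t_def' signed_transp_apply)
  have "follows w (p @ (q @ (r @ [hd p])))" "sorted_wrt before (p @ q @ r)"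
    using c pq by (auto simp: config_def)
  then have f: "follows w p" "follows w q" "follows w (r @ [hd p])" "hd q = w a" "hd (r @ [hd p]) = w b"
    and s: "sorted_wrt before q" "sorted_wrt before (p @ r)"
    using pq la by (auto simp: follows_append sorted_wrt_append)
  have f': "follows (w \<circ> t) p" "follows (w \<circ> t) q" "follows (w \<circ> t) (r @ [hd p])"
    using f(1-3) fix_t by (auto intro!: follows_update simp: p q butlast_append simp del: comp_apply)
  have new_q: "follows (w \<circ> t) (q @ [hd q])" using f'(2) f(4) pq(2) t_ab la by (simp add: follows_snoc)
  have "follows (w \<circ> t) (p @ (r @ [hd p]))"
    using f'(1,3) f(5) pq(1) t_ab la by (subst follows_append) auto
  then have new_pr: "follows (w \<circ> t) ((p @ r) @ [hd (p @ r)])" using pq(1) by simp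
  have rest: "xs \<noteq> [] \<and> sorted_wrt before xs \<and> follows (w \<circ> t) (xs @ [hd xs])"
    if "xs \<in> set (As1 @ As2)" for xs
    using that fix_t by (intro config_update_rest[OF c]) auto
  have ys: "sorted_wrt (<) ys" "\<forall>y \<in> set ys. 0 < y" "ys \<noteq> [] \<longrightarrow> follows w (ys @ [- hd ys])"
    using c by (auto simp: config_def)
  have "ys \<noteq> [] \<longrightarrow> follows (w \<circ> t) (ys @ [- hd ys])"
    using ys(3) fix_t by (auto intro!: follows_update simp del: comp_apply)
  moreover have "w \<circ> t \<in> B_group n"
    unfolding t_def' by (intro B_group_comp B reflections_B_group signed_transp_in_reflections dom ab)
  moreover have "mset (map abs (concat (q # (p @ r) # As1 @ As2) @ ys)) = mset [1..int n]"
    using c by (simp add: config_def ac_simps)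
  ultimately show ?thesis unfolding t_def[symmetric] config_def
    using ys(1,2) new_q new_pr s rest pq by (simp del: comp_apply)
qed

lemma config_split_B:
  assumes c: "config n As (p @ q @ r) w" and pq: "p \<noteq> []" "q \<noteq> []"
  shows "config n (q # As) (p @ r) (w \<circ> signed_transp (last p) (last q))"
proof -
  define t where "t = signed_transp (last p) (last q)"
  obtain p' a where p: "p = p' @ [a]" using pq(1) rev_exhaust by blast
  obtain q' b where q: "q = q' @ [b]" using pq(2) rev_exhaust by blast
  have la: "last p = a" "last q = b" by (simp_all add: p q)
  note D = config_distinct[OF c, unfolded p q]
  have B: "w \<in> B_group n" using c by (simp add: config_def)
  have dom: "a \<in> signed_dom n" "b \<in> signed_dom n" by (auto intro!: config_dom[OF c] simp: p q)
  have "\<bar>b\<bar> \<noteq> \<bar>a\<bar>"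
    by (rule distinct_map_neq[OF D, where xs = "concat As @ p'" and ys = "q' @ b # r"]) auto
  then have ab: "a \<noteq> b" "a \<noteq> 0" "b \<noteq> 0" using dom signed_dom_nonzero by auto
  have t_def': "t = signed_transp a b" by (simp add: t_def p q)
  have fix_t: "t x = x" if "x \<in> set p' \<union> set q' \<union> set r \<union> set (concat As)" for x
  proof -
    have "\<bar>x\<bar> \<noteq> \<bar>a\<bar>"
      by (rule distinct_map_neq[OF D, where xs = "concat As @ p'" and ys = "q' @ b # r"]) (use that in auto)
    moreover have "\<bar>x\<bar> \<noteq> \<bar>b\<bar>"
      by (rule distinct_map_neq[OF D, where xs = "concat As @ p' @ a # q'" and ys = r]) (use that in auto)
    ultimately show ?thesis unfolding t_def' using ab by (intro signed_transp_other)
  qed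
  have t_ab: "t a = b" "t b = a" using ab by (auto simp: t_def' signed_transp_apply)
  have "follows w (p @ (q @ (r @ [- hd p])))" and s: "sorted_wrt (<) (p @ q @ r)"
      and pos: "\<forall>y \<in> set (p @ q @ r). 0 < y"
    using c pq by (auto simp: config_def)
  then have f: "follows w p" "follows w q" "follows w (r @ [- hd p])" "hd q = w a" "hd (r @ [- hd p]) = w b"
    using pq la by (auto simp: follows_append)
  have f': "follows (w \<circ> t) p" "follows (w \<circ> t) q" "follows (w \<circ> t) (r @ [- hd p])"
    using f(1-3) fix_t by (auto intro!: follows_update simp: p q butlast_append simp del: comp_apply)
  have new_q: "follows (w \<circ> t) (q @ [hd q])" using f'(2) f(4) pq(2) t_ab la by (simp add: follows_snoc)
  have "follows (w \<circ> t) (p @ (r @ [- hd p]))"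
    using f'(1,3) f(5) pq(1) t_ab la by (subst follows_append) auto
  then have new_pr: "follows (w \<circ> t) ((p @ r) @ [- hd (p @ r)])" using pq(1) by simp
  have rest: "xs \<noteq> [] \<and> sorted_wrt before xs \<and> follows (w \<circ> t) (xs @ [hd xs])"
    if "xs \<in> set As" for xs
    using that fix_t by (intro config_update_rest[OF c]) auto
  have "sorted_wrt before q" using s pos by (intro sorted_imp_before) (auto simp: sorted_wrt_append)
  moreover have "w \<circ> t \<in> B_group n"
    unfolding t_def' by (intro B_group_comp B reflections_B_group signed_transp_in_reflections dom ab)
  moreover have "mset (map abs (concat (q # As) @ (p @ r))) = mset [1..int n]"
    using c by (simp add: config_def ac_simps)
  moreover have "sorted_wrt (<) (p @ r)" "\<forall>y \<in> set (p @ r). 0 < y" using s pos by (auto simp: sorted_wrt_append)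
  ultimately show ?thesis unfolding t_def[symmetric] config_def
    using new_q new_pr rest pq by (simp del: comp_apply)
qed

text \<open>The reflection interchanges the end of \<open>p\<close> with the negative of the end of \<open>p @ q\<close>, where \<open>q\<close> may be empty.  The arc that it cuts
  out of the full cycle runs through the end of the positive half into the negative half; the part that stays
  symmetric is \<open>q\<close> together with \<open>-q\<close>.\<close>

lemma config_split_B_wrap:
  assumes c: "config n As (p @ q @ r) w" and pq: "p \<noteq> []"
  shows "config n ((r @ map uminus p) # As) q (w \<circ> signed_transp (last p) (- last (p @ q)))"
proof -
  define b where "b = last (p @ q)"
  define t where "t = signed_transp (last p) (- b)"
  obtain p' a where p: "p = p' @ [a]" using pq(1) rev_exhaust by blast
  have la: "last p = a" by (simp add: p)
  note D = config_distinct[OF c, unfolded p]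
  have B: "w \<in> B_group n" using c by (simp add: config_def)
  have b_in: "b \<in> set (p @ q)" unfolding b_def using pq by (intro last_in_set) simp
  have dom: "a \<in> signed_dom n" "b \<in> signed_dom n" using b_in by (auto intro!: config_dom[OF c] simp: p)
  have "\<forall>y \<in> set (p @ q @ r). 0 < y" and s: "sorted_wrt (<) (p @ q @ r)" using c by (auto simp: config_def)
  then have pos: "\<forall>y \<in> set p. 0 < y" "\<forall>y \<in> set q. 0 < y" "\<forall>y \<in> set r. 0 < y" by auto
  then have "0 < a" "0 < b" using b_in by (auto simp: p)
  then have ab: "a \<noteq> - b" "a \<noteq> 0" "- b \<noteq> 0" by auto
  have t_def': "t = signed_transp a (- b)" by (simp add: t_def p)
  have fix_t: "t x = x" if "x \<in> set p' \<union> set (butlast q) \<union> set r \<union> set (concat As)" for x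
  proof -
    have a: "\<bar>x\<bar> \<noteq> \<bar>a\<bar>"
      by (rule distinct_map_neq[OF D, where xs = "concat As @ p'" and ys = "q @ r"])
        (use that in \<open>auto dest: in_set_butlastD\<close>)
    moreover have "\<bar>x\<bar> \<noteq> \<bar>- b\<bar>"
    proof (cases "q = []")
      case True then show ?thesis using a by (simp add: b_def p)
    next
      case False
      then have q: "q = butlast q @ [b]" by (simp add: b_def)
      have "concat As @ (p' @ [a]) @ q @ r = (concat As @ p' @ a # butlast q) @ b # r"
        by (subst q) simp
      then have "\<bar>x\<bar> \<noteq> \<bar>b\<bar>" by (rule distinct_map_neq[OF D]) (use that in auto)
      then show ?thesis by simp
    qed
    ultimately show ?thesis unfolding t_def' using ab by (intro signed_transp_other)
  qed
  have t_ab: "t (- a) = b" "t b = - a" using ab by (auto simp: t_def' signed_transp_apply)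
  have "follows w ((p @ q) @ (r @ [- hd p]))" using c pq by (auto simp: config_def)
  then have f: "follows w (p @ q)" "follows w (r @ [- hd p])" "hd (r @ [- hd p]) = w b"
    unfolding b_def using pq by (subst (asm) follows_append; simp)+
  have fp: "follows w p" "follows w q" "q \<noteq> [] \<Longrightarrow> hd q = w a"
    using f(1) pq la by (cases "q = []"; auto simp: follows_append)+
  have f': "follows (w \<circ> t) p" "follows (w \<circ> t) q" "follows (w \<circ> t) (r @ [- hd p])"
    using fp f(2) fix_t by (auto intro!: follows_update simp: p butlast_append simp del: comp_apply)
  have Bt: "w \<circ> t \<in> B_group n"
    unfolding t_def' using dom by (intro B_group_comp B reflections_B_group signed_transp_in_reflections ab) auto
  let ?m = "map uminus p"
  have m: "?m \<noteq> []" "hd ?m = - hd p" "last ?m = - a" using pq la by (simp_all add: hd_map last_map)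
  have fm: "follows (w \<circ> t) ?m" using f'(1) follows_uminus[OF Bt] by blast
  have frm: "follows (w \<circ> t) (r @ ?m)"
  proof (cases "r = []")
    case False
    then show ?thesis using f'(3) fm m by (simp add: follows_append)
  qed (use fm in simp)
  have "hd (r @ ?m) = w b" using f(3) m by (cases r) auto
  then have new_A: "follows (w \<circ> t) ((r @ ?m) @ [hd (r @ ?m)])"
    using frm m t_ab by (subst follows_snoc) auto
  have new_B: "follows (w \<circ> t) (q @ [- hd q])" if "q \<noteq> []"
  proof -
    have "b = last q" using that by (simp add: b_def)
    then have "(w \<circ> t) (last q) = - hd q" using t_ab fp(3)[OF that] B_group_odd[OF B] by simp
    then show ?thesis using f'(2) that by (simp add: follows_snoc)
  qed
  have sA: "sorted_wrt before (r @ ?m)"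
    using s pos sorted_imp_before[of r] sorted_imp_before_uminus[of p] by (auto simp: sorted_wrt_append before_def)
  have rest: "xs \<noteq> [] \<and> sorted_wrt before xs \<and> follows (w \<circ> t) (xs @ [hd xs])"
    if "xs \<in> set As" for xs
    using that fix_t by (intro config_update_rest[OF c]) auto
  have "abs \<circ> uminus = (abs :: int \<Rightarrow> int)" by auto
  then have "mset (map abs (concat ((r @ ?m) # As) @ q)) = mset [1..int n]"
    using c by (simp add: config_def ac_simps)
  moreover have "sorted_wrt (<) q" using s by (auto simp: sorted_wrt_append)
  moreover have "r @ ?m \<noteq> []" using m by simp
  ultimately show ?thesis unfolding b_def[symmetric] t_def[symmetric] config_def
    using new_A new_B rest sA pos Bt by (auto simp del: comp_apply)
qed

section \<open>Order-preserving and order-reversing splittings\<close>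

text \<open>Along a cycle the values rise while they are positive and fall afterwards, so the later of two
  elements is the larger one exactly if it is positive.\<close>

lemma before_less_iff: "before x y \<Longrightarrow> x < y \<longleftrightarrow> 0 < y"
  by (auto simp: before_def split: if_splits)

lemma before_sorted_positive_prefix:
  assumes "sorted_wrt before xs"
  shows "\<exists>a \<le> length xs. \<forall>i < length xs. 0 < xs ! i \<longleftrightarrow> i < a"
  using assms
proof (induction xs)
  case (Cons x xs)
  show ?case
  proof (cases "0 < x")
    case True
    obtain a where "a \<le> length xs" "\<forall>i < length xs. 0 < xs ! i \<longleftrightarrow> i < a" using Cons by auto
    then show ?thesis using True by (intro exI[of _ "Suc a"]) (auto simp: nth_Cons split: nat.splits)
  next
    case False
    then have "\<not> 0 < (x # xs) ! i" if "i < length (x # xs)" for i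
    proof (cases i)
      case (Suc l)
      then have "before x (xs ! l)" using Cons.prems that by simp
      then show ?thesis using False Suc by (simp add: before_def)
    qed (use False in simp)
    then show ?thesis by (intro exI[of _ 0]) auto
  qed
qed simp

lemma follows_nth: "follows w zs \<Longrightarrow> Suc i < length zs \<Longrightarrow> w (zs ! i) = zs ! Suc i"
  by (induction zs arbitrary: i) (auto simp: successively_Cons nth_Cons hd_conv_nth split: nat.splits)

text \<open>By \<open>before_less_iff\<close> the comparison of two elements depends on the sign of the later one alone, so passing to the
  successors changes it only if the later element is the last positive one, or if its successor is the first
  element of the list.\<close>

lemma cycle_A_preserves_order_iff:
  assumes xs: "sorted_wrt before xs" "follows w (xs @ [hd xs])"
    and a: "\<forall>i < length xs. 0 < xs ! i \<longleftrightarrow> i < a" "a \<le> length xs"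
    and ij: "i < j" "j < length xs"
  shows "(w (xs ! i) < w (xs ! j) \<longleftrightarrow> xs ! i < xs ! j) \<longleftrightarrow>
    \<not> (Suc j = a \<or> Suc j = length xs \<and> a \<le> Suc i)"
proof -
  let ?k = "length xs"
  have less: "xs ! i' < xs ! j' \<longleftrightarrow> j' < a" if "i' < j'" "j' < ?k" for i' j'
    using before_less_iff[OF sorted_wrt_nth_less[OF xs(1) that]] a(1) that(2) by simp
  have neq: "xs ! 0 \<noteq> xs ! j'" if "0 < j'" "j' < ?k" for j'
    using sorted_wrt_nth_less[OF xs(1) that] by (auto simp: before_def split: if_splits)
  have w: "w (xs ! l) = (if Suc l < ?k then xs ! Suc l else xs ! 0)" if "l < ?k" for l
  proof -
    have "w ((xs @ [hd xs]) ! l) = (xs @ [hd xs]) ! Suc l" using that by (intro follows_nth[OF xs(2)]) simp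
    moreover have "hd xs = xs ! 0" using that by (cases xs) auto
    ultimately show ?thesis using that by (simp add: nth_append split: if_splits)
  qed
  show ?thesis
  proof (cases "Suc j < ?k")
    case True
    then have "w (xs ! i) < w (xs ! j) \<longleftrightarrow> Suc j < a" using w ij less[of "Suc i" "Suc j"] by simp
    moreover have "xs ! i < xs ! j \<longleftrightarrow> j < a" using less ij by simp
    ultimately show ?thesis using True by auto
  next
    case False
    then have "w (xs ! i) < w (xs ! j) \<longleftrightarrow> xs ! Suc i < xs ! 0" using w ij by simp
    also have "\<dots> \<longleftrightarrow> \<not> Suc i < a"
      using less[of 0 "Suc i"] neq[of "Suc i"] ij by (auto simp: not_less order_le_less)
    moreover have "xs ! i < xs ! j \<longleftrightarrow> j < a" using less ij by simp
    ultimately show ?thesis using False ij a(2) by auto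
  qed
qed

lemma cycle_B_nth:
  assumes "follows w (ys @ [- hd ys])" "l < length ys"
  shows "w (ys ! l) = (if Suc l < length ys then ys ! Suc l else - (ys ! 0))"
proof -
  have "w ((ys @ [- hd ys]) ! l) = (ys @ [- hd ys]) ! Suc l" using assms by (intro follows_nth) auto
  moreover have "hd ys = ys ! 0" using assms(2) by (cases ys) auto
  ultimately show ?thesis using assms(2) by (simp add: nth_append split: if_splits)
qed

lemma cycle_B_preserves_order_iff:
  assumes ys: "sorted_wrt (<) ys" "\<forall>y \<in> set ys. 0 < y" "follows w (ys @ [- hd ys])"
    and ij: "i < j" "j < length ys"
  shows "(w (ys ! i) < w (ys ! j) \<longleftrightarrow> ys ! i < ys ! j) \<longleftrightarrow> Suc j \<noteq> length ys"
proof -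
  have pos: "0 < ys ! l" if "l < length ys" for l using ys(2) that by simp
  have less: "ys ! i' < ys ! j'" if "i' < j'" "j' < length ys" for i' j'
    using sorted_wrt_nth_less[OF ys(1) that] .
  have "0 < ys ! 0" using ij by (intro pos) auto
  then show ?thesis using cycle_B_nth[OF ys(3), of i] cycle_B_nth[OF ys(3), of j] ij
      less[of i j] less[of "Suc i" "Suc j"] pos[of "Suc i"] by (auto simp: not_less)
qed

lemma cycle_B_wrap_preserves_order_iff:
  assumes ys: "sorted_wrt (<) ys" "\<forall>y \<in> set ys. 0 < y" "follows w (ys @ [- hd ys])"
    and w: "w \<in> B_group n" and ij: "i \<le> j" "j < length ys"
  shows "(w (ys ! i) < w (- (ys ! j)) \<longleftrightarrow> ys ! i < - (ys ! j)) \<longleftrightarrow> Suc i \<noteq> length ys"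
proof -
  have pos: "0 < ys ! l" if "l < length ys" for l using ys(2) that by simp
  have less: "ys ! 0 < ys ! j'" if "0 < j'" "j' < length ys" for j'
    using sorted_wrt_nth_less[OF ys(1) that] .
  have "0 < ys ! 0" using ij by (intro pos) auto
  then show ?thesis unfolding B_group_odd[OF w]
    using cycle_B_nth[OF ys(3), of i] cycle_B_nth[OF ys(3), of j] ij
      pos[of i] pos[of j] less[of "Suc i"] pos[of "Suc i"] pos[of "Suc j"] by (auto simp: not_less)
qed

section \<open>Summation over the splittings of a cycle\<close>

lemma finite_pairs: "finite {(i, j). i < j \<and> j < (k :: nat)}" "finite {(i, j). i \<le> j \<and> j < (k :: nat)}"
  by (rule finite_subset[of _ "{..<k} \<times> {..<k}"]; auto)+

lemma sum_pairs_less: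
  fixes g :: "nat \<Rightarrow> real"
  shows "(\<Sum>(i, j) \<in> {(i, j). i < j \<and> j < k}. g (j - i)) = (\<Sum>d = 1..<k. of_nat (k - d) * g d)"
proof -
  have "(\<Sum>(i, j) \<in> {(i, j). i < j \<and> j < k}. g (j - i)) =
      (\<Sum>(d, i) \<in> Sigma {1..<k} (\<lambda>d. {..<k - d}). g d)"
    by (rule sum.reindex_bij_witness[of _ "\<lambda>(d, i). (i, i + d)" "\<lambda>(i, j). (j - i, i)"]) auto
  also have "\<dots> = (\<Sum>d = 1..<k. \<Sum>i < k - d. g d)" by (subst sum.Sigma) auto
  finally show ?thesis by simp
qed

lemma sum_pairs_le:
  fixes g :: "nat \<Rightarrow> real"
  shows "(\<Sum>(i, j) \<in> {(i, j). i \<le> j \<and> j < k}. g (k - (j - i))) = (\<Sum>d = 1..k. of_nat d * g d)"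
proof -
  have "(\<Sum>(i, j) \<in> {(i, j). i \<le> j \<and> j < k}. g (k - (j - i))) =
      (\<Sum>(d, i) \<in> Sigma {1..k} (\<lambda>d. {..<d}). g d)"
    by (rule sum.reindex_bij_witness[of _ "\<lambda>(d, i). (i, i + (k - d))" "\<lambda>(i, j). (k - (j - i), i)"]) auto
  also have "\<dots> = (\<Sum>d = 1..k. \<Sum>i < d. g d)" by (subst sum.Sigma) auto
  finally show ?thesis by simp
qed

lemma sum_good_split:
  fixes q :: real
  assumes "finite A"
  shows "(\<Sum>x \<in> A. (if P x then 1 else q) * f x) = q * (\<Sum>x \<in> A. f x) + (1 - q) * (\<Sum>x \<in> {x \<in> A. P x}. f x)"
proof -
  have "(\<Sum>x \<in> A. (if P x then 1 else q) * f x) = (\<Sum>x \<in> A. q * f x + (if P x then (1 - q) * f x else 0))"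
    by (intro sum.cong) (auto simp: algebra_simps)
  also have "\<dots> = q * (\<Sum>x \<in> A. f x) + (\<Sum>x \<in> {x \<in> A. P x}. (1 - q) * f x)"
    using assms by (simp add: sum.distrib sum_distrib_left sum.inter_filter)
  finally show ?thesis by (simp add: sum_distrib_left)
qed

text \<open>The exceptional pairs, of weight \<open>1\<close>, are those with \<open>j\<close> the last position before \<open>a\<close> and those with \<open>j\<close>
  the last position of all.  The former have the distances \<open>1, \<dots>, a - 1\<close> and the latter, up to the symmetry \<open>d \<mapsto> k - d\<close>, the
  remaining ones; so each distance occurs once, whatever \<open>a\<close> is.\<close>

lemma weighted_sum_A:
  fixes g :: "nat \<Rightarrow> real" and q :: real
  assumes g: "\<And>d. 1 \<le> d \<Longrightarrow> d < k \<Longrightarrow> g (k - d) = g d" and a: "a \<le> k"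
  shows "(\<Sum>(i, j) \<in> {(i, j). i < j \<and> j < k}.
      (if Suc j = a \<or> Suc j = k \<and> a \<le> Suc i then 1 else q) * g (j - i)) =
    (1 - q + q * of_nat k / 2) * (\<Sum>d = 1..<k. g d)"
proof -
  let ?A = "{(i, j). i < j \<and> j < k}"
  let ?P = "\<lambda>(i, j). Suc j = a \<or> Suc j = k \<and> a \<le> Suc i"
  have "(\<Sum>d = 1..<k. of_nat (k - d) * g d) = (\<Sum>d = 1..<k. of_nat d * g d)"
    by (rule sum.reindex_bij_witness[of _ "\<lambda>d. k - d" "\<lambda>d. k - d"]) (auto simp: g)
  moreover have "(\<Sum>d = 1..<k. of_nat (k - d) * g d) + (\<Sum>d = 1..<k. of_nat d * g d) =
      of_nat k * (\<Sum>d = 1..<k. g d)"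
    unfolding sum.distrib[symmetric] sum_distrib_left by (intro sum.cong) (auto simp: of_nat_diff algebra_simps)
  ultimately have all: "(\<Sum>(i, j) \<in> ?A. g (j - i)) = of_nat k / 2 * (\<Sum>d = 1..<k. g d)"
    unfolding sum_pairs_less by simp
  \<comment> \<open>The symmetry of \<open>g\<close> matches the pair \<open>(i, k - 1)\<close>, whose distance is \<open>k - 1 - i\<close>, with \<open>d = i + 1\<close>.\<close>
  have sym: "g (Suc i) = g (k - 1 - i)" if "i < k - 1" for i using g[of "Suc i"] that by simp
  have good: "(\<Sum>(i, j) \<in> {x \<in> ?A. ?P x}. g (j - i)) = (\<Sum>d = 1..<k. g d)"
    by (rule sum.reindex_bij_witness[of _ "\<lambda>d. if d < a then (a - 1 - d, a - 1) else (d - 1, k - 1)"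
          "\<lambda>(i, j). if Suc j = a then j - i else Suc i"])
      (use a sym in \<open>auto split: if_splits\<close>)
  have "(\<Sum>(i, j) \<in> ?A. (if Suc j = a \<or> Suc j = k \<and> a \<le> Suc i then 1 else q) * g (j - i)) =
      (\<Sum>x \<in> ?A. (if ?P x then 1 else q) * (case x of (i, j) \<Rightarrow> g (j - i)))"
    by (intro sum.cong HOL.refl) (simp only: split_def)
  also have "\<dots> = q * (of_nat k / 2 * (\<Sum>d = 1..<k. g d)) + (1 - q) * (\<Sum>d = 1..<k. g d)"
    unfolding sum_good_split[OF finite_pairs(1)] all good ..
  finally show ?thesis by (simp add: algebra_simps)
qed

text \<open>The first sum belongs to arcs inside the positive half, of size \<open>j - i\<close>, and the second one to arcs that
  run into the negative half, of size \<open>k - (j - i)\<close>.  Each size \<open>d \<le> k\<close> belongs to \<open>k\<close> arcs in total, exactly one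
  of which has weight \<open>1\<close>.\<close>

lemma weighted_sum_B:
  fixes g :: "nat \<Rightarrow> real" and q :: real
  shows "(\<Sum>(i, j) \<in> {(i, j). i < j \<and> j < k}. (if Suc j = k then 1 else q) * g (j - i)) +
    (\<Sum>(i, j) \<in> {(i, j). i \<le> j \<and> j < k}. (if Suc i = k then 1 else q) * g (k - (j - i))) =
    (1 - q + q * of_nat k) * (\<Sum>d = 1..k. g d)"
proof -
  let ?A = "{(i, j). i < j \<and> j < k}" and ?B = "{(i, j). i \<le> j \<and> j < k}"
  let ?f = "\<lambda>(i, j). g (j - i)" and ?h = "\<lambda>(i, j). g (k - (j - i))"
  have A: "(\<Sum>(i, j) \<in> ?A. (if Suc j = k then 1 else q) * g (j - i)) =
      q * (\<Sum>x \<in> ?A. ?f x) + (1 - q) * (\<Sum>x \<in> {x \<in> ?A. Suc (snd x) = k}. ?f x)"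
    unfolding sum_good_split[OF finite_pairs(1), symmetric] by (intro sum.cong) auto
  have B: "(\<Sum>(i, j) \<in> ?B. (if Suc i = k then 1 else q) * g (k - (j - i))) =
      q * (\<Sum>x \<in> ?B. ?h x) + (1 - q) * (\<Sum>x \<in> {x \<in> ?B. Suc (fst x) = k}. ?h x)"
    unfolding sum_good_split[OF finite_pairs(2), symmetric] by (intro sum.cong) auto
  have good_A: "(\<Sum>x \<in> {x \<in> ?A. Suc (snd x) = k}. ?f x) = (\<Sum>d = 1..<k. g d)"
    by (rule sum.reindex_bij_witness[of _ "\<lambda>d. (k - 1 - d, k - 1)" "\<lambda>(i, j). j - i"]) auto
  have good_B: "(\<Sum>x \<in> {x \<in> ?B. Suc (fst x) = k}. ?h x) = (if k = 0 then 0 else g k)"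
  proof -
    have "{x \<in> ?B. Suc (fst x) = k} = (if k = 0 then {} else {(k - 1, k - 1)})" by auto
    then show ?thesis by simp
  qed
  have "(\<Sum>d = 1..<k. of_nat (k - d) * g d) = (\<Sum>d = 1..k. of_nat (k - d) * g d)"
    by (rule sum.mono_neutral_left) auto
  moreover have "(\<Sum>d = 1..k. of_nat (k - d) * g d) + (\<Sum>d = 1..k. of_nat d * g d) =
      of_nat k * (\<Sum>d = 1..k. g d)"
    unfolding sum.distrib[symmetric] sum_distrib_left by (intro sum.cong) (auto simp: of_nat_diff algebra_simps)
  ultimately have tot: "(\<Sum>x \<in> ?A. ?f x) + (\<Sum>x \<in> ?B. ?h x) = of_nat k * (\<Sum>d = 1..k. g d)"
    unfolding sum_pairs_less sum_pairs_le by simp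
  have good: "(\<Sum>d = 1..<k. g d) + (if k = 0 then 0 else g k) = (\<Sum>d = 1..k. g d)"
    by (cases k) (auto simp: atLeastLessThanSuc_atLeastAtMost)
  have collect: "q * F + (1 - q) * G + (q * F' + (1 - q) * G') = q * (F + F') + (1 - q) * (G + G')"
    for F F' G G' :: real by (simp add: algebra_simps)
  show ?thesis unfolding A B good_A good_B collect tot good by (simp add: algebra_simps)
qed

section \<open>The reflections that split a cycle\<close>

lemma signed_transp_eqD:
  assumes "signed_transp a b = signed_transp c d" "a \<noteq> b" "a \<noteq> 0" "b \<noteq> 0" "c \<noteq> d" "c \<noteq> 0" "d \<noteq> 0"
  shows "c = a \<and> d = b \<or> c = b \<and> d = a \<or> c = - a \<and> d = - b \<or> c = - b \<and> d = - a"
proof -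
  have "signed_transp a b c = d" unfolding assms(1) using assms by (simp add: signed_transp_apply)
  then show ?thesis using assms(2-) by (auto simp: signed_transp_apply split: if_splits)
qed

lemma distinct_concat_nth:
  assumes "distinct (concat xss)" "l < length xss" "l' < length xss" "x \<in> set (xss ! l)" "x \<in> set (xss ! l')"
  shows "l = l'"
  using assms
proof (induction xss arbitrary: l l')
  case (Cons xs xss)
  have disj: "x \<notin> set (xss ! m)" if "x \<in> set xs" "m < length xss" for m
    using Cons.prems(1) that by (auto simp: disjoint_iff)
  show ?case
  proof (cases l; cases l')
    fix m m' assume "l = Suc m" "l' = Suc m'"
    then show ?thesis using Cons.IH[of m m'] Cons.prems by simp
  qed (use disj Cons.prems in auto)
qed simp

lemma nth_nth_mem_concat: "l < length xss \<Longrightarrow> i < length (xss ! l) \<Longrightarrow> xss ! l ! i \<in> set (concat xss)"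
  by (metis UN_I nth_mem set_concat)

lemma config_block_unique:
  assumes c: "config n As ys w" and l: "l < length As" "l' < length As" "i < length (As ! l)" "i' < length (As ! l')"
    and e: "\<bar>As ! l ! i\<bar> = \<bar>As ! l' ! i'\<bar>"
  shows "l = l' \<and> i = i'"
proof -
  have "distinct (map abs (concat As))" using config_distinct[OF c] by simp
  then have d: "distinct (concat (map (map abs) As))" by (simp add: map_concat)
  have m: "\<bar>As ! l ! i\<bar> \<in> set (map (map abs) As ! l)" using l by simp
  have m': "\<bar>As ! l ! i\<bar> \<in> set (map (map abs) As ! l')" unfolding e using l by simp
  have "l = l'" by (rule distinct_concat_nth[OF d _ _ m m']) (use l in auto)
  moreover have "distinct (map abs (As ! l))"
    using d l(1) by (auto simp: distinct_concat_iff)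
  ultimately show ?thesis using l e by (metis length_map nth_eq_iff_index_eq nth_map)
qed

lemma config_ys_unique:
  assumes c: "config n As ys w"
  shows "l < length As \<Longrightarrow> i < length (As ! l) \<Longrightarrow> j < length ys \<Longrightarrow> \<bar>As ! l ! i\<bar> \<noteq> ys ! j"
    and "j < length ys \<Longrightarrow> j' < length ys \<Longrightarrow> ys ! j = ys ! j' \<Longrightarrow> j = j'"
proof -
  have d: "abs ` set (concat As) \<inter> abs ` set ys = {}" "distinct (map abs ys)"
    using config_distinct[OF c] by auto
  have pos: "0 < ys ! j" if "j < length ys" for j using c that by (simp add: config_def)
  show "\<bar>As ! l ! i\<bar> \<noteq> ys ! j" if "l < length As" "i < length (As ! l)" "j < length ys"
  proof
    assume e: "\<bar>As ! l ! i\<bar> = ys ! j"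
    then have "\<bar>As ! l ! i\<bar> = \<bar>ys ! j\<bar>" by (metis abs_idempotent)
    moreover have "As ! l ! i \<in> set (concat As)" "ys ! j \<in> set ys" using that nth_nth_mem_concat by auto
    ultimately show False using d(1) by (metis disjoint_iff imageI)
  qed
  show "j = j'" if "j < length ys" "j' < length ys" "ys ! j = ys ! j'"
    using d(2) that by (simp add: distinct_map nth_eq_iff_index_eq)
qed

lemma config_nth_dom:
  assumes c: "config n As ys w"
  shows "l < length As \<Longrightarrow> i < length (As ! l) \<Longrightarrow> As ! l ! i \<in> signed_dom n"
    and "j < length ys \<Longrightarrow> ys ! j \<in> signed_dom n"
  using config_dom[OF c] nth_nth_mem_concat[of l As i] by auto

lemma take_drop_pieces:
  assumes "i < j" "j < length xs"
  defines "p \<equiv> take (Suc i) xs" and "q \<equiv> take (j - i) (drop (Suc i) xs)" and "r \<equiv> drop (Suc j) xs"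
  shows "p @ q @ r = xs" "p \<noteq> []" "q \<noteq> []" "last p = xs ! i" "last q = xs ! j"
    "length q = j - i" "length (p @ r) = length xs - (j - i)"
proof -
  have "drop (j - i) (drop (Suc i) xs) = r" using assms by (simp add: r_def)
  then have "q @ r = drop (Suc i) xs" unfolding q_def by (metis append_take_drop_id)
  then show "p @ q @ r = xs" unfolding p_def by simp
  show "p \<noteq> []" "q \<noteq> []" using assms by (auto simp: p_def q_def)
  show "last p = xs ! i" using assms by (simp add: p_def take_Suc_conv_app_nth)
  have "q \<noteq> []" "length q = j - i" using assms by (auto simp: q_def)
  then have "last q = q ! (j - i - 1)" by (simp add: last_conv_nth)
  also have "\<dots> = xs ! j" using assms by (simp add: q_def)
  finally show "last q = xs ! j" .
  show "length q = j - i" by fact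
  show "length (p @ r) = length xs - (j - i)" using assms by (simp add: p_def r_def)
qed

definition block_prod :: "(nat \<Rightarrow> real) \<Rightarrow> int list list \<Rightarrow> real" where
  "block_prod \<alpha> As = prod_list (map (\<lambda>xs. \<alpha> (length xs)) As)"

lemma block_prod_Cons [simp]: "block_prod \<alpha> (xs # As) = \<alpha> (length xs) * block_prod \<alpha> As"
  and block_prod_append: "block_prod \<alpha> (As @ Bs) = block_prod \<alpha> As * block_prod \<alpha> Bs"
  and block_prod_Nil [simp]: "block_prod \<alpha> [] = 1"
  by (simp_all add: block_prod_def)

lemma config_split_A_nth:
  assumes c: "config n As ys w" and l: "l < length As" and ij: "i < j" "j < length (As ! l)"
  defines "rest \<equiv> take l As @ drop (Suc l) As"
  shows "\<exists>As'. config n As' ys (w \<circ> signed_transp (As ! l ! i) (As ! l ! j)) \<and> length As' = Suc (length As) \<and>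
    block_prod \<alpha> As' = \<alpha> (j - i) * \<alpha> (length (As ! l) - (j - i)) * block_prod \<alpha> rest"
proof -
  note P = take_drop_pieces[OF ij]
  let ?p = "take (Suc i) (As ! l)" and ?q = "take (j - i) (drop (Suc i) (As ! l))" and ?r = "drop (Suc j) (As ! l)"
  have As: "As = take l As @ (?p @ ?q @ ?r) # drop (Suc l) As"
    unfolding P(1) using l by (rule id_take_nth_drop)
  have "config n (?q # (?p @ ?r) # take l As @ drop (Suc l) As) ys (w \<circ> signed_transp (last ?p) (last ?q))"
    by (rule config_split_A) (use c As P in auto)
  moreover have "block_prod \<alpha> (?q # (?p @ ?r) # take l As @ drop (Suc l) As) =
      \<alpha> (j - i) * \<alpha> (length (As ! l) - (j - i)) * block_prod \<alpha> rest"
    unfolding rest_def block_prod_Cons P(6,7) by simp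
  moreover have "length (?q # (?p @ ?r) # take l As @ drop (Suc l) As) = Suc (length As)" using l by simp
  ultimately show ?thesis unfolding P(4,5) by blast
qed

lemma config_split_B_nth:
  assumes c: "config n As ys w" and ij: "i < j" "j < length ys"
  shows "\<exists>As' ys'. config n As' ys' (w \<circ> signed_transp (ys ! i) (ys ! j)) \<and> length As' = Suc (length As) \<and>
    block_prod \<alpha> As' = \<alpha> (j - i) * block_prod \<alpha> As \<and> length ys' = length ys - (j - i)"
proof -
  note P = take_drop_pieces[OF ij]
  let ?p = "take (Suc i) ys" and ?q = "take (j - i) (drop (Suc i) ys)" and ?r = "drop (Suc j) ys"
  have "config n (?q # As) (?p @ ?r) (w \<circ> signed_transp (last ?p) (last ?q))"
    by (rule config_split_B) (use c P in auto)
  moreover have "block_prod \<alpha> (?q # As) = \<alpha> (j - i) * block_prod \<alpha> As"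
    unfolding block_prod_Cons P(6) ..
  ultimately show ?thesis using P(7) unfolding P(4,5) by (metis length_Cons)
qed

lemma config_split_B_wrap_nth:
  assumes c: "config n As ys w" and ij: "i \<le> j" "j < length ys"
  shows "\<exists>As' ys'. config n As' ys' (w \<circ> signed_transp (ys ! i) (- (ys ! j))) \<and> length As' = Suc (length As) \<and>
    block_prod \<alpha> As' = \<alpha> (length ys - (j - i)) * block_prod \<alpha> As \<and> length ys' = j - i"
proof -
  let ?p = "take (Suc i) ys" and ?q = "take (j - i) (drop (Suc i) ys)" and ?r = "drop (Suc j) ys"
  have "drop (j - i) (drop (Suc i) ys) = ?r" using ij by simp
  then have "?q @ ?r = drop (Suc i) ys" by (metis append_take_drop_id)
  then have ys: "?p @ ?q @ ?r = ys" by simp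
  have "length (?p @ ?q) = Suc j" using ij by simp
  moreover have "(?p @ ?q) ! j = ys ! j" using ij by (auto simp: nth_append min_def)
  moreover have "last (?p @ ?q) = (?p @ ?q) ! (length (?p @ ?q) - 1)" using ij by (intro last_conv_nth) auto
  ultimately have last_pq: "last (?p @ ?q) = ys ! j" by (simp only: diff_Suc_1)
  have last_p: "last ?p = ys ! i" using ij by (simp add: take_Suc_conv_app_nth)
  have "config n ((?r @ map uminus ?p) # As) ?q (w \<circ> signed_transp (last ?p) (- last (?p @ ?q)))"
  proof (rule config_split_B_wrap)
    show "config n As (?p @ ?q @ ?r) w" unfolding ys by (rule c)
    show "?p \<noteq> []" using ij by auto
  qed
  moreover have "length (?r @ map uminus ?p) = length ys - (j - i)" using ij by simp
  moreover have "length ?q = j - i" using ij by simp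
  ultimately show ?thesis unfolding last_pq last_p by (metis block_prod_Cons length_Cons)
qed

definition moves_A :: "int list list \<Rightarrow> nat \<Rightarrow> (int \<Rightarrow> int) set" where
  "moves_A As l = (\<lambda>(i, j). signed_transp (As ! l ! i) (As ! l ! j)) ` {(i, j). i < j \<and> j < length (As ! l)}"

definition moves_B :: "int list \<Rightarrow> (int \<Rightarrow> int) set" where
  "moves_B ys = (\<lambda>(i, j). signed_transp (ys ! i) (ys ! j)) ` {(i, j). i < j \<and> j < length ys}"

definition moves_B_wrap :: "int list \<Rightarrow> (int \<Rightarrow> int) set" where
  "moves_B_wrap ys = (\<lambda>(i, j). signed_transp (ys ! i) (- (ys ! j))) ` {(i, j). i \<le> j \<and> j < length ys}"

lemma config_A_pair:
  assumes c: "config n As ys w" "l < length As" "i < j" "j < length (As ! l)"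
  shows "As ! l ! i \<noteq> As ! l ! j" "As ! l ! i \<noteq> 0" "As ! l ! j \<noteq> 0"
proof -
  have i: "i < length (As ! l)" using c(3,4) by simp
  show "As ! l ! i \<noteq> As ! l ! j"
    using config_block_unique[OF c(1,2,2) i c(4)] c(3) by auto
  show "As ! l ! i \<noteq> 0" "As ! l ! j \<noteq> 0"
    using config_nth_dom(1)[OF c(1,2)] i c(4) signed_dom_nonzero by blast+
qed

lemma config_B_pos: "config n As ys w \<Longrightarrow> j < length ys \<Longrightarrow> 0 < ys ! j"
  by (simp add: config_def)

lemma config_B_pair:
  assumes c: "config n As ys w" "i < j" "j < length ys"
  shows "ys ! i \<noteq> ys ! j" "ys ! i \<noteq> 0" "ys ! j \<noteq> 0"
  using config_ys_unique(2)[OF c(1), of i j] config_B_pos[OF c(1), of i] config_B_pos[OF c(1), of j] assms by auto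

lemma config_B_wrap_pair:
  assumes c: "config n As ys w" "i \<le> j" "j < length ys"
  shows "ys ! i \<noteq> - (ys ! j)" "ys ! i \<noteq> 0" "- (ys ! j) \<noteq> 0"
  using config_B_pos[OF c(1), of i] config_B_pos[OF c(1), of j] assms by auto

lemma moves_A_inj:
  assumes c: "config n As ys w" and l: "l < length As" "l' < length As"
    and ij: "i < j" "j < length (As ! l)" "i' < j'" "j' < length (As ! l')"
    and e: "signed_transp (As ! l ! i) (As ! l ! j) = signed_transp (As ! l' ! i') (As ! l' ! j')"
  shows "l = l' \<and> i = i' \<and> j = j'"
proof -
  note lt = ij(2,4) less_trans[OF ij(1,2)] less_trans[OF ij(3,4)]
  note U = config_block_unique[OF c l(2,1)]
  have "\<bar>As ! l' ! i'\<bar> = \<bar>As ! l ! i\<bar> \<and> \<bar>As ! l' ! j'\<bar> = \<bar>As ! l ! j\<bar> \<or>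
      \<bar>As ! l' ! i'\<bar> = \<bar>As ! l ! j\<bar> \<and> \<bar>As ! l' ! j'\<bar> = \<bar>As ! l ! i\<bar>"
    using signed_transp_eqD[OF e config_A_pair[OF c l(1) ij(1,2)] config_A_pair[OF c l(2) ij(3,4)]] by auto
  then show ?thesis using U[of i' i] U[of j' j] U[of i' j] U[of j' i] lt ij by auto
qed

lemma moves_A_B_disjoint:
  assumes c: "config n As ys w" and l: "l < length As"
  shows "moves_A As l \<inter> (moves_B ys \<union> moves_B_wrap ys) = {}"
proof -
  have False if ij: "i < j" "j < length (As ! l)" and b: "i' < length ys" "\<bar>b\<bar> = ys ! i'" "a \<noteq> b" "a \<noteq> 0" "b \<noteq> 0"
    and e: "signed_transp (As ! l ! i) (As ! l ! j) = signed_transp a b" for i j i' a b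
  proof -
    have "\<bar>b\<bar> = \<bar>As ! l ! i\<bar> \<or> \<bar>b\<bar> = \<bar>As ! l ! j\<bar>"
      using signed_transp_eqD[OF e config_A_pair[OF c l ij] b(3-5)] by auto
    then show False using config_ys_unique(1)[OF c l _ b(1)] ij b(2) by (metis less_trans)
  qed
  note F = this
  show ?thesis
  proof (intro equalityI subsetI)
    fix t assume t: "t \<in> moves_A As l \<inter> (moves_B ys \<union> moves_B_wrap ys)"
    then obtain i j where ij: "i < j" "j < length (As ! l)" "t = signed_transp (As ! l ! i) (As ! l ! j)"
      by (auto simp: moves_A_def)
    from t have "t \<in> moves_B ys \<or> t \<in> moves_B_wrap ys" by simp
    then show "t \<in> {}"
    proof
      assume "t \<in> moves_B ys"
      then obtain i' j' where b: "i' < j'" "j' < length ys" "t = signed_transp (ys ! i') (ys ! j')"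
        by (auto simp: moves_B_def)
      have "signed_transp (As ! l ! i) (As ! l ! j) = signed_transp (ys ! i') (ys ! j')" using ij b by simp
      then show ?thesis using F[OF ij(1,2) b(2) _ config_B_pair[OF c b(1,2)]] config_B_pos[OF c b(2)] by simp
    next
      assume "t \<in> moves_B_wrap ys"
      then obtain i' j' where b: "i' \<le> j'" "j' < length ys" "t = signed_transp (ys ! i') (- (ys ! j'))"
        by (auto simp: moves_B_wrap_def)
      have "signed_transp (As ! l ! i) (As ! l ! j) = signed_transp (ys ! i') (- (ys ! j'))" using ij b by simp
      then show ?thesis using F[OF ij(1,2) b(2) _ config_B_wrap_pair[OF c b(1,2)]] config_B_pos[OF c b(2)] by simp
    qed
  qed simp
qed

lemma moves_B_disjoint:
  assumes c: "config n As ys w" shows "moves_B ys \<inter> moves_B_wrap ys = {}"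
proof (intro equalityI subsetI)
  fix t assume t: "t \<in> moves_B ys \<inter> moves_B_wrap ys"
  then obtain i j where ij: "i < j" "j < length ys" "t = signed_transp (ys ! i) (ys ! j)"
    by (auto simp: moves_B_def)
  from t obtain i' j' where b: "i' \<le> j'" "j' < length ys" "t = signed_transp (ys ! i') (- (ys ! j'))"
    by (auto simp: moves_B_wrap_def)
  have e: "signed_transp (ys ! i) (ys ! j) = signed_transp (ys ! i') (- (ys ! j'))" using ij b by simp
  have "0 < ys ! i" "0 < ys ! j" "0 < ys ! i'" "0 < ys ! j'" using config_B_pos[OF c] ij b by auto
  then show "t \<in> {}"
    using signed_transp_eqD[OF e config_B_pair[OF c ij(1,2)] config_B_wrap_pair[OF c b(1,2)]] by auto
qed simp

lemma moves_B_inj: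
  assumes c: "config n As ys w"
  shows "inj_on (\<lambda>(i, j). signed_transp (ys ! i) (ys ! j)) {(i, j). i < j \<and> j < length ys}"
proof (rule inj_onI, clarify)
  fix i j i' j' assume ij: "i < j" "j < length ys" "i' < j'" "j' < length ys"
    and e: "signed_transp (ys ! i) (ys ! j) = signed_transp (ys ! i') (ys ! j')"
  note U = config_ys_unique(2)[OF c]
  have "0 < ys ! i" "0 < ys ! j" "0 < ys ! i'" "0 < ys ! j'" using config_B_pos[OF c] ij by auto
  then have "ys ! i' = ys ! i \<and> ys ! j' = ys ! j \<or> ys ! i' = ys ! j \<and> ys ! j' = ys ! i"
    using signed_transp_eqD[OF e config_B_pair[OF c ij(1,2)] config_B_pair[OF c ij(3,4)]] by auto
  then show "i = i' \<and> j = j'" using U[of i' i] U[of j' j] U[of i' j] U[of j' i] ij by auto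
qed

lemma moves_B_wrap_inj:
  assumes c: "config n As ys w"
  shows "inj_on (\<lambda>(i, j). signed_transp (ys ! i) (- (ys ! j))) {(i, j). i \<le> j \<and> j < length ys}"
proof (rule inj_onI, clarify)
  fix i j i' j' assume ij: "i \<le> j" "j < length ys" "i' \<le> j'" "j' < length ys"
    and e: "signed_transp (ys ! i) (- (ys ! j)) = signed_transp (ys ! i') (- (ys ! j'))"
  note U = config_ys_unique(2)[OF c]
  have "0 < ys ! i" "0 < ys ! j" "0 < ys ! i'" "0 < ys ! j'" using config_B_pos[OF c] ij by auto
  then have "ys ! i' = ys ! i \<and> ys ! j' = ys ! j \<or> ys ! i' = ys ! j \<and> ys ! j' = ys ! i"
    using signed_transp_eqD[OF e config_B_wrap_pair[OF c ij(1,2)] config_B_wrap_pair[OF c ij(3,4)]] by auto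
  then show "i = i' \<and> j = j'" using U[of i' i] U[of j' j] U[of i' j] U[of j' i] ij by auto
qed

text \<open>Each of the four names of a reflection may be the one in which it appears among the moves.\<close>

lemma same_block_imp_move:
  assumes c: "config n As ys w" and ab: "a \<noteq> b" "a \<in> signed_dom n" "b \<in> signed_dom n"
    and blk: "(\<exists>l < length As. {a, b} \<subseteq> set (As ! l) \<or> {- a, - b} \<subseteq> set (As ! l)) \<or> {\<bar>a\<bar>, \<bar>b\<bar>} \<subseteq> set ys"
  shows "signed_transp a b \<in> (\<Union>l < length As. moves_A As l) \<union> moves_B ys \<union> moves_B_wrap ys"
proof -
  have nz: "a \<noteq> 0" "b \<noteq> 0" using ab signed_dom_nonzero by auto
  have A: "signed_transp a b \<in> moves_A As l" if l: "{a, b} \<subseteq> set (As ! l)" "a \<noteq> b" "a \<noteq> 0" "b \<noteq> 0" for a b l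
  proof -
    obtain i j where ij: "i < length (As ! l)" "j < length (As ! l)" "a = As ! l ! i" "b = As ! l ! j"
      using l(1) by (auto simp: in_set_conv_nth)
    then have "i < j \<or> j < i" using l(2) by (metis linorder_neqE_nat)
    then show ?thesis
    proof
      assume "i < j"
      then show ?thesis unfolding moves_A_def using ij by (intro image_eqI[of _ _ "(i, j)"]) auto
    next
      assume "j < i"
      then have "signed_transp b a \<in> moves_A As l"
        unfolding moves_A_def using ij by (intro image_eqI[of _ _ "(j, i)"]) auto
      then show ?thesis using signed_transp_commute[OF l(2-4)] by simp
    qed
  qed
  from blk show ?thesis
  proof
    assume "\<exists>l < length As. {a, b} \<subseteq> set (As ! l) \<or> {- a, - b} \<subseteq> set (As ! l)"
    then obtain l where l: "l < length As" "{a, b} \<subseteq> set (As ! l) \<or> {- a, - b} \<subseteq> set (As ! l)" by blast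
    then have "signed_transp a b \<in> moves_A As l"
      using A[of a b l] A[of "- a" "- b" l] ab(1) nz signed_transp_uminus[OF ab(1) nz] by auto
    then show ?thesis using l(1) by blast
  next
    assume "{\<bar>a\<bar>, \<bar>b\<bar>} \<subseteq> set ys"
    then obtain i j where ij: "i < length ys" "j < length ys" "\<bar>a\<bar> = ys ! i" "\<bar>b\<bar> = ys ! j"
      by (auto simp: in_set_conv_nth)
    have B: "signed_transp (ys ! i) (ys ! j) \<in> moves_B ys" if "i \<noteq> j" "i < length ys" "j < length ys" for i j
    proof (cases "i < j")
      case True then show ?thesis unfolding moves_B_def using that by (intro image_eqI[of _ _ "(i, j)"]) auto
    next
      case False
      then have ji: "j < i" using that by simp
      then have "signed_transp (ys ! j) (ys ! i) \<in> moves_B ys"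
        unfolding moves_B_def using that by (intro image_eqI[of _ _ "(j, i)"]) auto
      then show ?thesis using signed_transp_commute[OF config_B_pair[OF c ji that(2)]] by simp
    qed
    have W: "signed_transp (ys ! i) (- (ys ! j)) \<in> moves_B_wrap ys" if "i < length ys" "j < length ys" for i j
    proof (cases "i \<le> j")
      case True then show ?thesis unfolding moves_B_wrap_def using that by (intro image_eqI[of _ _ "(i, j)"]) auto
    next
      case False
      have pos: "0 < ys ! i" "0 < ys ! j" using config_B_pos[OF c] that by auto
      have "signed_transp (ys ! j) (- (ys ! i)) \<in> moves_B_wrap ys"
        unfolding moves_B_wrap_def using that False by (intro image_eqI[of _ _ "(j, i)"]) auto
      moreover have "signed_transp (ys ! j) (- (ys ! i)) = signed_transp (ys ! i) (- (ys ! j))"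
        using signed_transp_uminus[of "ys ! j" "- (ys ! i)"] signed_transp_commute[of "ys ! i" "- (ys ! j)"] pos by simp
      ultimately show ?thesis by simp
    qed
    consider "a = ys ! i" "b = ys ! j" | "a = - (ys ! i)" "b = - (ys ! j)" | "a = ys ! i" "b = - (ys ! j)"
      | "a = - (ys ! i)" "b = ys ! j" using ij(3,4) by linarith
    then show ?thesis
    proof cases
      case 1 then show ?thesis using B[of i j] ij ab(1) by auto
    next
      case 2
      then have "i \<noteq> j" using ab(1) by auto
      then show ?thesis using B[of i j] ij 2 signed_transp_uminus[of "ys ! i" "ys ! j"] ab(1) nz by auto
    next
      case 3 then show ?thesis using W[of i j] ij by auto
    next
      case 4
      then show ?thesis using W[of i j] ij signed_transp_uminus[of "ys ! i" "- (ys ! j)"] ab(1) nz by auto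
    qed
  qed
qed

section \<open>The generating function of a configuration\<close>

lemma block_prod_split:
  "l < length As \<Longrightarrow> block_prod \<alpha> As = \<alpha> (length (As ! l)) * block_prod \<alpha> (take l As @ drop (Suc l) As)"
  by (subst id_take_nth_drop[of l As]) (auto simp: block_prod_append)

lemma moves_reflections:
  assumes c: "config n As ys w"
  shows "(\<Union>l < length As. moves_A As l) \<union> moves_B ys \<union> moves_B_wrap ys \<subseteq> reflections n"
proof -
  have "moves_A As l \<subseteq> reflections n" if l: "l < length As" for l
  proof
    fix t assume "t \<in> moves_A As l"
    then obtain i j where ij: "i < j" "j < length (As ! l)" "t = signed_transp (As ! l ! i) (As ! l ! j)"
      by (auto simp: moves_A_def)
    then show "t \<in> reflections n"
      using config_nth_dom(1)[OF c l] config_A_pair(1)[OF c l ij(1,2)] by (auto intro!: signed_transp_in_reflections)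
  qed
  moreover have "moves_B ys \<subseteq> reflections n"
  proof
    fix t assume "t \<in> moves_B ys"
    then obtain i j where ij: "i < j" "j < length ys" "t = signed_transp (ys ! i) (ys ! j)"
      by (auto simp: moves_B_def)
    then show "t \<in> reflections n"
      using config_nth_dom(2)[OF c] config_B_pair(1)[OF c ij(1,2)] by (auto intro!: signed_transp_in_reflections)
  qed
  moreover have "moves_B_wrap ys \<subseteq> reflections n"
  proof
    fix t assume "t \<in> moves_B_wrap ys"
    then obtain i j where ij: "i \<le> j" "j < length ys" "t = signed_transp (ys ! i) (- (ys ! j))"
      by (auto simp: moves_B_wrap_def)
    then show "t \<in> reflections n"
      using config_nth_dom(2)[OF c] config_B_wrap_pair(1)[OF c ij(1,2)] by (auto intro!: signed_transp_in_reflections)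
  qed
  ultimately show ?thesis by blast
qed

text \<open>A factorisation of \<open>w t\<close> into \<open>k\<close> reflections would give a shortest word for \<open>w\<close> with last factor \<open>t\<close>, and
  all factors of a shortest word split cycles.\<close>

lemma chain_weight_outside_moves:
  assumes c: "config n As ys w" and k: "Suc k + length As = n" and t: "t \<in> reflections n"
    and out: "t \<notin> (\<Union>l < length As. moves_A As l) \<union> moves_B ys \<union> moves_B_wrap ys"
  shows "chain_weight n q k (w \<circ> t) = 0"
proof (rule ccontr)
  have w: "w \<in> B_group n" using c by (simp add: config_def)
  assume "chain_weight n q k (w \<circ> t) \<noteq> 0"
  then obtain ts where ts: "set ts \<subseteq> reflections n" "length ts = k" "compose_list ts = w \<circ> t"
    using chain_weight_nonzero_imp_word B_group_comp[OF w reflections_B_group[OF t]] by blast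
  have "compose_list (ts @ [t]) = (w \<circ> t) \<circ> t" by (simp add: compose_list_append compose_list_Cons ts(3))
  also have "\<dots> = w" using reflections_involution[OF t] by (simp add: comp_assoc)
  finally have word: "w = compose_list (ts @ [t])" by (rule sym)
  obtain a b where ab: "t = signed_transp a b" "a \<in> signed_dom n" "b \<in> signed_dom n" "a \<noteq> b"
    using t by (rule reflectionsE)
  have "(\<exists>l < length As. {a, b} \<subseteq> set (As ! l) \<or> {- a, - b} \<subseteq> set (As ! l)) \<or> {\<bar>a\<bar>, \<bar>b\<bar>} \<subseteq> set ys"
    by (rule config_word_same_block[OF c _ word]) (use ts t k ab in auto)
  then have "t \<in> (\<Union>l < length As. moves_A As l) \<union> moves_B ys \<union> moves_B_wrap ys"
    unfolding ab(1) by (rule same_block_imp_move[OF c ab(4,2,3)])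
  then show False using out by blast
qed

lemma length_le_sum_list_length: "\<forall>xs \<in> set xss. xs \<noteq> [] \<Longrightarrow> length xss \<le> sum_list (map length xss)"
proof (induction xss)
  case (Cons xs xss)
  then have "1 \<le> length xs" by (simp add: Suc_le_eq)
  then show ?case using Cons by simp
qed simp

lemma config_singletons:
  assumes c: "config n As ys w" and n: "length As = n"
  shows "ys = []" "\<And>xs. xs \<in> set As \<Longrightarrow> length xs = 1" "w = id"
proof -
  have ne: "\<forall>xs \<in> set As. xs \<noteq> []" using c by (auto simp: config_def)
  have "sum_list (map length As) + length ys = length As" using config_length[OF c] n by simp
  then have total: "sum_list (map length As) = length As" "length ys = 0"
    using length_le_sum_list_length[OF ne] by linarith+
  show ys: "ys = []" using total(2) by simp
  show len: "length xs = 1" if "xs \<in> set As" for xs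
    using ne total(1) that
  proof (induction As)
    case (Cons zs As)
    have "1 \<le> length zs" "length As \<le> sum_list (map length As)"
      using Cons.prems(1) length_le_sum_list_length[of As] by (auto simp: Suc_le_eq)
    then have "length zs = 1" "sum_list (map length As) = length As" using Cons.prems(2) by auto
    then show ?case using Cons by auto
  qed simp
  have w: "w \<in> B_group n" using c by (simp add: config_def)
  have fixed: "w x = x" if l: "l < length As" "x \<in> set (As ! l)" for l x
  proof -
    have "As ! l = [x]" using len[of "As ! l"] l by (auto simp: length_Suc_conv)
    moreover have "follows w (As ! l @ [hd (As ! l)])" using c l(1) by (simp add: config_def)
    ultimately show ?thesis by simp
  qed
  show "w = id"
  proof
    fix x
    show "w x = id x"
    proof (cases "x \<in> signed_dom n")
      case True
      from c this show ?thesis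
      proof (cases rule: config_cases)
        case (1 l) then show ?thesis using fixed by simp
      next
        case (2 l)
        then have "w (- x) = - x" using fixed by blast
        then show ?thesis using B_group_odd[OF w, of x] by simp
      next
        case 3 then show ?thesis using ys by simp
      qed
    next
      case False then show ?thesis using B_group_permutes[OF w] by (simp add: permutes_def)
    qed
  qed
qed

text \<open>Induction on the number of factors.  A splitting of one list \<open>C\<close> replaces \<open>\<alpha> (length C)\<close> by \<open>\<alpha> d * \<alpha> (length C - d)\<close>,
  and the recurrence for \<open>\<alpha>\<close> says that the weighted sum over all splittings of \<open>C\<close> is \<open>length C - 1\<close> times the
  old value; the same holds for \<open>ys\<close> with the factor \<open>length ys\<close>.  These factors add up to the rank, which is the number of
  reflections, and this produces the factorial.\<close>

theorem chain_weight_config: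
  fixes \<alpha> \<beta> :: "nat \<Rightarrow> real" and q :: real
  assumes init: "\<alpha> 1 = 1" "\<beta> 0 = 1"
    and \<alpha>: "\<And>k. k \<ge> 1 \<Longrightarrow> of_nat (k - 1) * \<alpha> k = (1 - q + q * of_nat k / 2) * (\<Sum>d = 1..<k. \<alpha> d * \<alpha> (k - d))"
    and \<beta>: "\<And>m. of_nat m * \<beta> m = (1 - q + q * of_nat m) * (\<Sum>d = 1..m. \<alpha> d * \<beta> (m - d))"
    and n: "n \<ge> 1" and c: "config n As ys w" and k: "k + length As = n"
  shows "chain_weight n q k w = fact k * (block_prod \<alpha> As * \<beta> (length ys))"
  using c k
proof (induction k arbitrary: As ys w)
  case 0
  then have s: "ys = []" "\<And>xs. xs \<in> set As \<Longrightarrow> length xs = 1" "w = id"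
    using config_singletons[of n As ys w] by auto
  have "block_prod \<alpha> Bs = 1" if "\<And>xs. xs \<in> set Bs \<Longrightarrow> length xs = 1" for Bs
    using that init(1) by (induction Bs) auto
  then have "block_prod \<alpha> As = 1" using s(2) by blast
  moreover have "chain_weight n q 0 w = 1" unfolding s(3) chain_weight.simps by (rule if_P) (rule HOL.refl)
  ultimately show ?case using s(1) init by simp
next
  case (Suc k)
  note c = Suc.prems(1)
  let ?N = "chain_weight n q k"
  define cf where "cf t = (if len_S n w < len_S n (w \<circ> t) then q else 1)" for t
  define T where "T t = cf t * ?N (w \<circ> t)" for t
  have w: "w \<in> B_group n" using c by (simp add: config_def)
  have cf: "cf (signed_transp a b) = (if (w a < w b \<longleftrightarrow> a < b) then q else 1)"
    if "a \<in> signed_dom n" "b \<in> signed_dom n" "a \<noteq> b" for a b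
    unfolding cf_def using len_S_less_comp_signed_transp_iff[OF n w that] by simp
  have step: "?N v = fact k * (block_prod \<alpha> As' * \<beta> (length ys'))"
    if "config n As' ys' v" "length As' = Suc (length As)" for As' ys' v
    using Suc.IH[OF that(1)] that(2) Suc.prems(2) by simp
  define W where "W = block_prod \<alpha> As * \<beta> (length ys)"
  have sum_A: "(\<Sum>t \<in> moves_A As l. T t) = fact k * W * of_nat (length (As ! l) - 1)" if l: "l < length As" for l
  proof -
    define xs where "xs = As ! l"
    define g where "g d = \<alpha> d * \<alpha> (length xs - d)" for d
    \<comment> \<open>The factors that a splitting of \<open>xs\<close> leaves unchanged.\<close>
    define R where "R = block_prod \<alpha> (take l As @ drop (Suc l) As) * \<beta> (length ys)"
    have xs: "sorted_wrt before xs" "follows w (xs @ [hd xs])" "xs \<noteq> []" using c l by (auto simp: config_def xs_def)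
    obtain a where a: "a \<le> length xs" "\<forall>i < length xs. 0 < xs ! i \<longleftrightarrow> i < a"
      using before_sorted_positive_prefix[OF xs(1)] by blast
    have "inj_on (\<lambda>(i, j). signed_transp (xs ! i) (xs ! j)) {(i, j). i < j \<and> j < length xs}"
      unfolding xs_def by (rule inj_onI) (use moves_A_inj[OF c l l] in auto)
    then have "(\<Sum>t \<in> moves_A As l. T t) =
        (\<Sum>(i, j) \<in> {(i, j). i < j \<and> j < length xs}. T (signed_transp (xs ! i) (xs ! j)))"
      unfolding moves_A_def xs_def[symmetric] by (subst sum.reindex) (auto intro!: sum.cong)
    also have "\<dots> = (\<Sum>(i, j) \<in> {(i, j). i < j \<and> j < length xs}.
        fact k * R * ((if Suc j = a \<or> Suc j = length xs \<and> a \<le> Suc i then 1 else q) * g (j - i)))"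
    proof (rule sum.cong[OF HOL.refl], clarify)
      fix i j assume ij: "i < j" "j < length xs"
      have i: "i < length xs" using ij by simp
      have dom: "xs ! i \<in> signed_dom n" "xs ! j \<in> signed_dom n" "xs ! i \<noteq> xs ! j"
        using config_nth_dom(1)[OF c l] config_A_pair(1)[OF c l] ij i unfolding xs_def by auto
      have "cf (signed_transp (xs ! i) (xs ! j)) = (if Suc j = a \<or> Suc j = length xs \<and> a \<le> Suc i then 1 else q)"
        unfolding cf[OF dom] cycle_A_preserves_order_iff[OF xs(1,2) a(2,1) ij] by simp
      moreover obtain As' where As': "config n As' ys (w \<circ> signed_transp (xs ! i) (xs ! j))" "length As' = Suc (length As)"
          "block_prod \<alpha> As' = \<alpha> (j - i) * \<alpha> (length xs - (j - i)) * block_prod \<alpha> (take l As @ drop (Suc l) As)"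
        using config_split_A_nth[OF c l, of i j \<alpha>] ij unfolding xs_def by blast
      have "?N (w \<circ> signed_transp (xs ! i) (xs ! j)) = fact k * R * g (j - i)"
        unfolding step[OF As'(1,2)] As'(3) R_def g_def by (simp add: mult_ac)
      ultimately show "T (signed_transp (xs ! i) (xs ! j)) =
          fact k * R * ((if Suc j = a \<or> Suc j = length xs \<and> a \<le> Suc i then 1 else q) * g (j - i))"
        unfolding T_def by (simp add: mult_ac)
    qed
    also have "\<dots> = fact k * R * (\<Sum>(i, j) \<in> {(i, j). i < j \<and> j < length xs}.
        (if Suc j = a \<or> Suc j = length xs \<and> a \<le> Suc i then 1 else q) * g (j - i))"
      unfolding sum_distrib_left by (simp only: split_def)
    also have "\<dots> = fact k * R * ((1 - q + q * of_nat (length xs) / 2) * (\<Sum>d = 1..<length xs. g d))"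
      by (subst weighted_sum_A[OF _ a(1)]) (auto simp: g_def mult.commute)
    also have "\<dots> = fact k * R * (of_nat (length xs - 1) * \<alpha> (length xs))"
      using \<alpha>[of "length xs"] xs(3) unfolding g_def by (simp add: Suc_le_eq)
    also have "\<dots> = fact k * W * of_nat (length xs - 1)"
      unfolding R_def W_def block_prod_split[OF l] xs_def by (simp add: mult_ac)
    finally show ?thesis unfolding xs_def .
  qed
  have sum_B: "(\<Sum>t \<in> moves_B ys. T t) + (\<Sum>t \<in> moves_B_wrap ys. T t) = fact k * W * of_nat (length ys)"
  proof -
    define m where "m = length ys"
    define g where "g d = \<alpha> d * \<beta> (m - d)" for d
    have ys: "sorted_wrt (<) ys" "\<forall>y \<in> set ys. 0 < y" "ys \<noteq> [] \<Longrightarrow> follows w (ys @ [- hd ys])"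
      using c by (auto simp: config_def)
    have B1: "(\<Sum>t \<in> moves_B ys. T t) = (\<Sum>(i, j) \<in> {(i, j). i < j \<and> j < m}.
        fact k * block_prod \<alpha> As * ((if Suc j = m then 1 else q) * g (j - i)))"
    proof -
      have "(\<Sum>t \<in> moves_B ys. T t) = (\<Sum>(i, j) \<in> {(i, j). i < j \<and> j < m}. T (signed_transp (ys ! i) (ys ! j)))"
        unfolding moves_B_def m_def using moves_B_inj[OF c] by (subst sum.reindex) (auto intro!: sum.cong)
      also have "\<dots> = (\<Sum>(i, j) \<in> {(i, j). i < j \<and> j < m}.
          fact k * block_prod \<alpha> As * ((if Suc j = m then 1 else q) * g (j - i)))"
      proof (rule sum.cong[OF HOL.refl], clarify)
        fix i j assume ij: "i < j" "j < m"
        then have ij': "i < j" "j < length ys" by (auto simp: m_def)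
        then have fol: "follows w (ys @ [- hd ys])" using ys(3) by force
        have dom: "ys ! i \<in> signed_dom n" "ys ! j \<in> signed_dom n" "ys ! i \<noteq> ys ! j"
          using config_nth_dom(2)[OF c] config_B_pair(1)[OF c ij'] ij' by auto
        have "cf (signed_transp (ys ! i) (ys ! j)) = (if Suc j = m then 1 else q)"
          unfolding cf[OF dom] cycle_B_preserves_order_iff[OF ys(1,2) fol ij'] m_def by simp
        moreover obtain As' ys' where s: "config n As' ys' (w \<circ> signed_transp (ys ! i) (ys ! j))"
            "length As' = Suc (length As)" "block_prod \<alpha> As' = \<alpha> (j - i) * block_prod \<alpha> As" "length ys' = m - (j - i)"
          using config_split_B_nth[OF c ij', of \<alpha>] unfolding m_def by blast
        have "?N (w \<circ> signed_transp (ys ! i) (ys ! j)) = fact k * block_prod \<alpha> As * g (j - i)"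
          unfolding step[OF s(1,2)] s(3,4) g_def by (simp add: mult_ac)
        ultimately show "T (signed_transp (ys ! i) (ys ! j)) =
            fact k * block_prod \<alpha> As * ((if Suc j = m then 1 else q) * g (j - i))"
          unfolding T_def by (simp add: mult_ac)
      qed
      finally show ?thesis .
    qed
    have B2: "(\<Sum>t \<in> moves_B_wrap ys. T t) = (\<Sum>(i, j) \<in> {(i, j). i \<le> j \<and> j < m}.
        fact k * block_prod \<alpha> As * ((if Suc i = m then 1 else q) * g (m - (j - i))))"
    proof -
      have "(\<Sum>t \<in> moves_B_wrap ys. T t) = (\<Sum>(i, j) \<in> {(i, j). i \<le> j \<and> j < m}. T (signed_transp (ys ! i) (- (ys ! j))))"
        unfolding moves_B_wrap_def m_def using moves_B_wrap_inj[OF c] by (subst sum.reindex) (auto intro!: sum.cong)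
      also have "\<dots> = (\<Sum>(i, j) \<in> {(i, j). i \<le> j \<and> j < m}.
          fact k * block_prod \<alpha> As * ((if Suc i = m then 1 else q) * g (m - (j - i))))"
      proof (rule sum.cong[OF HOL.refl], clarify)
        fix i j assume ij: "i \<le> j" "j < m"
        then have ij': "i \<le> j" "j < length ys" by (auto simp: m_def)
        then have fol: "follows w (ys @ [- hd ys])" using ys(3) by force
        have dom: "ys ! i \<in> signed_dom n" "- (ys ! j) \<in> signed_dom n" "ys ! i \<noteq> - (ys ! j)"
          using config_nth_dom(2)[OF c] config_B_wrap_pair(1)[OF c ij'] ij' by auto
        have "cf (signed_transp (ys ! i) (- (ys ! j))) = (if Suc i = m then 1 else q)"
          unfolding cf[OF dom] cycle_B_wrap_preserves_order_iff[OF ys(1,2) fol w ij'] m_def by simp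
        moreover obtain As' ys' where s: "config n As' ys' (w \<circ> signed_transp (ys ! i) (- (ys ! j)))"
            "length As' = Suc (length As)" "block_prod \<alpha> As' = \<alpha> (m - (j - i)) * block_prod \<alpha> As" "length ys' = j - i"
          using config_split_B_wrap_nth[OF c ij', of \<alpha>] unfolding m_def by blast
        have "m - (m - (j - i)) = j - i" using ij by simp
        then have "?N (w \<circ> signed_transp (ys ! i) (- (ys ! j))) = fact k * block_prod \<alpha> As * g (m - (j - i))"
          unfolding step[OF s(1,2)] s(3,4) g_def by (simp add: mult_ac)
        ultimately show "T (signed_transp (ys ! i) (- (ys ! j))) =
            fact k * block_prod \<alpha> As * ((if Suc i = m then 1 else q) * g (m - (j - i)))"
          unfolding T_def by (simp add: mult_ac)
      qed
      finally show ?thesis .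
    qed
    have "(\<Sum>t \<in> moves_B ys. T t) + (\<Sum>t \<in> moves_B_wrap ys. T t) = fact k * block_prod \<alpha> As *
        ((\<Sum>(i, j) \<in> {(i, j). i < j \<and> j < m}. (if Suc j = m then 1 else q) * g (j - i)) +
         (\<Sum>(i, j) \<in> {(i, j). i \<le> j \<and> j < m}. (if Suc i = m then 1 else q) * g (m - (j - i))))"
      unfolding B1 B2 distrib_left sum_distrib_left by (simp only: split_def)
    also have "\<dots> = fact k * block_prod \<alpha> As * ((1 - q + q * of_nat m) * (\<Sum>d = 1..m. g d))"
      by (simp only: weighted_sum_B)
    also have "(1 - q + q * of_nat m) * (\<Sum>d = 1..m. g d) = of_nat m * \<beta> m"
      unfolding \<beta>[of m] g_def ..
    finally show ?thesis unfolding W_def m_def by (simp add: mult_ac)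
  qed
  let ?X = "(\<Union>l < length As. moves_A As l) \<union> moves_B ys \<union> moves_B_wrap ys"
  have fin: "finite ?X" by (rule finite_subset[OF moves_reflections[OF c]]) simp
  have "chain_weight n q (Suc k) w = (\<Sum>t \<in> reflections n. T t)"
    unfolding chain_weight.simps T_def cf_def ..
  also have "\<dots> = (\<Sum>t \<in> ?X. T t)"
    using chain_weight_outside_moves[OF c Suc.prems(2)]
    by (intro sum.mono_neutral_right moves_reflections[OF c]) (auto simp: T_def)
  also have "\<dots> = (\<Sum>t \<in> (\<Union>l < length As. moves_A As l). T t) + ((\<Sum>t \<in> moves_B ys. T t) + (\<Sum>t \<in> moves_B_wrap ys. T t))"
  proof -
    have d1: "(\<Union>l < length As. moves_A As l) \<inter> (moves_B ys \<union> moves_B_wrap ys) = {}"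
      using moves_A_B_disjoint[OF c] by blast
    have "(\<Sum>t \<in> ?X. T t) = (\<Sum>t \<in> (\<Union>l < length As. moves_A As l). T t) + (\<Sum>t \<in> moves_B ys \<union> moves_B_wrap ys. T t)"
      unfolding Un_assoc by (rule sum.union_disjoint) (use fin d1 in auto)
    also have "(\<Sum>t \<in> moves_B ys \<union> moves_B_wrap ys. T t) = (\<Sum>t \<in> moves_B ys. T t) + (\<Sum>t \<in> moves_B_wrap ys. T t)"
      by (rule sum.union_disjoint) (use fin moves_B_disjoint[OF c] in auto)
    finally show ?thesis .
  qed
  also have "(\<Sum>t \<in> (\<Union>l < length As. moves_A As l). T t) = (\<Sum>l < length As. \<Sum>t \<in> moves_A As l. T t)"
  proof (rule sum.UNION_disjoint)
    show "\<forall>l \<in> {..<length As}. finite (moves_A As l)"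
      unfolding moves_A_def by (intro ballI finite_imageI finite_pairs)
    show "\<forall>l \<in> {..<length As}. \<forall>l' \<in> {..<length As}. l \<noteq> l' \<longrightarrow> moves_A As l \<inter> moves_A As l' = {}"
    proof (intro ballI impI equalityI subsetI)
      fix l l' t assume l: "l \<in> {..<length As}" "l' \<in> {..<length As}" "l \<noteq> l'" "t \<in> moves_A As l \<inter> moves_A As l'"
      from l(4) obtain i j where ij: "i < j" "j < length (As ! l)" "t = signed_transp (As ! l ! i) (As ! l ! j)"
        by (auto simp: moves_A_def)
      from l(4) obtain i' j' where ij': "i' < j'" "j' < length (As ! l')" "t = signed_transp (As ! l' ! i') (As ! l' ! j')"
        by (auto simp: moves_A_def)
      have "signed_transp (As ! l ! i) (As ! l ! j) = signed_transp (As ! l' ! i') (As ! l' ! j')"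
        using ij(3) ij'(3) by simp
      then show "t \<in> {}" using moves_A_inj[OF c _ _ ij(1,2) ij'(1,2)] l by simp
    qed simp
  qed simp
  also have "\<dots> = (\<Sum>l < length As. fact k * W * of_nat (length (As ! l) - 1))"
    using sum_A by (intro sum.cong) auto
  also have "\<dots> = fact k * W * of_nat (\<Sum>l < length As. length (As ! l) - 1)"
    by (simp add: sum_distrib_left)
  also have "(\<Sum>l < length As. length (As ! l) - 1) = sum_list (map length As) - length As"
  proof -
    have "(\<Sum>l < length As. length (As ! l) - 1) = sum_list (map (\<lambda>xs. length xs - 1) As)"
      by (simp add: sum_list_sum_nth atLeast0LessThan)
    moreover have "sum_list (map (\<lambda>xs. length xs - 1) Bs) + length Bs = sum_list (map length Bs)"
      if "\<And>xs. xs \<in> set Bs \<Longrightarrow> xs \<noteq> []" for Bs :: "int list list"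
      using that by (induction Bs) (auto simp: Suc_diff_le Suc_le_eq)
    moreover have "xs \<noteq> []" if "xs \<in> set As" for xs using c that by (simp add: config_def)
    ultimately show ?thesis by (metis add_diff_cancel_right')
  qed
  also have "fact k * W * of_nat (sum_list (map length As) - length As) +
      ((\<Sum>t \<in> moves_B ys. T t) + (\<Sum>t \<in> moves_B_wrap ys. T t)) =
      fact k * W * of_nat (sum_list (map length As) - length As + length ys)"
    unfolding sum_B by (simp add: algebra_simps)
  also have "sum_list (map length As) - length As + length ys = Suc k"
  proof -
    have "length As \<le> sum_list (map length As)"
      using c by (intro length_le_sum_list_length) (auto simp: config_def)
    then show ?thesis using config_length[OF c] Suc.prems(2) by linarith
  qed
  finally show ?case unfolding W_def by (simp add: algebra_simps)
qed

section \<open>The Coxeter element\<close>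

lemma follows_rotate:
  assumes "map f cs = rotate1 cs" "cs \<noteq> []" shows "follows f (cs @ [hd cs])"
proof -
  have nth: "f (cs ! i) = (cs @ [hd cs]) ! Suc i" if "i < length cs" for i
  proof -
    have "f (cs ! i) = rotate1 cs ! i" using assms(1) that by (metis nth_map)
    also have "\<dots> = (cs @ [hd cs]) ! Suc i" using assms(2) by (cases cs) auto
    finally show ?thesis .
  qed
  then show ?thesis by (auto simp: successively_conv_nth nth_append)
qed

lemma config_coxeter_elt:
  assumes n: "n \<ge> 1" shows "config n [] [1..int n] (coxeter_elt n)"
proof -
  let ?u = "[1..int n]" and ?c = "coxeter_elt n"
  define cs where "cs = ?u @ map uminus ?u"
  have ne: "?u \<noteq> []" using n by simp
  have hd: "hd ?u = 1" using n by (simp add: upto_rec1)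
  have distinct: "distinct cs" by (auto simp: cs_def distinct_map inj_on_def)
  have c: "?c = cycle_of_list cs" by (simp add: coxeter_elt_def cs_def)
  have "map ?c cs = rotate1 cs" using cyclic_rotation[OF distinct, of 1] by (simp add: c)
  then have fol: "follows ?c (cs @ [hd cs])" using ne by (intro follows_rotate) (auto simp: cs_def)
  have dom: "set cs = signed_dom n"
  proof (intro equalityI subsetI)
    fix x assume "x \<in> signed_dom n"
    then have "x \<in> {1..int n} \<or> - x \<in> {1..int n}" by (auto simp: signed_dom_def)
    then show "x \<in> set cs"
      unfolding cs_def by (auto intro: image_eqI[of x uminus "- x"])
  qed (auto simp: cs_def signed_dom_def)
  have perm: "?c permutes signed_dom n" unfolding c dom[symmetric] by (rule cycle_permutes)
  have nth1: "cs ! i = int i + 1" if "i < n" for i using that by (simp add: cs_def nth_append)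
  have nth2: "cs ! (n + i) = - (int i + 1)" if "i < n" for i using that by (simp add: cs_def nth_append)
  have len: "length cs = 2 * n" by (simp add: cs_def)
  have hdcs: "hd cs = 1" using ne hd by (simp add: cs_def)
  have pos: "?c (int i + 1) = (if Suc i < n then int i + 2 else - 1)" if "i < n" for i
  proof -
    have "?c ((cs @ [hd cs]) ! i) = (cs @ [hd cs]) ! Suc i" using that len by (intro follows_nth[OF fol]) simp
    then have "?c (int i + 1) = cs ! Suc i" using that len nth1[OF that] by (simp add: nth_append)
    then show ?thesis using nth1[of "Suc i"] nth2[of 0] that
      by (cases "Suc i < n") (auto simp: not_less le_Suc_eq)
  qed
  have neg: "?c (- (int i + 1)) = (if Suc i < n then - (int i + 2) else 1)" if "i < n" for i
  proof -
    have "?c ((cs @ [hd cs]) ! (n + i)) = (cs @ [hd cs]) ! Suc (n + i)" using that len by (intro follows_nth[OF fol]) simp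
    then have "?c (- (int i + 1)) = (if Suc i < n then cs ! (n + Suc i) else 1)"
      using that len nth2[OF that] by (simp add: nth_append hdcs)
    then show ?thesis using nth2[of "Suc i"] by auto
  qed
  have odd: "?c (- x) = - ?c x" if "x \<in> signed_dom n" for x
  proof (cases "0 < x")
    case True
    define i where "i = nat (x - 1)"
    have "i < n" "x = int i + 1" using that True by (auto simp: i_def signed_dom_def)
    then show ?thesis using pos[of i] neg[of i] by simp
  next
    case False
    define i where "i = nat (- x - 1)"
    have "i < n" "x = - (int i + 1)" using that False by (auto simp: i_def signed_dom_def)
    then show ?thesis using pos[of i] neg[of i] by (simp only: minus_minus split: if_split) simp
  qed
  have B: "?c \<in> B_group n" using perm odd by (simp add: B_group_def)
  \<comment> \<open>Only the positive half and the first negative element matter for \<open>config\<close>.\<close>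
  have "map uminus ?u = - 1 # tl (map uminus ?u)" using ne hd by (cases "?u") auto
  then have "cs @ [hd cs] = (?u @ [- 1]) @ (tl (map uminus ?u) @ [hd cs])" unfolding cs_def
    by (metis append_Cons append_Nil append_assoc)
  then have "follows ?c (?u @ [- hd ?u])" using fol hd by (metis successively_append_iff)
  moreover have "map abs ?u = ?u" by (rule map_idI) simp
  ultimately show ?thesis using B by (auto simp: config_def sorted_wrt_upto simp del: mset_map)
qed

section \<open>Rothe's identity\<close>

text \<open>With \<open>z = 1/u\<close> and \<open>u > 0\<close>, \<open>rothe u x k\<close> is \<open>u\<^sup>k\<close> times the Rothe coefficient
  \<open>x z / (x z + k z) \<cdot> (x z + k z gchoose k)\<close>, and \<open>rothe_binom u x k\<close> is \<open>u\<^sup>k (x z + k z gchoose k)\<close>.\<close>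

definition rothe :: "real \<Rightarrow> real \<Rightarrow> nat \<Rightarrow> real" where
  "rothe u x k = (if k = 0 then 1 else x * (\<Prod>i = 1..<k. x + of_nat k - of_nat i * u)) / fact k"

definition rothe_binom :: "real \<Rightarrow> real \<Rightarrow> nat \<Rightarrow> real" where
  "rothe_binom u x k = (\<Prod>i < k. x + of_nat k - of_nat i * u) / fact k"

lemma rothe_0 [simp]: "rothe u x 0 = 1" "rothe_binom u x 0 = 1"
  by (simp_all add: rothe_def rothe_binom_def)

lemma rothe_zero: "rothe u 0 (Suc k) = 0"
  by (simp add: rothe_def)

lemma mult_div_fact_Suc: "of_nat (Suc k) * z / fact (Suc k) = (z :: real) / fact k"
  by (simp del: of_nat_Suc)

lemma rothe_diff: "rothe u x (Suc k) - rothe u (x - u) (Suc k) = u * rothe u (x + 1 - u) k"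
proof (cases k)
  case (Suc m)
  define Q where "Q = (\<Prod>i = 1..<Suc m. x - u + of_nat (Suc k) - of_nat i * u)"
  have "(\<Prod>i = 1..<Suc k. x + of_nat (Suc k) - of_nat i * u) =
      (x + of_nat (Suc k) - u) * (\<Prod>i = 2..<Suc k. x + of_nat (Suc k) - of_nat i * u)"
    using Suc by (subst prod.atLeast_Suc_lessThan) (auto simp: numeral_2_eq_2)
  also have "(\<Prod>i = 2..<Suc k. x + of_nat (Suc k) - of_nat i * u) = Q"
    unfolding Q_def Suc by (rule prod.reindex_bij_witness[of _ Suc "\<lambda>i. i - 1"]) (auto simp: algebra_simps)
  finally have a: "rothe u x (Suc k) = x * ((x + of_nat (Suc k) - u) * Q) / fact (Suc k)"
    by (simp add: rothe_def)
  have "(\<Prod>i = 1..<Suc k. (x - u) + of_nat (Suc k) - of_nat i * u) = Q * (x - u + of_nat (Suc k) - of_nat k * u)"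
    unfolding Q_def Suc by (subst prod.atLeastLessThan_Suc) auto
  then have b: "rothe u (x - u) (Suc k) = (x - u) * (Q * (x - u + of_nat (Suc k) - of_nat k * u)) / fact (Suc k)"
    by (simp add: rothe_def)
  have "(\<Prod>i = 1..<k. (x + 1 - u) + of_nat k - of_nat i * u) = Q"
    unfolding Q_def Suc by (intro prod.cong) (auto simp: algebra_simps)
  then have c: "rothe u (x + 1 - u) k = (x + 1 - u) * Q / fact k"
    using Suc by (simp add: rothe_def)
  have "x * ((x + of_nat (Suc k) - u) * Q) - (x - u) * (Q * (x - u + of_nat (Suc k) - of_nat k * u)) =
      of_nat (Suc k) * (u * ((x + 1 - u) * Q))" by (simp add: algebra_simps)
  then have "rothe u x (Suc k) - rothe u (x - u) (Suc k) = of_nat (Suc k) * (u * ((x + 1 - u) * Q)) / fact (Suc k)"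
    unfolding a b by (simp only: diff_divide_distrib[symmetric])
  then show ?thesis unfolding c mult_div_fact_Suc by (simp add: mult.assoc)
qed (simp add: rothe_def)

lemma rothe_binom_diff: "rothe_binom u x (Suc k) - rothe_binom u (x - u) (Suc k) = u * rothe_binom u (x + 1 - u) k"
proof -
  define Q where "Q = (\<Prod>i < k. x - u + of_nat (Suc k) - of_nat i * u)"
  have a: "rothe_binom u x (Suc k) = (x + of_nat (Suc k)) * Q / fact (Suc k)"
    unfolding rothe_binom_def Q_def by (subst prod.lessThan_Suc_shift) (simp add: algebra_simps)
  have b: "rothe_binom u (x - u) (Suc k) = Q * (x - u + of_nat (Suc k) - of_nat k * u) / fact (Suc k)"
    unfolding rothe_binom_def Q_def by (subst prod.lessThan_Suc) simp
  have c: "rothe_binom u (x + 1 - u) k = Q / fact k"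
    unfolding rothe_binom_def Q_def by (simp add: algebra_simps)
  have "(x + of_nat (Suc k)) * Q - Q * (x - u + of_nat (Suc k) - of_nat k * u) = of_nat (Suc k) * (u * Q)"
    by (simp add: algebra_simps)
  then have "rothe_binom u x (Suc k) - rothe_binom u (x - u) (Suc k) = of_nat (Suc k) * (u * Q) / fact (Suc k)"
    unfolding a b by (simp only: diff_divide_distrib[symmetric])
  then show ?thesis unfolding c mult_div_fact_Suc by (simp add: mult.assoc)
qed

text \<open>The families \<open>rothe u\<close> and \<open>F\<close> satisfy the same difference equation \<open>F x (k + 1) - F (x - u) (k + 1) = u F (x + 1 - u) k\<close>, and the
  convolution inherits it in the variable \<open>j u\<close>.  For \<open>u = 1/N\<close> the shift by \<open>1\<close> is a shift by
  a multiple of \<open>u\<close>, so a double induction on \<open>n\<close> and \<open>j\<close> suffices.\<close>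

lemma rothe_convolution:
  fixes F :: "real \<Rightarrow> nat \<Rightarrow> real"
  assumes u: "u = 1 / of_nat N" "N \<ge> 1"
    and F0: "\<And>x. F x 0 = 1"
    and F: "\<And>x k. F x (Suc k) - F (x - u) (Suc k) = u * F (x + 1 - u) k"
  shows "(\<Sum>k \<le> n. rothe u (of_nat j * u) k * F y (n - k)) = F (of_nat j * u + y) n"
proof (induction n arbitrary: j)
  case 0 then show ?case by (simp add: F0)
next
  case (Suc n)
  note IH = Suc.IH
  show ?case
  proof (induction j)
    case 0
    have "(\<Sum>k \<le> Suc n. rothe u (of_nat 0 * u) k * F y (Suc n - k)) =
        (\<Sum>k \<le> Suc n. if k = 0 then F y (Suc n) else 0)"
    proof (rule sum.cong)
      fix k show "rothe u (of_nat 0 * u) k * F y (Suc n - k) = (if k = 0 then F y (Suc n) else 0)"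
        by (cases k) (auto simp: rothe_zero)
    qed simp
    then show ?case by simp
  next
    case (Suc j)
    have x: "of_nat (Suc j) * u - u = of_nat j * u" by (simp add: algebra_simps)
    \<comment> \<open>Here \<open>u = 1/N\<close> is used: the shifted argument is again a multiple of \<open>u\<close>.\<close>
    have one: "of_nat (Suc j) * u + 1 - u = of_nat (j + N) * u" using u by (simp add: field_simps)
    have "(\<Sum>k \<le> Suc n. rothe u (of_nat (Suc j) * u) k * F y (Suc n - k)) -
        (\<Sum>k \<le> Suc n. rothe u (of_nat j * u) k * F y (Suc n - k)) =
        (\<Sum>k \<le> n. (rothe u (of_nat (Suc j) * u) (Suc k) - rothe u (of_nat j * u) (Suc k)) * F y (n - k))"
      by (simp only: sum.atMost_Suc_shift rothe_0 diff_Suc_Suc)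
        (simp add: sum_subtractf[symmetric] left_diff_distrib)
    also have "\<dots> = (\<Sum>k \<le> n. u * (rothe u (of_nat (j + N) * u) k * F y (n - k)))"
      using rothe_diff[of u "of_nat (Suc j) * u", unfolded x one] by (simp only: mult.assoc)
    also have "\<dots> = u * F (of_nat (j + N) * u + y) n" by (simp only: sum_distrib_left[symmetric] IH)
    also have "of_nat (j + N) * u + y = (of_nat (Suc j) * u + y) + 1 - u" using one by linarith
    also have "u * F \<dots> n = F (of_nat (Suc j) * u + y) (Suc n) - F (of_nat (Suc j) * u + y - u) (Suc n)"
      by (rule F[symmetric])
    also have "of_nat (Suc j) * u + y - u = of_nat j * u + y" using x by linarith
    finally show ?case unfolding Suc.IH by simp
  qed
qed

text \<open>The generating functions, divided by factorials, of a cycle pair with \<open>k\<close> elements in each cycle and of a cycle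
  \<open>B = -B\<close> with \<open>2 m\<close> elements.\<close>

definition alpha :: "real \<Rightarrow> nat \<Rightarrow> real" where "alpha q k = rothe (1 - q) 1 (k - 1)"
definition beta :: "real \<Rightarrow> nat \<Rightarrow> real" where "beta q m = rothe_binom (1 - q) 0 m"

lemma alpha_beta_initial: "alpha q 1 = 1" "beta q 0 = 1"
  by (simp_all add: alpha_def beta_def)

text \<open>The convolution is \<open>rothe u 2 (k - 2)\<close>, and the factor in front of it supplies the last factor of the product
  \<open>alpha q k\<close>.\<close>

lemma alpha_recurrence:
  assumes q: "q = 1 - 1 / of_nat N" "N \<ge> 1" and k: "k \<ge> 1"
  shows "of_nat (k - 1) * alpha q k = (1 - q + q * of_nat k / 2) * (\<Sum>d = 1..<k. alpha q d * alpha q (k - d))"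
proof (cases "k = 1")
  case False
  then obtain m where m: "k = Suc (Suc m)" using k by (metis One_nat_def not0_implies_Suc not_one_le_zero)
  define u where "u = 1 - q"
  have u: "u = 1 / of_nat N" using q by (simp add: u_def)
  then have one: "of_nat N * u = 1" using q(2) by simp
  have "(\<Sum>d = 1..<k. alpha q d * alpha q (k - d)) = (\<Sum>e \<le> m. rothe u 1 e * rothe u 1 (m - e))"
    by (rule sum.reindex_bij_witness[of _ Suc "\<lambda>d. d - 1"])
      (auto simp: m alpha_def u_def intro!: arg_cong[of _ _ "rothe _ _"])
  also have "\<dots> = rothe u 2 m"
    using rothe_convolution[OF u q(2), of "rothe u" N 1 m] rothe_diff[of u] unfolding one by simp
  finally have conv: "(\<Sum>d = 1..<k. alpha q d * alpha q (k - d)) = rothe u 2 m" .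
  show ?thesis
  proof (cases m)
    case 0 then show ?thesis unfolding conv by (simp add: m alpha_def rothe_def)
  next
    case (Suc l)
    have "(\<Prod>i = 1..<Suc m. 1 + of_nat (Suc m) - of_nat i * u) =
        (\<Prod>i = 1..<m. 2 + of_nat m - of_nat i * u) * (2 + of_nat m - of_nat m * u)"
      using Suc by (subst prod.atLeastLessThan_Suc) auto
    then have "alpha q k = (\<Prod>i = 1..<m. 2 + of_nat m - of_nat i * u) * (2 + of_nat m - of_nat m * u) / fact (Suc m)"
      by (simp add: alpha_def m rothe_def u_def[symmetric])
    moreover have "rothe u 2 m = 2 * (\<Prod>i = 1..<m. 2 + of_nat m - of_nat i * u) / fact m"
      using Suc by (simp add: rothe_def)
    moreover have "1 - q + q * of_nat k / 2 = (2 + of_nat m - of_nat m * u) / 2"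
      by (simp add: u_def m field_simps)
    moreover have "of_nat (k - 1) * (x / fact (Suc m)) = x / fact m" for x :: real
      by (simp add: m del: of_nat_Suc)
    ultimately show ?thesis unfolding conv by simp
  qed
qed simp

lemma beta_recurrence:
  assumes q: "q = 1 - 1 / of_nat N" "N \<ge> 1"
  shows "of_nat m * beta q m = (1 - q + q * of_nat m) * (\<Sum>d = 1..m. alpha q d * beta q (m - d))"
proof (cases m)
  case (Suc l)
  define u where "u = 1 - q"
  have u: "u = 1 / of_nat N" using q by (simp add: u_def)
  then have one: "of_nat N * u = 1" using q(2) by simp
  have "(\<Sum>d = 1..m. alpha q d * beta q (m - d)) = (\<Sum>e \<le> l. rothe u 1 e * rothe_binom u 0 (l - e))"
    by (rule sum.reindex_bij_witness[of _ Suc "\<lambda>d. d - 1"])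
      (auto simp: Suc alpha_def beta_def u_def intro!: arg_cong[of _ _ "rothe_binom _ _"])
  also have "\<dots> = rothe_binom u 1 l"
    using rothe_convolution[OF u q(2), of "rothe_binom u" N 0 l] rothe_binom_diff[of u] unfolding one by simp
  finally have conv: "(\<Sum>d = 1..m. alpha q d * beta q (m - d)) = rothe_binom u 1 l" .
  have "beta q m = (\<Prod>i < l. of_nat m - of_nat i * u) * (of_nat m - of_nat l * u) / fact (Suc l)"
    unfolding beta_def rothe_binom_def Suc u_def[symmetric] by simp
  moreover have "rothe_binom u 1 l = (\<Prod>i < l. of_nat m - of_nat i * u) / fact l"
    by (simp add: rothe_binom_def Suc add.commute)
  moreover have "1 - q + q * of_nat m = of_nat m - of_nat l * u" by (simp add: u_def Suc algebra_simps)
  moreover have "of_nat m * (x / fact (Suc l)) = x / fact l" for x :: real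
    by (simp add: Suc del: of_nat_Suc)
  ultimately show ?thesis unfolding conv by simp
qed simp

lemma fact_mult_beta: "fact n * beta q n = (\<Prod>k < n. of_nat (n - k) + of_nat k * q)"
  unfolding beta_def rothe_binom_def by (auto intro!: prod.cong simp: of_nat_diff algebra_simps)

section \<open>A three-term recurrence\<close>

text \<open>The product that the solution of the recurrence collapses to is \<open>(n - 1)!\<close> times the value at \<open>k = n - 1\<close>.\<close>

definition partial_product :: "nat \<Rightarrow> real \<Rightarrow> nat \<Rightarrow> real" where
  "partial_product n q k = (\<Prod>i = 1..k. of_nat i + q * (of_nat n - of_nat i)) / fact k"

lemma partial_product_Suc: "of_nat (Suc k) * partial_product n q (Suc k) = (of_nat (Suc k) + q * (of_nat n - of_nat (Suc k))) * partial_product n q k"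
  by (simp add: partial_product_def field_simps del: of_nat_Suc)

text \<open>The closed form of the sequence \<open>f\<close> with \<open>f 0 = 1\<close>, \<open>f 1 = 1 + q\<close> and
  \<open>m f m = m (1 + q) f (m - 1) + q (n - m) f (m - 2)\<close>.  It is found from the generating function
  of \<open>f\<close> by Lagrange inversion.\<close>

definition solution :: "nat \<Rightarrow> real \<Rightarrow> nat \<Rightarrow> real" where
  "solution n q m = (\<Sum>k \<le> m. partial_product n q k * (- q) ^ (m - k) * ((of_nat n - of_nat k - 2) gchoose (m - k)))"

lemma solution_0: "solution n q 0 = 1"
  by (simp add: solution_def partial_product_def)

lemma solution_1: "solution n q 1 = 1 + q"
  by (simp add: solution_def partial_product_def algebra_simps)

text \<open>The upper argument \<open>n - k - 2\<close> of the binomial coefficient is a natural number smaller than the lower one, except for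
  \<open>k = n - 1\<close>.\<close>

lemma solution_top: "n \<ge> 1 \<Longrightarrow> solution n q (n - 1) = partial_product n q (n - 1)"
proof -
  assume n: "n \<ge> 1"
  have "(of_nat n - of_nat k - 2 :: real) gchoose (n - 1 - k) = (if k = n - 1 then 1 else 0)"
    if "k \<le> n - 1" for k
  proof (cases "k = n - 1")
    case False
    then have e: "(of_nat n - of_nat k - 2 :: real) = of_nat (n - 2 - k)" and less: "n - 2 - k < n - 1 - k"
      using that n by (auto simp: of_nat_diff)
    have "(of_nat n - of_nat k - 2 :: real) gchoose (n - 1 - k) = of_nat ((n - 2 - k) choose (n - 1 - k))"
      unfolding e by (rule binomial_gbinomial[symmetric])
    then show ?thesis using False less by (simp add: binomial_eq_0)
  qed simp
  then have "solution n q (n - 1) = (\<Sum>k \<le> n - 1. if k = n - 1 then partial_product n q k else 0)"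
    unfolding solution_def by (intro sum.cong) auto
  then show ?thesis by simp
qed

text \<open>The terms with the same \<open>k\<close> in the three sums combine to a difference \<open>V k - V (k + 1)\<close>.\<close>

lemma solution_recurrence:
  "of_nat (m + 2) * solution n q (m + 2) =
    of_nat (m + 2) * (1 + q) * solution n q (m + 1) + q * (of_nat n - of_nat m - 2) * solution n q m"
proof -
  define s where "s = - q"
  define C where "C k j = ((of_nat n - of_nat k - 2 :: real) gchoose j)" for k j :: nat
  let ?p = "partial_product n q"
  \<comment> \<open>The boundary values are \<open>V 0 = 0\<close> and \<open>V (m + 1)\<close>; the latter cancels against the terms \<open>k > m\<close>.\<close>
  define V where "V k = of_nat k * ?p k * s ^ (m + 2 - k) * ((of_nat n - of_nat k - 1) gchoose (m + 2 - k))" for k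
  define D where "D k = of_nat (m + 2) * (?p k * s ^ (m + 2 - k) * C k (m + 2 - k))
      - of_nat (m + 2) * (1 - s) * (?p k * s ^ (m + 1 - k) * C k (m + 1 - k))
      + s * (of_nat n - of_nat m - 2) * (?p k * s ^ (m - k) * C k (m - k))" for k
  have tele: "D k = V k - V (Suc k)" if "k \<le> m" for k
  proof -
    define j where "j = m - k"
    then have j: "m = k + j" using that by simp
    define X :: real where "X = of_nat n - of_nat k - 2"
    have e: "m + 2 - k = Suc (Suc j)" "m + 1 - k = Suc j" "m - k = j" "m + 2 - Suc k = Suc j" by (auto simp: j)
    have pas: "(X + 1) gchoose Suc (Suc j) = (X gchoose Suc j) + (X gchoose Suc (Suc j))"
      by (rule gbinomial_Suc_Suc)
    have abs1: "(X - of_nat j) * (X gchoose j) = of_nat (Suc j) * (X gchoose Suc j)"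
      using gbinomial_mult_1[of X j] by (simp add: left_diff_distrib)
    have abs2: "of_nat (Suc (Suc j)) * ((X + 1) gchoose Suc (Suc j)) = (X + 1) * (X gchoose Suc j)"
      using gbinomial_absorption[of "Suc j" "X + 1"] by simp
    have p: "of_nat (Suc k) * ?p (Suc k) = (of_nat (Suc k) - s * (X + 1)) * ?p k"
      unfolding partial_product_Suc by (simp add: X_def s_def algebra_simps)
    define c where "c = ?p k * s ^ Suc j"
    have "D k = of_nat (m + 2) * c * s * (X gchoose Suc (Suc j)) - of_nat (m + 2) * (1 - s) * c * (X gchoose Suc j)
        + c * ((X - of_nat j) * (X gchoose j))"
      unfolding D_def C_def e X_def[symmetric] c_def
      by (simp add: j X_def algebra_simps)
    also have "\<dots> = of_nat (m + 2) * c * s * ((X + 1) gchoose Suc (Suc j)) - of_nat (Suc k) * c * (X gchoose Suc j)"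
      unfolding abs1 pas by (simp add: j algebra_simps)
    also have "of_nat (m + 2) * c * s * ((X + 1) gchoose Suc (Suc j)) =
        of_nat k * c * s * ((X + 1) gchoose Suc (Suc j)) + c * s * ((X + 1) * (X gchoose Suc j))"
      unfolding abs2[symmetric] by (simp add: j algebra_simps)
    also have "of_nat k * c * s * ((X + 1) gchoose Suc (Suc j)) = V k"
      unfolding V_def e c_def by (simp add: X_def)
    also have "V k + c * s * ((X + 1) * (X gchoose Suc j)) - of_nat (Suc k) * c * (X gchoose Suc j) =
        V k - ((of_nat (Suc k) - s * (X + 1)) * ?p k) * s ^ Suc j * (X gchoose Suc j)"
      unfolding c_def by (simp add: algebra_simps)
    also have "((of_nat (Suc k) - s * (X + 1)) * ?p k) * s ^ Suc j * (X gchoose Suc j) = V (Suc k)"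
      unfolding V_def e p by (simp add: X_def)
    finally show ?thesis .
  qed
  have "(\<Sum>k \<le> m. D k) = V 0 - V (Suc m)"
  proof -
    have "(\<Sum>k \<le> m. D k) = (\<Sum>k \<le> m. V k - V (Suc k))" using tele by (intro sum.cong) auto
    then show ?thesis by (simp add: sum_telescope)
  qed
  moreover have "V 0 = 0" by (simp add: V_def)
  ultimately have sum_D: "(\<Sum>k \<le> m. D k) = - V (Suc m)" by simp
  define Y :: real where "Y = of_nat n - of_nat m - 2"
  have V: "V (Suc m) = of_nat (Suc m) * ?p (Suc m) * s * Y" by (simp add: V_def Y_def)
  have p: "of_nat (m + 2) * ?p (m + 2) = (of_nat (m + 2) - s * Y) * ?p (Suc m)"
    using partial_product_Suc[of "Suc m" n q] by (simp add: Y_def s_def algebra_simps)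
  have sol_eq: "solution n q l = (\<Sum>k \<le> l. ?p k * s ^ (l - k) * C k (l - k))" for l
    by (simp add: solution_def C_def s_def)
  have sol2: "solution n q (m + 2) = (\<Sum>k \<le> m. ?p k * s ^ (m + 2 - k) * C k (m + 2 - k))
      + ?p (Suc m) * s * (Y - 1) + ?p (m + 2)"
    unfolding sol_eq by (simp add: numeral_2_eq_2 C_def Y_def)
  have sol1: "solution n q (m + 1) = (\<Sum>k \<le> m. ?p k * s ^ (m + 1 - k) * C k (m + 1 - k)) + ?p (Suc m)"
    unfolding sol_eq by (simp add: C_def)
  have "of_nat (m + 2) * solution n q (m + 2) - of_nat (m + 2) * (1 - s) * solution n q (m + 1) + s * Y * solution n q m =
      (\<Sum>k \<le> m. D k) + of_nat (m + 2) * (?p (Suc m) * s * (Y - 1)) + of_nat (m + 2) * ?p (m + 2)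
      - of_nat (m + 2) * (1 - s) * ?p (Suc m)"
    unfolding sol2 sol1 unfolding sol_eq D_def Y_def[symmetric]
    by (simp add: sum.distrib sum_subtractf sum_distrib_left algebra_simps)
  also have "\<dots> = 0" unfolding sum_D V p by (simp add: algebra_simps)
  finally show ?thesis by (simp add: s_def Y_def algebra_simps)
qed

section \<open>Words without consecutive excedances\<close>

text \<open>Prefixes of length \<open>m\<close> of the words that are counted by \<open>gamma_B\<close>.  The condition \<open>x\<^sub>1 = 1\<close> is replaced by
  the equivalent one that \<open>1\<close> is not an excedance, which makes sense for the empty prefix.\<close>

definition good_words :: "nat \<Rightarrow> nat \<Rightarrow> nat list set" where
  "good_words n m = {x. length x = m \<and> set x \<subseteq> {1..n} \<and> 1 \<notin> excedances x \<and> no_consecutive_exc x}"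

lemma finite_good_words: "finite (good_words n m)"
  by (rule finite_subset[OF _ finite_lists_length_eq[of "{1..n}" m]]) (auto simp: good_words_def)

lemma excedances_snoc:
  "excedances (x @ [y]) = excedances x \<union> (if Suc (length x) < y then {Suc (length x)} else {})"
  by (auto simp: excedances_def nth_append le_Suc_eq)

lemma excedances_subset: "excedances x \<subseteq> {1..length x}"
  by (auto simp: excedances_def)

lemma exc_snoc: "exc (x @ [y]) = exc x + (if Suc (length x) < y then 1 else 0)"
proof -
  have "finite (excedances x)" "Suc (length x) \<notin> excedances x"
    using excedances_subset[of x] finite_subset by auto
  then show ?thesis by (simp add: exc_def excedances_snoc)
qed

lemma no_consecutive_exc_snoc:
  "no_consecutive_exc (x @ [y]) \<longleftrightarrow>
    no_consecutive_exc x \<and> \<not> (length x \<in> excedances x \<and> Suc (length x) < y)"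
  using excedances_subset[of x] by (auto simp: no_consecutive_exc_def excedances_snoc)

lemma length_mem_excedances_snoc: "Suc (length x) \<in> excedances (x @ [y]) \<longleftrightarrow> Suc (length x) < y"
  using excedances_subset[of x] by (auto simp: excedances_snoc)

lemma exc_Nil: "exc [] = 0"
  by (simp add: exc_def excedances_def)

lemma exc_one: "exc [1] = 0"
  using exc_snoc[of "[]" 1] by (simp add: exc_Nil)

lemma good_words_0: "good_words n 0 = {[]}"
  by (auto simp: good_words_def excedances_def no_consecutive_exc_def)

lemma good_words_snoc_nonexc:
  "x \<in> good_words n m \<Longrightarrow> 1 \<le> y \<Longrightarrow> y \<le> Suc m \<Longrightarrow> y \<le> n \<Longrightarrow> x @ [y] \<in> good_words n (Suc m)"
  by (auto simp: good_words_def excedances_snoc no_consecutive_exc_snoc)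

lemma good_words_snocD:
  "x @ [y] \<in> good_words n (Suc m) \<Longrightarrow> x \<in> good_words n m \<and> 1 \<le> y \<and> y \<le> n"
  by (auto simp: good_words_def excedances_snoc no_consecutive_exc_snoc split: if_splits)

lemma good_words_Suc_E:
  assumes "x \<in> good_words n (Suc m)"
  obtains x' y where "x = x' @ [y]" "x' \<in> good_words n m" "1 \<le> y" "y \<le> n"
proof -
  have "x \<noteq> []" using assms by (auto simp: good_words_def)
  then obtain x' y where "x = x' @ [y]" using rev_exhaust by blast
  then show ?thesis using that good_words_snocD assms by blast
qed

lemma good_words_1: "n \<ge> 1 \<Longrightarrow> good_words n 1 = {[1]}"
proof (intro equalityI subsetI)
  fix x assume x: "x \<in> good_words n 1"
  then have "x \<in> good_words n (Suc 0)" by simp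
  then obtain y where y: "x = [y]" "1 \<le> y" by (elim good_words_Suc_E) (auto simp: good_words_0)
  then show "x \<in> {[1]}" using x by (auto simp: good_words_def excedances_def)
qed (auto simp: good_words_def excedances_def no_consecutive_exc_def)

text \<open>The last letter is an excedance or not; if it is, the letter before it is none.\<close>

lemma good_words_Suc_Suc:
  assumes "m + 2 \<le> n"
  shows "good_words n (m + 2) =
    (\<lambda>(x, y). x @ [y]) ` (good_words n (m + 1) \<times> {1..m + 2}) \<union>
    (\<lambda>(x, z, y). x @ [z] @ [y]) ` (good_words n m \<times> {1..m + 1} \<times> {m + 3..n})"
    (is "_ = ?A \<union> ?B")
proof (intro equalityI subsetI)
  fix x assume "x \<in> good_words n (m + 2)"
  then have x: "x \<in> good_words n (Suc (Suc m))" by simp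
  then obtain x' y where x': "x = x' @ [y]" "x' \<in> good_words n (Suc m)" "1 \<le> y" "y \<le> n"
    by (rule good_words_Suc_E)
  show "x \<in> ?A \<union> ?B"
  proof (cases "y \<le> m + 2")
    case True then show ?thesis using x' by (intro UnI1 image_eqI[of _ _ "(x', y)"]) auto
  next
    case False
    obtain x'' z where x'': "x' = x'' @ [z]" "x'' \<in> good_words n m" "1 \<le> z" "z \<le> n"
      using x'(2) by (rule good_words_Suc_E)
    have len: "length x'' = m" using x'' by (simp add: good_words_def)
    have "no_consecutive_exc (x' @ [y])" using x by (simp add: good_words_def x'(1))
    moreover have "length x' = Suc m" using len by (simp add: x''(1))
    ultimately have "Suc m \<notin> excedances x'" using False by (simp add: no_consecutive_exc_snoc)
    then have "z \<le> m + 1" using length_mem_excedances_snoc[of x'' z] len by (simp add: x''(1))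
    then show ?thesis using x' x'' False by (intro UnI2 image_eqI[of _ _ "(x'', z, y)"]) auto
  qed
next
  fix x assume "x \<in> ?A \<union> ?B"
  then show "x \<in> good_words n (m + 2)"
  proof
    assume "x \<in> ?A"
    then show ?thesis using good_words_snoc_nonexc[of _ n "m + 1"] assms by auto
  next
    assume "x \<in> ?B"
    then obtain x'' z y where x: "x = (x'' @ [z]) @ [y]" "x'' \<in> good_words n m" "1 \<le> z" "z \<le> m + 1" "m + 3 \<le> y" "y \<le> n"
      by auto
    define v where "v = x'' @ [z]"
    have v: "v \<in> good_words n (Suc m)" unfolding v_def using x assms by (intro good_words_snoc_nonexc) auto
    then have len: "length v = Suc m" by (simp add: good_words_def)
    then have "Suc m \<notin> excedances v"
      unfolding v_def using length_mem_excedances_snoc[of x'' z] x(4) by simp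
    then show ?thesis using v x(5,6) len unfolding x(1) v_def[symmetric] good_words_def
      by (auto simp: excedances_snoc no_consecutive_exc_snoc)
  qed
qed

lemma good_words_exc_le:
  "m \<le> n \<Longrightarrow> x \<in> good_words n m \<Longrightarrow> 2 * exc x \<le> m"
proof (induction m arbitrary: x rule: less_induct)
  case (less m)
  consider "m = 0" | "m = 1" | l where "m = l + 2" by (metis One_nat_def add_2_eq_Suc' not0_implies_Suc)
  then show ?case
  proof cases
    case 1
    then have "x = []" using less.prems(2) by (simp add: good_words_0)
    then show ?thesis by (simp add: exc_Nil)
  next
    case 2
    then have "x = [1]" using less.prems good_words_1[of n] by simp
    then show ?thesis by (simp only: exc_one)
  next
    case (3 l)
    then have le: "l + 2 \<le> n" and "x \<in> good_words n (l + 2)" using less.prems by auto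
    from this(2) show ?thesis unfolding good_words_Suc_Suc[OF le]
    proof
      assume "x \<in> (\<lambda>(x, y). x @ [y]) ` (good_words n (l + 1) \<times> {1..l + 2})"
      then obtain x' y where x': "x = x' @ [y]" "x' \<in> good_words n (l + 1)" "y \<le> l + 2" by auto
      then have "length x' = l + 1" by (simp add: good_words_def)
      then show ?thesis using less.IH[of "l + 1" x'] x' 3 less.prems by (simp add: exc_snoc)
    next
      assume "x \<in> (\<lambda>(x, z, y). x @ [z] @ [y]) ` (good_words n l \<times> {1..l + 1} \<times> {l + 3..n})"
      then obtain x' z y where x': "x = (x' @ [z]) @ [y]" "x' \<in> good_words n l" "z \<le> l + 1" by auto
      then have "length x' = l" by (simp add: good_words_def)
      then show ?thesis using less.IH[of l x'] x' 3 less.prems by (simp add: exc_snoc del: append_assoc)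
    qed
  qed
qed

definition word_weight :: "nat \<Rightarrow> real \<Rightarrow> nat \<Rightarrow> real" where
  "word_weight n q m = (\<Sum>x \<in> good_words n m. q ^ exc x * (1 + q) ^ (m - 2 * exc x))"

text \<open>By \<open>good_words_exc_le\<close> the exponent of \<open>1 + q\<close> is a true difference, so appending a non-excedance multiplies the
  weight by \<open>1 + q\<close>, and appending a non-excedance followed by an excedance multiplies it by \<open>q\<close>.\<close>

lemma word_weight_recurrence:
  assumes n: "m + 2 \<le> n"
  shows "word_weight n q (m + 2) =
    of_nat (m + 2) * (1 + q) * word_weight n q (m + 1)
    + of_nat (m + 1) * (of_nat n - of_nat m - 2) * q * word_weight n q m"
proof -
  let ?w = "\<lambda>m x. q ^ exc x * (1 + q) ^ (m - 2 * exc x)"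
  let ?A = "good_words n (m + 1) \<times> {1..m + 2}" and ?B = "good_words n m \<times> {1..m + 1} \<times> {m + 3..n}"
  let ?f = "\<lambda>(x :: nat list, y). x @ [y]" and ?g = "\<lambda>(x :: nat list, z, y). x @ [z] @ [y]"
  have disj: "?f ` ?A \<inter> ?g ` ?B = {}" by auto
  have "word_weight n q (m + 2) = (\<Sum>x \<in> ?f ` ?A. ?w (m + 2) x) + (\<Sum>x \<in> ?g ` ?B. ?w (m + 2) x)"
    unfolding word_weight_def good_words_Suc_Suc[OF n]
    by (rule sum.union_disjoint) (use disj finite_good_words in auto)
  also have "(\<Sum>x \<in> ?f ` ?A. ?w (m + 2) x) = (\<Sum>(x, y) \<in> ?A. (1 + q) * ?w (m + 1) x)"
  proof (subst sum.reindex)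
    show "inj_on ?f ?A" by (auto simp: inj_on_def)
    show "sum (?w (m + 2) \<circ> ?f) ?A = (\<Sum>(x, y) \<in> ?A. (1 + q) * ?w (m + 1) x)"
    proof (rule sum.cong[OF HOL.refl], clarsimp)
      fix x y assume x: "x \<in> good_words n (Suc m)" "Suc 0 \<le> y" "y \<le> Suc (Suc m)"
      then have "length x = Suc m" by (simp add: good_words_def)
      then have "exc (x @ [y]) = exc x" using x by (simp add: exc_snoc)
      moreover have "2 * exc x \<le> Suc m" using good_words_exc_le[of "Suc m" n x] x n by simp
      ultimately show "q ^ exc (x @ [y]) * (1 + q) ^ (Suc (Suc m) - 2 * exc (x @ [y])) =
          (1 + q) * (q ^ exc x * (1 + q) ^ (Suc m - 2 * exc x))" by (simp add: Suc_diff_le)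
    qed
  qed
  also have "(\<Sum>x \<in> ?g ` ?B. ?w (m + 2) x) = (\<Sum>(x, z, y) \<in> ?B. q * ?w m x)"
  proof (subst sum.reindex)
    show "inj_on ?g ?B" by (auto simp: inj_on_def)
    show "sum (?w (m + 2) \<circ> ?g) ?B = (\<Sum>(x, z, y) \<in> ?B. q * ?w m x)"
    proof (rule sum.cong[OF HOL.refl], clarsimp)
      fix x z y assume x: "x \<in> good_words n m" "z \<le> Suc m" "m + 3 \<le> y"
      then have "length x = m" by (simp add: good_words_def)
      then have "exc ((x @ [z]) @ [y]) = Suc (exc x)"
        using x unfolding exc_snoc by simp
      then have "exc (x @ [z, y]) = Suc (exc x)" by simp
      then show "q ^ exc (x @ [z, y]) * (1 + q) ^ (Suc (Suc m) - 2 * exc (x @ [z, y])) =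
          q * (q ^ exc x * (1 + q) ^ (m - 2 * exc x))" by simp
    qed
  qed
  also have "(\<Sum>(x, y) \<in> ?A. (1 + q) * ?w (m + 1) x) = of_nat (m + 2) * (1 + q) * word_weight n q (m + 1)"
    unfolding word_weight_def
    by (subst sum.cartesian_product[symmetric]) (simp add: sum_distrib_left mult_ac)
  also have "(\<Sum>(x, z, y) \<in> ?B. q * ?w m x) =
      of_nat (m + 1) * (of_nat n - of_nat m - 2) * q * word_weight n q m"
  proof -
    have "(\<Sum>(x, z, y) \<in> ?B. q * ?w m x) = (\<Sum>x \<in> good_words n m. \<Sum>p \<in> {1..m + 1} \<times> {m + 3..n}. q * ?w m x)"
      by (subst sum.cartesian_product) (intro sum.cong, auto)
    moreover have "card ({1..m + 1} \<times> {m + 3..n}) = (m + 1) * (n - m - 2)"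
      by (simp add: card_cartesian_product)
    then have "of_nat (card ({1..m + 1} \<times> {m + 3..n})) = (of_nat (m + 1) * of_nat (n - m - 2) :: real)"
      by (simp only: of_nat_mult)
    moreover have "of_nat (n - m - 2) = (of_nat n - of_nat m - 2 :: real)" using n by linarith
    ultimately show ?thesis unfolding word_weight_def sum_constant by (simp only: sum_distrib_left mult.assoc cong: prod.case_cong)
  qed
  finally show ?thesis .
qed

lemma word_weight_eq_solution: "n \<ge> 1 \<Longrightarrow> m \<le> n \<Longrightarrow> word_weight n q m = fact m * solution n q m"
proof (induction m rule: less_induct)
  case (less m)
  consider "m = 0" | "m = 1" | l where "m = l + 2" by (metis One_nat_def add_2_eq_Suc' not0_implies_Suc)
  then show ?case
  proof cases
    case 1 then show ?thesis
      by (simp add: word_weight_def good_words_0 solution_0 exc_Nil)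
  next
    case 2
    have "word_weight n q 1 = 1 + q"
      unfolding word_weight_def good_words_1[OF less.prems(1)] by (simp add: exc_one[simplified])
    then show ?thesis unfolding 2 using solution_1[of n q] by simp
  next
    case (3 l)
    have "word_weight n q (l + 2) = of_nat (l + 2) * (1 + q) * (fact (l + 1) * solution n q (l + 1))
        + of_nat (l + 1) * (of_nat n - of_nat l - 2) * q * (fact l * solution n q l)"
      using word_weight_recurrence[of l n q] less 3 by simp
    also have "\<dots> = fact (l + 1) * (of_nat (l + 2) * (1 + q) * solution n q (l + 1) + q * (of_nat n - of_nat l - 2) * solution n q l)"
      by (simp add: algebra_simps)
    also have "\<dots> = fact (l + 1) * (of_nat (l + 2) * solution n q (l + 2))"
      unfolding solution_recurrence ..
    also have "\<dots> = fact (l + 2) * solution n q (l + 2)" by (simp add: algebra_simps)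
    finally show ?thesis using 3 by simp
  qed
qed

lemma words_first_letter_one:
  assumes "n \<ge> 1"
  shows "{x \<in> words_B n. x ! 0 = 1 \<and> no_consecutive_exc x} = good_words n n"
proof -
  have "x ! 0 = 1 \<longleftrightarrow> 1 \<notin> excedances x" if "x \<in> words_B n" for x
  proof -
    have "x ! 0 \<in> set x" using that assms by (intro nth_mem) (auto simp: words_B_def)
    then have "1 \<le> x ! 0" using that by (auto simp: words_B_def)
    then show ?thesis using that assms by (auto simp: excedances_def words_B_def)
  qed
  then show ?thesis unfolding good_words_def by (auto simp: words_B_def)
qed

text \<open>No letter exceeds \<open>n\<close>, so the letter at position \<open>n\<close> is arbitrary and is never an excedance.\<close>

lemma good_words_last:
  assumes "n \<ge> 1"
  shows "good_words n n = (\<lambda>(x, y). x @ [y]) ` (good_words n (n - 1) \<times> {1..n})"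
proof -
  obtain m where m: "n = Suc m" using assms by (metis Suc_le_D One_nat_def)
  show ?thesis
  proof (intro equalityI subsetI)
    fix x assume "x \<in> good_words n n"
    then obtain x' y where "x = x' @ [y]" "x' \<in> good_words n m" "1 \<le> y" "y \<le> n"
      using good_words_Suc_E[of x n m] m by auto
    then show "x \<in> (\<lambda>(x, y). x @ [y]) ` (good_words n (n - 1) \<times> {1..n})"
      using m by (intro image_eqI[of _ _ "(x', y)"]) auto
  next
    fix x assume "x \<in> (\<lambda>(x, y). x @ [y]) ` (good_words n (n - 1) \<times> {1..n})"
    then show "x \<in> good_words n n" using m good_words_snoc_nonexc[of _ n m] by auto
  qed
qed

lemma gamma_sum:
  assumes n: "n \<ge> 1"
  shows "(\<Sum>j = 0..(n - 1) div 2. of_nat (gamma_B n j) * q ^ j * (1 + q) ^ (n - 1 - 2 * j)) =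
    (\<Prod>k < n. of_nat (n - k) + of_nat k * (q :: real))"
proof -
  let ?w = "\<lambda>x. q ^ exc x * (1 + q) ^ (n - 1 - 2 * exc x)"
  have exc_last: "exc (x @ [y]) = exc x" if "x \<in> good_words n (n - 1)" "y \<le> n" for x y
    using that n by (auto simp: exc_snoc good_words_def)
  have range: "exc ` good_words n n \<subseteq> {0..(n - 1) div 2}"
  proof
    fix e assume "e \<in> exc ` good_words n n"
    then obtain x y where x: "x \<in> good_words n (n - 1)" "e = exc x"
      using exc_last unfolding good_words_last[OF n] by auto
    have "2 * exc x \<le> n - 1" using good_words_exc_le[OF _ x(1)] by simp
    then show "e \<in> {0..(n - 1) div 2}" using x(2) by simp
  qed
  have "{x \<in> words_B n. exc x = j \<and> x ! 0 = 1 \<and> no_consecutive_exc x} = {x \<in> good_words n n. exc x = j}" for j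
    using words_first_letter_one[OF n] by blast
  then have "of_nat (gamma_B n j) * q ^ j * (1 + q) ^ (n - 1 - 2 * j) = (\<Sum>x \<in> {x \<in> good_words n n. exc x = j}. ?w x)" for j
    by (simp add: gamma_B_def mult.assoc)
  then have "(\<Sum>j = 0..(n - 1) div 2. of_nat (gamma_B n j) * q ^ j * (1 + q) ^ (n - 1 - 2 * j)) =
      (\<Sum>x \<in> good_words n n. ?w x)"
    by (simp only:) (rule sum.group[OF finite_good_words _ range]; simp)
  also have "\<dots> = (\<Sum>(x, y) \<in> good_words n (n - 1) \<times> {1..n}. ?w x)"
    unfolding good_words_last[OF n]
    by (subst sum.reindex) (auto simp: inj_on_def exc_last intro!: sum.cong)
  also have "\<dots> = of_nat n * word_weight n q (n - 1)"
    unfolding word_weight_def by (subst sum.cartesian_product[symmetric]) (simp add: sum_distrib_left)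
  also have "\<dots> = of_nat n * (\<Prod>i = 1..n - 1. of_nat i + q * (of_nat n - of_nat i))"
    using word_weight_eq_solution[OF n, of "n - 1" q] solution_top[OF n] by (simp add: partial_product_def)
  also have "(\<Prod>i = 1..n - 1. of_nat i + q * (of_nat n - of_nat i)) = (\<Prod>k = 1..<n. of_nat (n - k) + of_nat k * q)"
    by (rule prod.reindex_bij_witness[of _ "\<lambda>k. n - k" "\<lambda>k. n - k"]) (auto simp: of_nat_diff algebra_simps)
  also have "of_nat n * \<dots> = (\<Prod>k = 0..<n. of_nat (n - k) + of_nat k * q)"
    using n by (subst (2) prod.atLeast_Suc_lessThan) auto
  finally show ?thesis by (simp add: atLeast0LessThan)
qed

section \<open>Comparison of the two sides\<close>

lemma chain_weight_coxeter_elt: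
  assumes "n \<ge> 1" "q = 1 - 1 / of_nat N" "N \<ge> 1"
  shows "chain_weight n q n (coxeter_elt n) = (\<Prod>k < n. of_nat (n - k) + of_nat k * q)"
proof -
  have "chain_weight n q n (coxeter_elt n) = fact n * (block_prod (alpha q) [] * beta q (length [1..int n]))"
    using assms(1)
    by (intro chain_weight_config alpha_beta_initial alpha_recurrence[OF assms(2,3)]
        beta_recurrence[OF assms(2,3)] config_coxeter_elt) auto
  then show ?thesis by (simp add: fact_mult_beta)
qed

text \<open>The generating function at \<open>q = 0\<close> is \<open>n! \<noteq> 0\<close>, so a factorisation into \<open>n\<close> reflections exists;
  \<open>config_word_rank\<close> excludes shorter ones.\<close>

lemma len_T_coxeter_elt:
  assumes "n \<ge> 1" shows "len_T n (coxeter_elt n) = n"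
proof -
  have c: "config n [] [1..int n] (coxeter_elt n)" by (rule config_coxeter_elt[OF assms])
  then have B: "coxeter_elt n \<in> B_group n" by (simp add: config_def)
  \<comment> \<open>The value \<open>q = 0\<close> is the evaluation point \<open>1 - 1/N\<close> with \<open>N = 1\<close>.\<close>
  have "(0 :: real) < (\<Prod>k < n. of_nat (n - k) + of_nat k * 0)" by (intro prod_pos) auto
  then have "chain_weight n 0 n (coxeter_elt n) \<noteq> 0"
    using chain_weight_coxeter_elt[OF assms, of 0 1] by simp
  then obtain ts where "set ts \<subseteq> reflections n" "length ts = n" "compose_list ts = coxeter_elt n"
    using chain_weight_nonzero_imp_word[OF _ B] by blast
  then have "len_T n (coxeter_elt n) \<le> n" using word_length_le by metis
  moreover obtain ts where "set ts \<subseteq> reflections n" "length ts = len_T n (coxeter_elt n)"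
      "coxeter_elt n = compose_list ts"
    using shortest_word[OF B_group_generated_reflections[OF B]] by blast
  then have "n \<le> len_T n (coxeter_elt n)" using config_word_rank(1)[OF c, of ts] by simp
  ultimately show ?thesis by simp
qed

abbreviation real_poly :: "int poly \<Rightarrow> real poly" where
  "real_poly \<equiv> map_poly of_int"

lemma real_poly_add: "real_poly (p + r) = real_poly p + real_poly r"
  by (rule poly_eqI) (simp add: coeff_map_poly)

lemma real_poly_mult: "real_poly (p * r) = real_poly p * real_poly r"
  by (rule poly_eqI) (simp add: coeff_map_poly coeff_mult)

lemma real_poly_power: "real_poly (p ^ k) = real_poly p ^ k"
  by (induction k) (auto simp: real_poly_mult)

lemma real_poly_sum: "real_poly (\<Sum>i \<in> A. f i) = (\<Sum>i \<in> A. real_poly (f i))"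
  by (induction A rule: infinite_finite_induct) (auto simp: real_poly_add)

lemma real_poly_of_nat: "real_poly (of_nat k) = of_nat k"
  by (rule poly_eqI) (simp add: coeff_map_poly of_nat_poly coeff_pCons split: nat.splits)

lemma real_poly_monom: "real_poly (monom 1 k) = monom 1 k"
  by (rule poly_eqI) (simp add: coeff_map_poly coeff_monom)

lemma real_poly_inject: "real_poly p = real_poly r \<Longrightarrow> p = r"
  by (rule poly_eqI) (metis coeff_map_poly of_int_0 of_int_eq_iff)

lemma infinite_evaluation_points: "infinite (range (\<lambda>N. 1 - 1 / of_nat (Suc N) :: real))"
  by (rule range_inj_infinite) (auto simp: inj_on_def)

text \<open>The points \<open>1 - 1/N\<close> are infinitely many, and these are the ones at which \<open>rothe_convolution\<close> is available.\<close>

lemma int_poly_eqI: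
  assumes "\<And>N. N \<ge> 1 \<Longrightarrow> poly (real_poly p) (1 - 1 / of_nat N) = poly (real_poly r) (1 - 1 / of_nat N)"
  shows "p = r"
proof -
  have "range (\<lambda>N. 1 - 1 / of_nat (Suc N)) \<subseteq> {x. poly (real_poly p - real_poly r) x = 0}"
    using assms by (auto simp del: of_nat_Suc)
  then have "infinite {x. poly (real_poly p - real_poly r) x = 0}"
    using infinite_evaluation_points infinite_super by blast
  then have "real_poly p - real_poly r = 0" using poly_roots_finite by blast
  then show ?thesis by (intro real_poly_inject) simp
qed

theorem theorem5p1:
  fixes n :: nat and q :: "int poly"
  assumes "n \<ge> 1"
    and "q = monom 1 1"
  shows "M_B n = (\<Sum>j = 0..(n - 1) div 2.
           of_nat (gamma_B n j) * q ^ j * (1 + q) ^ (n - 1 - 2 * j))"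
proof (rule int_poly_eqI)
  fix N :: nat assume N: "N \<ge> 1"
  define x :: real where "x = 1 - 1 / of_nat N"
  have B: "coxeter_elt n \<in> B_group n" using config_coxeter_elt[OF assms(1)] by (simp add: config_def)
  have "poly (real_poly (M_B n)) x = (\<Sum>ws \<in> max_chains n. x ^ bad n ws)"
    by (simp add: M_B_def real_poly_sum real_poly_monom poly_sum poly_monom)
  also have "\<dots> = chain_weight n x n (coxeter_elt n)"
    unfolding chain_weight_eq[OF B] max_chains_eq_refl_chains[OF len_T_coxeter_elt[OF assms(1)]] bad_def ..
  also have "\<dots> = (\<Prod>k < n. of_nat (n - k) + of_nat k * x)"
    by (rule chain_weight_coxeter_elt[OF assms(1) x_def N])
  also have "\<dots> = (\<Sum>j = 0..(n - 1) div 2. of_nat (gamma_B n j) * x ^ j * (1 + x) ^ (n - 1 - 2 * j))"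
    by (rule gamma_sum[OF assms(1), symmetric])
  also have "\<dots> = poly (real_poly (\<Sum>j = 0..(n - 1) div 2.
      of_nat (gamma_B n j) * q ^ j * (1 + q) ^ (n - 1 - 2 * j))) x"
    by (simp add: assms(2) real_poly_sum real_poly_mult real_poly_power real_poly_add real_poly_of_nat
        real_poly_monom poly_sum poly_monom poly_power)
  finally show "poly (real_poly (M_B n)) (1 - 1 / of_nat N) = poly (real_poly (\<Sum>j = 0..(n - 1) div 2.
      of_nat (gamma_B n j) * q ^ j * (1 + q) ^ (n - 1 - 2 * j))) (1 - 1 / of_nat N)"
    unfolding x_def .
qed

end
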